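(* Suppose $(\tau_1,\ldots,\tau_m)$ satisfies the density hypothesis with respect to $\mathcal{F}_\infty$: there exist a Borel probability measure $\mu$ on $[0,\infty]$ and a nonnegative $\mathcal{B}[0,\infty]^m\otimes\mathcal{F}_\infty$-measurable function $\gamma$ on $[0,\infty]^m\times\Omega$ such that $\mathbb{Q}[(\tau_1,\ldots,\tau_m)\in A\mid\mathcal{F}_\infty]=\int_A\gamma(t_1,\ldots,t_m)\,\mu^{\otimes m}(dt_1,\ldots,dt_m)$ for all $A\in\mathcal{B}[0,\infty]^m$. Then the $\mathbb{G}^m$-optional splitting formula holds at times $\tau_1,\ldots,\tau_m$ with respect to $\mathbb{F}$.
   Context: Let $(\Omega,\mathcal{A},\mathbb{Q})$ be a probability space with a right-continuous filtration $\mathbb{F}=(\mathcal{F}_t)_{t\ge0}$ such that $\mathcal{F}_0$ contains $\mathcal{N}^{\mathcal{F}_\infty}$, where for a $\sigma$-algebra $\mathcal{T}\subset\mathcal{A}$, $\mathcal{N}^{\mathcal{T}}$ denotes the $\sigma$-algebra generated by all subsets of $\mathcal{T}$-measurable $\mathbb{Q}$-null sets. Let $\tau_1,\ldots,\tau_m$ be $[0,\infty]$-valued random variables. Set $\mathbb{G}^0=\mathbb{F}$ and for $1\le k\le m$, $\mathcal{N}^k=\mathcal{N}^{\sigma(\tau_1)\vee\cdots\vee\sigma(\tau_k)\vee\mathcal{F}_\infty}$ and $\mathcal{G}^k_t=\mathcal{N}^k\vee\bigcap_{s>t}(\mathcal{G}^{k-1}_s\vee\sigma(\tau_k\wedge s))$.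 $\sigma_{m,1}\le\cdots\le\sigma_{m,m}$ denotes the increasing reordering of $\tau_1,\ldots,\tau_m$, with $\sigma_{m,0}=0$, $\sigma_{m,m+1}=\infty$. For $a,b\in[0,\infty]$, $a\nmid b=a$ if $a\le b$ and $=\infty$ if $a>b$. The $\mathbb{G}^m$-optional splitting formula holds at times $\tau_1,\ldots,\tau_m$ with respect to $\mathbb{F}$ if for every $\mathbb{G}^m$-optional $Y$ there exist $\mathcal{B}[0,\infty]^m\otimes\mathcal{O}(\mathbb{F})$-measurable functions $Y^{(0)},\ldots,Y^{(m)}$ on $[0,\infty]^m\times(\mathbb{R}_+\times\Omega)$ with $Y=\sum_{i=0}^mY^{(i)}(\tau_1\nmid\sigma_{m,i},\ldots,\tau_m\nmid\sigma_{m,i})\mathbf{1}_{[\sigma_{m,i},\sigma_{m,i+1})}$ up to indistinguishability outside an $\mathcal{N}^m$-measurable null set, where $Y^{(i)}(\Upsilon)(t,\omega)=Y^{(i)}(\Upsilon(\omega),t,\omega)$. *)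

theory Defs
  imports "HOL-Probability.Probability"
begin

text \<open>Time runs over [0,\<infinity>) as nonnegative reals; random times take values in
  [0,\<infinity>] = ennreal. The random times are indexed 0..<m (tau j stands for tau_(j+1)).
  sigma-algebras on Omega = space M are represented as set systems.\<close>

definition join_sa :: "'w set \<Rightarrow> 'w set set \<Rightarrow> 'w set set \<Rightarrow> 'w set set" where
  "join_sa \<Omega> A B = sigma_sets \<Omega> (A \<union> B)"

definition sig_of :: "'w measure \<Rightarrow> ('w \<Rightarrow> ennreal) \<Rightarrow> 'w set set" where
  "sig_of M f = {f -` B \<inter> space M | B. B \<in> sets (borel :: ennreal measure)}"

definition Finf :: "'w measure \<Rightarrow> (real \<Rightarrow> 'w set set) \<Rightarrow> 'w set set" where
  "Finf M F = sigma_sets (space M) (\<Union>t\<in>{0..}. F t)"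

definition null_sa :: "'w measure \<Rightarrow> 'w set set \<Rightarrow> 'w set set" where
  "null_sa M T = sigma_sets (space M)
     {N. \<exists>B\<in>T. N \<subseteq> B \<and> B \<in> sets M \<and> measure M B = 0}"

definition Nk :: "'w measure \<Rightarrow> (real \<Rightarrow> 'w set set) \<Rightarrow> (nat \<Rightarrow> 'w \<Rightarrow> ennreal) \<Rightarrow> nat \<Rightarrow> 'w set set" where
  "Nk M F \<tau> k = null_sa M (sigma_sets (space M) ((\<Union>j<k. sig_of M (\<tau> j)) \<union> Finf M F))"

fun Gk :: "'w measure \<Rightarrow> (real \<Rightarrow> 'w set set) \<Rightarrow> (nat \<Rightarrow> 'w \<Rightarrow> ennreal) \<Rightarrow> nat \<Rightarrow> real \<Rightarrow> 'w set set" where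
  "Gk M F \<tau> 0 t = F t"
| "Gk M F \<tau> (Suc k) t = join_sa (space M) (Nk M F \<tau> (Suc k))
     (\<Inter>s\<in>{t<..}. join_sa (space M) (Gk M F \<tau> k s) (sig_of M (\<lambda>\<omega>. min (\<tau> k \<omega>) (ennreal s))))"

definition std_filtration :: "'w measure \<Rightarrow> (real \<Rightarrow> 'w set set) \<Rightarrow> bool" where
  "std_filtration M F \<longleftrightarrow>
     (\<forall>t\<ge>0. sigma_algebra (space M) (F t) \<and> F t \<subseteq> sets M) \<and>
     (\<forall>s t. 0 \<le> s \<longrightarrow> s \<le> t \<longrightarrow> F s \<subseteq> F t)"

definition right_continuous_filtration :: "(real \<Rightarrow> 'w set set) \<Rightarrow> bool" where
  "right_continuous_filtration F \<longleftrightarrow> (\<forall>t\<ge>0. F t = (\<Inter>s\<in>{t<..}. F s))"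

definition adapted :: "'w measure \<Rightarrow> (real \<Rightarrow> 'w set set) \<Rightarrow> (real \<Rightarrow> 'w \<Rightarrow> real) \<Rightarrow> bool" where
  "adapted M G X \<longleftrightarrow> (\<forall>t\<ge>0. \<forall>U. open U \<longrightarrow> {\<omega>\<in>space M. X t \<omega> \<in> U} \<in> G t)"

definition cadlag :: "'w measure \<Rightarrow> (real \<Rightarrow> 'w \<Rightarrow> real) \<Rightarrow> bool" where
  "cadlag M X \<longleftrightarrow> (\<forall>\<omega>\<in>space M. \<forall>t\<ge>0.
      continuous (at_right t) (\<lambda>s. X s \<omega>) \<and>
      (t > 0 \<longrightarrow> (\<exists>l. ((\<lambda>s. X s \<omega>) \<longlongrightarrow> l) (at_left t))))"

definition optional_sets :: "'w measure \<Rightarrow> (real \<Rightarrow> 'w set set) \<Rightarrow> (real \<times> 'w) set set" where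
  "optional_sets M G = sigma_sets ({0..} \<times> space M)
     {{p \<in> {0..} \<times> space M. X (fst p) (snd p) \<in> U} | X U.
        adapted M G X \<and> cadlag M X \<and> open U}"

definition opt_measure :: "'w measure \<Rightarrow> (real \<Rightarrow> 'w set set) \<Rightarrow> (real \<times> 'w) measure" where
  "opt_measure M G = sigma ({0..} \<times> space M) (optional_sets M G)"

definition nmid :: "ennreal \<Rightarrow> ennreal \<Rightarrow> ennreal" where
  "nmid a b = (if a \<le> b then a else \<top>)"

definition ostat :: "nat \<Rightarrow> (nat \<Rightarrow> 'w \<Rightarrow> ennreal) \<Rightarrow> nat \<Rightarrow> 'w \<Rightarrow> ennreal" where
  "ostat m \<tau> i \<omega> = (if i = 0 then 0 else if i \<le> m
      then sort (map (\<lambda>j. \<tau> j \<omega>) [0..<m]) ! (i - 1) else \<top>)"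

definition optional_splitting :: "'w measure \<Rightarrow> (real \<Rightarrow> 'w set set) \<Rightarrow> (nat \<Rightarrow> 'w \<Rightarrow> ennreal) \<Rightarrow> nat \<Rightarrow> bool" where
  "optional_splitting M F \<tau> m \<longleftrightarrow>
    (\<forall>Y :: real \<Rightarrow> 'w \<Rightarrow> real.
      (\<lambda>(t, \<omega>). Y t \<omega>) \<in> borel_measurable (opt_measure M (Gk M F \<tau> m)) \<longrightarrow>
      (\<exists>Yi :: nat \<Rightarrow> (nat \<Rightarrow> ennreal) \<Rightarrow> real \<Rightarrow> 'w \<Rightarrow> real.
        (\<forall>i\<le>m. (\<lambda>(u, (t, \<omega>)). Yi i u t \<omega>) \<in>
            borel_measurable ((PiM {..<m} (\<lambda>_. (borel :: ennreal measure))) \<Otimes>\<^sub>M opt_measure M F)) \<and>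
        (\<exists>N \<in> Nk M F \<tau> m. (\<exists>B\<in>sets M. N \<subseteq> B \<and> measure M B = 0) \<and>
          (\<forall>\<omega>\<in>space M - N. \<forall>t\<ge>0.
             Y t \<omega> = (\<Sum>i\<le>m. Yi i (\<lambda>j\<in>{..<m}. nmid (\<tau> j \<omega>) (ostat m \<tau> i \<omega>)) t \<omega> *
                  (if ostat m \<tau> i \<omega> \<le> ennreal t \<and> ennreal t < ostat m \<tau> (Suc i) \<omega> then 1 else 0))))))"

end

theory Submission
  imports Defs
begin

text \<open>At a fixed time \<open>t\<close> a set of the enlarged \<open>\<sigma>\<close>-algebra is, up to a null set, of the form
  \<open>{\<omega>. (u, \<omega>) \<in> D}\<close>, where \<open>u\<close> lists the random times with those after \<open>t\<close> replaced by
  \<open>\<infinity>\<close> and all sections of \<open>D\<close> lie in \<open>F t\<close>. For a cadlag adapted \<open>X\<close> the set \<open>{X > a}\<close> is a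
  countable union of stochastic intervals \<open>[T, S)\<close> between passages of the rational skeleton of
  \<open>X\<close>, so it suffices to treat intervals \<open>[0, T)\<close>, where \<open>T u\<close> is a stopping time of \<open>F\<close> for each
  parameter \<open>u\<close>. Such an interval is the set where the right-continuous conditional probability
  of \<open>{T u \<ge> q}\<close> is positive for some rational \<open>q > t\<close>, outside a set with \<open>\<omega>\<close>-null sections for
  every \<open>u\<close>. Only here the density hypothesis enters: such a set is not charged by the joint
  law of the random times and \<open>\<omega>\<close>. On the event that the \<open>i\<close>-th order statistic is the last one up
  to \<open>t\<close>, replacing the times after \<open>t\<close> and after that order statistic is the same thing.\<close>

section \<open>First entrance\<close>

text \<open>The main obstacle is measurability in the parameter. For one fixed \<open>u\<close> the
  interval [0, T u) is optional, but all these intervals together must be measurable for the product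
  with the optional \<sigma>-algebra, and knowing each section of \<open>D\<close> gives no such
  product structure. Conditional probabilities of sections supply it: they respect complements and
  disjoint countable unions, so versions built up from rectangles are jointly measurable by
  construction. The price is an exceptional set that varies with \<open>u\<close>, and uncountably
  many \<open>u\<close> occur; it is therefore carried along as a subset of the product. Its
  sections must be null at every \<open>u\<close>, not just at almost every one, because the vector
  that is finally inserted has \<infinity> in place of the hidden times, and the law of the times
  need not charge such vectors. A second obstacle is that \<open>X r\<close> is described through
  the vector visible at \<open>r\<close>, while T needs one frozen \<open>u\<close>. Passages are
  therefore counted only at rational times \<open>r\<close> at which \<open>u\<close> can be the
  visible vector (\<open>settled\<close>).\<close>

abbreviation pos_rat :: "real set" where "pos_rat \<equiv> \<rat> \<inter> {0..}"

lemma countable_pos_rat: "countable pos_rat"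
  by (simp add: countable_rat countable_Int1)

locale usual_filtration = prob_space M for M :: "'w measure" +
  fixes F :: "real \<Rightarrow> 'w set set"
  assumes std: "std_filtration M F"
    and right_cont: "right_continuous_filtration F"
    and null: "null_sa M (Finf M F) \<subseteq> F 0"
begin

abbreviation FI :: "'w measure" where "FI \<equiv> sigma (space M) (Finf M F)"
abbreviation FF :: "real \<Rightarrow> 'w measure" where "FF t \<equiv> sigma (space M) (F t)"

lemma space_FI [simp]: "space FI = space M" and space_FF [simp]: "space (FF t) = space M"
  by (simp_all add: space_measure_of_conv)

lemma F_sigma_algebra: "t \<ge> 0 \<Longrightarrow> sigma_algebra (space M) (F t)"
  using std unfolding std_filtration_def by auto

lemma F_sets: "t \<ge> 0 \<Longrightarrow> A \<in> F t \<Longrightarrow> A \<in> sets M"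
  using std unfolding std_filtration_def by auto

lemma F_mono: "0 \<le> s \<Longrightarrow> s \<le> t \<Longrightarrow> A \<in> F s \<Longrightarrow> A \<in> F t"
  using std unfolding std_filtration_def by blast

lemma sets_FF: "t \<ge> 0 \<Longrightarrow> sets (FF t) = F t"
  using F_sigma_algebra[of t] by (rule sigma_algebra.sets_measure_of_eq)

lemma Finf_sigma_algebra: "sigma_algebra (space M) (Finf M F)"
  unfolding Finf_def
  by (rule sigma_algebra_sigma_sets) (auto dest!: F_sets sets.sets_into_space)

lemma sets_FI: "sets FI = Finf M F"
  using Finf_sigma_algebra by (rule sigma_algebra.sets_measure_of_eq)

lemma F_FI: "t \<ge> 0 \<Longrightarrow> A \<in> F t \<Longrightarrow> A \<in> sets FI"
  unfolding sets_FI unfolding Finf_def by auto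

lemma FI_sets: "A \<in> sets FI \<Longrightarrow> A \<in> sets M"
  unfolding sets_FI unfolding Finf_def
  by (rule subsetD[OF sets.sigma_sets_subset[of "\<Union>t\<in>{0..}. F t" M]]) (auto dest: F_sets)

lemma subalgebra_FI: "subalgebra M FI"
  unfolding subalgebra_def using FI_sets by auto

lemma subalgebra_FF: "t \<ge> 0 \<Longrightarrow> subalgebra M (FF t)"
  unfolding subalgebra_def using F_sets sets_FF by auto

lemma FF_subalgebra_FI: "t \<ge> 0 \<Longrightarrow> subalgebra FI (FF t)"
  unfolding subalgebra_def using F_FI sets_FF by auto

lemma FF_mono: "0 \<le> s \<Longrightarrow> s \<le> t \<Longrightarrow> subalgebra (FF t) (FF s)"
  unfolding subalgebra_def using F_mono sets_FF by (auto simp: subset_iff)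

lemma null_F:
  assumes "A \<in> sets FI" "emeasure M A = 0" "t \<ge> 0"
  shows "A \<in> F t"
proof -
  have "A \<in> null_sa M (Finf M F)"
    unfolding null_sa_def
    by (rule sigma_sets.Basic)
      (use assms FI_sets[of A] sets_FI in \<open>simp add: measure_def, intro bexI[of _ A], auto\<close>)
  then show ?thesis using null assms(3) F_mono by blast
qed

text \<open>The set where some \<open>P r\<close> occurs is split according to the first such time \<open>r\<close>; this is
  the common core of Doob's maximal inequality and of Dubins' upcrossing inequality.\<close>

lemma first_entrance_finite:
  assumes "finite I" "I \<subseteq> {0..}" "\<And>r. r \<in> I \<Longrightarrow> P r \<in> F r"
    and "sets N1 = sets M" "sets N2 = sets M"
    and "\<And>r B. r \<in> I \<Longrightarrow> B \<in> F r \<Longrightarrow> B \<subseteq> P r \<Longrightarrow> emeasure N1 B \<le> emeasure N2 B"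
  shows "emeasure N1 (\<Union>r\<in>I. P r) \<le> emeasure N2 (\<Union>r\<in>I. P r)"
  using assms(1-3,6)
proof (induction I rule: finite_linorder_max_induct)
  case empty
  then show ?case by simp
next
  case (insert b A)
  let ?U = "\<Union>r\<in>A. P r" and ?B = "P b - (\<Union>r\<in>A. P r)"
  have b: "b \<ge> 0" using insert by auto
  interpret Fb: sigma_algebra "space M" "F b" by (rule F_sigma_algebra[OF b])
  have PA: "P r \<in> F b" if "r \<in> A" for r
  proof (rule F_mono)
    show "0 \<le> r" "r \<le> b" "P r \<in> F r"
      using that insert.hyps(2) insert.prems(1,2) by (auto intro: less_imp_le)
  qed
  have U: "?U \<in> F b" using insert(1) PA by auto
  have B: "?B \<in> F b" using U insert by auto
  have s: "?U \<in> sets N1" "?U \<in> sets N2" "?B \<in> sets N1" "?B \<in> sets N2"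
    using U B F_sets[OF b] assms(4,5) by auto
  have eq: "(\<Union>r\<in>insert b A. P r) = ?U \<union> ?B" by auto
  have IH: "emeasure N1 ?U \<le> emeasure N2 ?U"
    by (rule insert.IH) (use insert.prems in auto)
  have "emeasure N1 (?U \<union> ?B) = emeasure N1 ?U + emeasure N1 ?B"
    by (intro plus_emeasure[symmetric] s) auto
  also have "\<dots> \<le> emeasure N2 ?U + emeasure N2 ?B"
    using insert.prems(3)[of b ?B] B IH by (intro add_mono) auto
  also have "\<dots> = emeasure N2 (?U \<union> ?B)"
    by (intro plus_emeasure s) auto
  finally show ?case unfolding eq .
qed

text \<open>Continuity from below along finite subsets of an enumeration of
  \<open>I\<close>.\<close>

lemma first_entrance:
  assumes "countable I" "I \<subseteq> {0..}" "\<And>r. r \<in> I \<Longrightarrow> P r \<in> F r"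
    and "sets N1 = sets M" "sets N2 = sets M"
    and "\<And>r B. r \<in> I \<Longrightarrow> B \<in> F r \<Longrightarrow> B \<subseteq> P r \<Longrightarrow> emeasure N1 B \<le> emeasure N2 B"
  shows "emeasure N1 (\<Union>r\<in>I. P r) \<le> emeasure N2 (\<Union>r\<in>I. P r)"
proof (cases "I = {}")
  case False
  define A where "A n = (\<Union>r\<in>from_nat_into I ` {..n}. P r)" for n :: nat
  have ran: "range (from_nat_into I) = I"
    using False assms(1) by (rule range_from_nat_into)
  have eq: "(\<Union>r\<in>I. P r) = (\<Union>n. A n)"
    unfolding A_def by (subst ran[symmetric], auto)
  have inc: "incseq A" unfolding A_def incseq_def by fastforce
  have sub: "from_nat_into I ` {..n} \<subseteq> I" for n using ran by auto
  have "P r \<in> sets M" if "r \<in> I" for r using that assms(2,3) F_sets[of r] by auto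
  then have "A n \<in> sets M" for n unfolding A_def using sub by blast
  then have s: "range A \<subseteq> sets N1" "range A \<subseteq> sets N2" using assms by auto
  have "emeasure N1 (A n) \<le> emeasure N2 (A n)" for n
    unfolding A_def using sub[of n] assms
    by (intro first_entrance_finite) auto
  then have "(SUP n. emeasure N1 (A n)) \<le> (SUP n. emeasure N2 (A n))"
    by (intro SUP_mono) auto
  then show ?thesis
    unfolding eq SUP_emeasure_incseq[OF s(1) inc] SUP_emeasure_incseq[OF s(2) inc] .
qed simp

section \<open>Maximal inequalities for conditional probabilities\<close>

text \<open>Only rational times are constrained, so that countably many versions suffice; the
  integral identity is the defining property of the conditional expectation of
  \<open>indicator C\<close>.\<close>

definition cond_prob_process :: "(real \<Rightarrow> 'w \<Rightarrow> real) \<Rightarrow> 'w set \<Rightarrow> bool" where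
  "cond_prob_process N C \<longleftrightarrow> (\<forall>r\<in>pos_rat. N r \<in> borel_measurable (FF r) \<and>
     (\<forall>\<omega>\<in>space M. 0 \<le> N r \<omega> \<and> N r \<omega> \<le> 1) \<and>
     (\<forall>B\<in>F r. (\<integral>\<^sup>+\<omega>. ennreal (N r \<omega>) * indicator B \<omega> \<partial>M) = emeasure M (C \<inter> B)))"

lemma cond_prob_processD:
  assumes "cond_prob_process N C" "r \<in> pos_rat"
  shows "N r \<in> borel_measurable (FF r)"
    and "\<omega> \<in> space M \<Longrightarrow> 0 \<le> N r \<omega>" "\<omega> \<in> space M \<Longrightarrow> N r \<omega> \<le> 1"
    and "B \<in> F r \<Longrightarrow> (\<integral>\<^sup>+\<omega>. ennreal (N r \<omega>) * indicator B \<omega> \<partial>M) = emeasure M (C \<inter> B)"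
  using assms unfolding cond_prob_process_def by blast+

text \<open>Doob's maximal inequality, with the restriction to \<open>C\<close> kept on the right.
  On a piece \<open>B\<close> of \<open>P r\<close> the density \<open>b\<close> is dominated by
  \<open>N r\<close>, whose integral over \<open>B\<close> is that of \<open>indicator C\<close>.
  The values are in \<open>ennreal\<close> so that infinite sums of processes are covered as
  well.\<close>

lemma cond_process_ge:
  fixes N :: "real \<Rightarrow> 'w \<Rightarrow> ennreal"
  assumes N: "\<And>r B. r \<in> pos_rat \<Longrightarrow> B \<in> F r \<Longrightarrow> (\<integral>\<^sup>+\<omega>. N r \<omega> * indicator B \<omega> \<partial>M) = emeasure M (C \<inter> B)"
    and C: "C \<in> sets M"
    and P: "\<And>r. r \<in> pos_rat \<Longrightarrow> P r \<in> F r"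
    and ge: "\<And>r \<omega>. r \<in> pos_rat \<Longrightarrow> \<omega> \<in> P r \<Longrightarrow> b \<le> N r \<omega>"
  shows "b * emeasure M (\<Union>r\<in>pos_rat. P r) \<le> emeasure M (C \<inter> (\<Union>r\<in>pos_rat. P r))"
proof -
  have Ps: "P r \<in> sets M" if "r \<in> pos_rat" for r using P[OF that] that F_sets[of r] by auto
  have U: "(\<Union>r\<in>pos_rat. P r) \<in> sets M"
    using Ps by (intro sets.countable_UN' countable_pos_rat) auto
  have "emeasure (density M (\<lambda>_. b)) (\<Union>r\<in>pos_rat. P r)
      \<le> emeasure (density M (indicator C)) (\<Union>r\<in>pos_rat. P r)"
  proof (rule first_entrance[OF countable_pos_rat])
    fix r B assume r: "r \<in> pos_rat" and B: "B \<in> F r" "B \<subseteq> P r"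
    have BM: "B \<in> sets M" using B r F_sets[of r] by auto
    have "emeasure (density M (\<lambda>_. b)) B = (\<integral>\<^sup>+\<omega>. b * indicator B \<omega> \<partial>M)"
      using BM by (simp add: emeasure_density)
    also have "\<dots> \<le> (\<integral>\<^sup>+\<omega>. N r \<omega> * indicator B \<omega> \<partial>M)"
      using ge[OF r] B(2) by (intro nn_integral_mono) (auto simp: indicator_def)
    also have "\<dots> = emeasure (density M (indicator C)) B"
      using C BM N[OF r B(1)] by (simp add: emeasure_restricted)
    finally show "emeasure (density M (\<lambda>_. b)) B \<le> emeasure (density M (indicator C)) B" .
  qed (use P in auto)
  then show ?thesis using C U by (simp add: emeasure_density_const emeasure_restricted)
qed

text \<open>The reverse comparison of the same two densities. Since \<open>C\<close> stays on the
  left, it bounds the part of \<open>C\<close> on which its own conditional probability has become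
  small.\<close>

lemma cond_process_le:
  fixes N :: "real \<Rightarrow> 'w \<Rightarrow> ennreal"
  assumes N: "\<And>r B. r \<in> pos_rat \<Longrightarrow> B \<in> F r \<Longrightarrow> (\<integral>\<^sup>+\<omega>. N r \<omega> * indicator B \<omega> \<partial>M) = emeasure M (C \<inter> B)"
    and C: "C \<in> sets M"
    and P: "\<And>r. r \<in> pos_rat \<Longrightarrow> P r \<in> F r"
    and le: "\<And>r \<omega>. r \<in> pos_rat \<Longrightarrow> \<omega> \<in> P r \<Longrightarrow> N r \<omega> \<le> a"
  shows "emeasure M (C \<inter> (\<Union>r\<in>pos_rat. P r)) \<le> a * emeasure M (\<Union>r\<in>pos_rat. P r)"
proof -
  have Ps: "P r \<in> sets M" if "r \<in> pos_rat" for r using P[OF that] that F_sets[of r] by auto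
  have U: "(\<Union>r\<in>pos_rat. P r) \<in> sets M"
    using Ps by (intro sets.countable_UN' countable_pos_rat) auto
  have "emeasure (density M (indicator C)) (\<Union>r\<in>pos_rat. P r)
      \<le> emeasure (density M (\<lambda>_. a)) (\<Union>r\<in>pos_rat. P r)"
  proof (rule first_entrance[OF countable_pos_rat])
    fix r B assume r: "r \<in> pos_rat" and B: "B \<in> F r" "B \<subseteq> P r"
    have BM: "B \<in> sets M" using B r F_sets[of r] by auto
    have "emeasure (density M (indicator C)) B = (\<integral>\<^sup>+\<omega>. N r \<omega> * indicator B \<omega> \<partial>M)"
      using C BM N[OF r B(1)] by (simp add: emeasure_restricted)
    also have "\<dots> \<le> (\<integral>\<^sup>+\<omega>. a * indicator B \<omega> \<partial>M)"
      using le[OF r] B(2) by (intro nn_integral_mono) (auto simp: indicator_def)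
    also have "\<dots> = emeasure (density M (\<lambda>_. a)) B"
      using BM by (simp add: emeasure_density)
    finally show "emeasure (density M (indicator C)) B \<le> emeasure (density M (\<lambda>_. a)) B" .
  qed (use P in auto)
  then show ?thesis using C U by (simp add: emeasure_density_const emeasure_restricted)
qed

end

section \<open>Regularity of paths along the rationals\<close>

text \<open>A chain of \<open>j\<close> entries ending at \<open>r\<close>, read as low, high, low
  and so on, so \<open>2 * k\<close> entries make \<open>k\<close> upcrossings. Recording the end
  point makes the event observable at time \<open>r\<close>. For \<open>a < b\<close> consecutive
  entries cannot coincide, so the weak inequality \<open>s \<le> r\<close> is harmless.\<close>

primrec alternates :: "real \<Rightarrow> real \<Rightarrow> (real \<Rightarrow> real) \<Rightarrow> nat \<Rightarrow> real \<Rightarrow> bool" where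
  "alternates a b g 0 r = True"
| "alternates a b g (Suc j) r =
    ((if even j then g r \<le> a else b \<le> g r) \<and> (\<exists>s\<in>pos_rat. s \<le> r \<and> alternates a b g j s))"

lemma pos_rat_between:
  assumes "0 \<le> x" "x < y"
  obtains r where "r \<in> pos_rat" "x < r" "r < y"
proof -
  obtain r where "r \<in> \<rat>" "x < r" "r < y" using Rats_dense_in_real[OF assms(2)] by auto
  with assms that[of r] show ?thesis by auto
qed

text \<open>A gap between \<open>Liminf\<close> and \<open>Limsup\<close> contains rationals
  \<open>a < b\<close>. Both lie strictly above a nonnegative \<open>Liminf\<close>, hence are
  positive, which is the range covered by the upcrossing estimate.\<close>

lemma limit_or_frequently_alternates:
  fixes g :: "real \<Rightarrow> real"
  assumes F: "F \<noteq> bot" and g: "\<And>r. 0 \<le> g r" "\<And>r. g r \<le> 1"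
    and ab: "\<And>a b. a \<in> \<rat> \<Longrightarrow> b \<in> \<rat> \<Longrightarrow> 0 < a \<Longrightarrow> a < b \<Longrightarrow>
      (\<forall>\<^sub>F r in F. a < g r) \<or> (\<forall>\<^sub>F r in F. g r < b)"
  shows "\<exists>l. (g \<longlongrightarrow> l) F"
proof -
  let ?L = "Liminf F (\<lambda>r. ereal (g r))" and ?U = "Limsup F (\<lambda>r. ereal (g r))"
  have L0: "0 \<le> ?L" using g by (intro Liminf_bounded) auto
  have U1: "?U \<le> 1" using g by (intro Limsup_bounded) auto
  have "?U \<le> ?L"
  proof (rule ccontr)
    assume "\<not> ?U \<le> ?L"
    then have lt: "?L < ?U" by simp
    obtain b where b: "?L < ereal (real_of_rat b)" "ereal (real_of_rat b) < ?U"
      using ereal_dense3[OF lt] by auto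
    obtain a where a: "?L < ereal (real_of_rat a)" "ereal (real_of_rat a) < ereal (real_of_rat b)"
      using ereal_dense3[OF b(1)] by auto
    have "0 < ereal (real_of_rat a)" using L0 a(1) by (rule le_less_trans)
    then have "(\<forall>\<^sub>F r in F. real_of_rat a < g r) \<or> (\<forall>\<^sub>F r in F. g r < real_of_rat b)"
      using a(2) by (intro ab) auto
    then show False
    proof
      assume "\<forall>\<^sub>F r in F. real_of_rat a < g r"
      then have "ereal (real_of_rat a) \<le> ?L"
        by (intro Liminf_bounded) (auto elim: eventually_mono)
      with a show False by simp
    next
      assume "\<forall>\<^sub>F r in F. g r < real_of_rat b"
      then have "?U \<le> ereal (real_of_rat b)"
        by (intro Limsup_bounded) (auto elim: eventually_mono)
      with b show False by simp
    qed
  qed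
  then have eq: "?L = ?U" by (intro antisym Liminf_le_Limsup F)
  have fin: "\<bar>?L\<bar> \<noteq> \<infinity>" using L0 U1 eq by auto
  have "((\<lambda>r. ereal (g r)) \<longlongrightarrow> ?L) F"
    using eq by (intro Liminf_eq_Limsup F) auto
  then have "((\<lambda>r. ereal (g r)) \<longlongrightarrow> ereal (real_of_ereal ?L)) F"
    using fin by (simp add: ereal_real)
  then show ?thesis by auto
qed

lemma eventually_right_rat:
  "(\<forall>\<^sub>F r in at t within (pos_rat \<inter> {t<..}). P r) \<longleftrightarrow> (\<exists>d>t. \<forall>r\<in>pos_rat. t < r \<longrightarrow> r < d \<longrightarrow> P r)"
proof
  assume "\<forall>\<^sub>F r in at t within (pos_rat \<inter> {t<..}). P r"
  then obtain d where d: "d > 0" "\<forall>x\<in>pos_rat \<inter> {t<..}. x \<noteq> t \<and> dist x t < d \<longrightarrow> P x"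
    unfolding eventually_at by auto
  then show "\<exists>d>t. \<forall>r\<in>pos_rat. t < r \<longrightarrow> r < d \<longrightarrow> P r"
    by (intro exI[of _ "t + d"]) (auto simp: dist_real_def)
next
  assume "\<exists>d>t. \<forall>r\<in>pos_rat. t < r \<longrightarrow> r < d \<longrightarrow> P r"
  then obtain d where "d > t" "\<forall>r\<in>pos_rat. t < r \<longrightarrow> r < d \<longrightarrow> P r" by auto
  then show "\<forall>\<^sub>F r in at t within (pos_rat \<inter> {t<..}). P r"
    unfolding eventually_at by (intro exI[of _ "d - t"]) (auto simp: dist_real_def)
qed

lemma eventually_left_rat:
  "(\<forall>\<^sub>F r in at t within (pos_rat \<inter> {..<t}). P r) \<longleftrightarrow> (\<exists>d<t. \<forall>r\<in>pos_rat. d < r \<longrightarrow> r < t \<longrightarrow> P r)"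
proof
  assume "\<forall>\<^sub>F r in at t within (pos_rat \<inter> {..<t}). P r"
  then obtain d where d: "d > 0" "\<forall>x\<in>pos_rat \<inter> {..<t}. x \<noteq> t \<and> dist x t < d \<longrightarrow> P x"
    unfolding eventually_at by auto
  then show "\<exists>d<t. \<forall>r\<in>pos_rat. d < r \<longrightarrow> r < t \<longrightarrow> P r"
    by (intro exI[of _ "t - d"]) (auto simp: dist_real_def)
next
  assume "\<exists>d<t. \<forall>r\<in>pos_rat. d < r \<longrightarrow> r < t \<longrightarrow> P r"
  then obtain d where "d < t" "\<forall>r\<in>pos_rat. d < r \<longrightarrow> r < t \<longrightarrow> P r" by auto
  then show "\<forall>\<^sub>F r in at t within (pos_rat \<inter> {..<t}). P r"
    unfolding eventually_at by (intro exI[of _ "t - d"]) (auto simp: dist_real_def)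
qed

lemma right_rat_nontrivial: "0 \<le> t \<Longrightarrow> at t within (pos_rat \<inter> {t<..}) \<noteq> bot"
  unfolding trivial_limit_def eventually_right_rat by (meson pos_rat_between)

lemma left_rat_nontrivial: "0 < t \<Longrightarrow> at t within (pos_rat \<inter> {..<t}) \<noteq> bot"
  unfolding trivial_limit_def eventually_left_rat
  by (metis dual_order.strict_trans linorder_not_le max.cobounded1 max.cobounded2 max_less_iff_conj
      order.strict_trans1 pos_rat_between)

text \<open>The bound \<open>j\<close> holds over the whole half-line at once; this is available
  because the bound on upcrossings of a conditional probability does not depend on a time
  horizon.\<close>

definition bounded_alternations :: "(real \<Rightarrow> real) \<Rightarrow> bool" where
  "bounded_alternations g \<longleftrightarrow>
     (\<forall>a\<in>\<rat>. \<forall>b\<in>\<rat>. 0 < a \<longrightarrow> a < b \<longrightarrow> (\<exists>j. \<forall>r\<in>pos_rat. \<not> alternates a b g j r))"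

lemma not_bounded_alternations:
  "\<not> bounded_alternations g \<longleftrightarrow>
     (\<exists>a b. a \<in> \<rat> \<and> b \<in> \<rat> \<and> 0 < a \<and> a < b \<and> (\<forall>j. \<exists>r\<in>pos_rat. alternates a b g j r))"
  unfolding bounded_alternations_def Ball_def Bex_def
  by (simp only: not_all not_imp not_ex not_not ex_simps)

lemma right_limit_rat:
  assumes g: "\<And>r. 0 \<le> g r" "\<And>r. g r \<le> 1" and alt: "bounded_alternations g" and t: "0 \<le> t"
  shows "\<exists>l. (g \<longlongrightarrow> l) (at t within (pos_rat \<inter> {t<..}))"
proof (rule limit_or_frequently_alternates[OF right_rat_nontrivial[OF t] g])
  fix a b :: real assume ab: "a \<in> \<rat>" "b \<in> \<rat>" "0 < a" "a < b"
  show "(\<forall>\<^sub>F r in at t within (pos_rat \<inter> {t<..}). a < g r) \<or>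
        (\<forall>\<^sub>F r in at t within (pos_rat \<inter> {t<..}). g r < b)"
  proof (rule ccontr)
    assume "\<not> ?thesis"
    then have low: "\<And>d. d > t \<Longrightarrow> \<exists>r\<in>pos_rat. t < r \<and> r < d \<and> g r \<le> a"
      and high: "\<And>d. d > t \<Longrightarrow> \<exists>r\<in>pos_rat. t < r \<and> r < d \<and> b \<le> g r"
      unfolding eventually_right_rat by (meson not_less)+
    \<comment> \<open>Alternations are counted from the left, but near \<open>t\<close> new ones can only be prepended;
      hence the claim is quantified over the chains that get extended.\<close>
    have ext: "\<exists>s>t. \<forall>i r. even i \<longrightarrow> r \<in> pos_rat \<longrightarrow> r \<le> s \<longrightarrow> alternates a b g i r \<longrightarrow>
            (\<exists>r'\<in>pos_rat. alternates a b g (i + 2 * j) r')" for j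
    proof (induction j)
      case 0
      show ?case by (intro exI[of _ "t + 1"]) auto
    next
      case (Suc j)
      then obtain s where s: "s > t" and IH: "\<And>i r. even i \<Longrightarrow> r \<in> pos_rat \<Longrightarrow> r \<le> s \<Longrightarrow>
        alternates a b g i r \<Longrightarrow> (\<exists>r'\<in>pos_rat. alternates a b g (i + 2 * j) r')" by blast
      obtain s2 where s2: "s2 \<in> pos_rat" "t < s2" "s2 < s" "b \<le> g s2" using high[OF s] by auto
      obtain s1 where s1: "s1 \<in> pos_rat" "t < s1" "s1 < s2" "g s1 \<le> a" using low[OF s2(2)] by auto
      show ?case
      proof (intro exI[of _ s1] conjI allI impI)
        fix i r assume i: "even i" "r \<in> pos_rat" "r \<le> s1" "alternates a b g i r"
        have "alternates a b g (Suc i) s1" using i s1 by auto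
        then have "alternates a b g (Suc (Suc i)) s2" using i(1) s1 s2
          by (subst alternates.simps) (auto intro: bexI[of _ s1])
        then show "\<exists>r'\<in>pos_rat. alternates a b g (i + 2 * Suc j) r'"
          using IH[of "Suc (Suc i)" s2] i(1) s2 by simp
      qed (rule s1)
    qed
    obtain j where j: "\<forall>r\<in>pos_rat. \<not> alternates a b g j r"
      using alt ab unfolding bounded_alternations_def by blast
    \<comment> \<open>Cutting off the last entries leaves a shorter chain, so a chain with
      \<open>2 * j\<close> entries contradicts the bound \<open>j\<close>.\<close>
    have down: "\<exists>s\<in>pos_rat. alternates a b g i s" if "r \<in> pos_rat" "alternates a b g (i + k) r" for i k r
      using that by (induction k arbitrary: r) auto
    obtain s where s: "s > t" "\<And>i r. even i \<Longrightarrow> r \<in> pos_rat \<Longrightarrow> r \<le> s \<Longrightarrow> alternates a b g i r \<Longrightarrow>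
            (\<exists>r'\<in>pos_rat. alternates a b g (i + 2 * j) r')" using ext[of j] by blast
    obtain r where "r \<in> pos_rat" "r < s" using pos_rat_between[OF t s(1)] by blast
    then obtain r' where "r' \<in> pos_rat" "alternates a b g (0 + 2 * j) r'" using s(2)[of 0 r] by auto
    then show False using down[of r' j j] j by (auto simp: mult_2)
  qed
qed

text \<open>To the left of \<open>t\<close> further oscillations come later in time and can be
  appended at the end of a chain, so a plain induction on its length suffices.\<close>

lemma left_limit_rat:
  assumes g: "\<And>r. 0 \<le> g r" "\<And>r. g r \<le> 1" and alt: "bounded_alternations g" and t: "0 < t"
  shows "\<exists>l. (g \<longlongrightarrow> l) (at t within (pos_rat \<inter> {..<t}))"
proof (rule limit_or_frequently_alternates[OF left_rat_nontrivial[OF t] g])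
  fix a b :: real assume ab: "a \<in> \<rat>" "b \<in> \<rat>" "0 < a" "a < b"
  show "(\<forall>\<^sub>F r in at t within (pos_rat \<inter> {..<t}). a < g r) \<or>
        (\<forall>\<^sub>F r in at t within (pos_rat \<inter> {..<t}). g r < b)"
  proof (rule ccontr)
    assume "\<not> ?thesis"
    then have low: "\<And>d. d < t \<Longrightarrow> \<exists>r\<in>pos_rat. d < r \<and> r < t \<and> g r \<le> a"
      and high: "\<And>d. d < t \<Longrightarrow> \<exists>r\<in>pos_rat. d < r \<and> r < t \<and> b \<le> g r"
      unfolding eventually_left_rat by (meson not_less)+
    have ext: "\<exists>r\<in>pos_rat. r < t \<and> alternates a b g j r" for j
    proof (induction j)
      case 0
      show ?case using t by (intro bexI[of _ 0]) auto
    next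
      case (Suc j)
      then obtain r where r: "r \<in> pos_rat" "r < t" "alternates a b g j r" by auto
      obtain s1 s2 where "s1 \<in> pos_rat" "r < s1" "s1 < t" "g s1 \<le> a"
         "s2 \<in> pos_rat" "r < s2" "s2 < t" "b \<le> g s2"
        using low[OF r(2)] high[OF r(2)] by auto
      then show ?case using r
        by (intro bexI[of _ "if even j then s1 else s2"]) (auto intro!: bexI[of _ r])
    qed
    obtain j where j: "\<forall>r\<in>pos_rat. \<not> alternates a b g j r"
      using alt ab unfolding bounded_alternations_def by blast
    then show False using ext[of j] by auto
  qed
qed

lemma continuous_at_right_iff:
  fixes f :: "real \<Rightarrow> real"
  shows "continuous (at_right t) f \<longleftrightarrow>
    (\<forall>e>0. \<exists>d>t. \<forall>s. t < s \<longrightarrow> s < d \<longrightarrow> \<bar>f s - f t\<bar> < e)"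
  unfolding continuous_within tendsto_iff eventually_at_right_field dist_real_def by auto

text \<open>Once the right limit exists at every time, a bound for \<open>g\<close> on the rationals
  of an interval is inherited by \<open>G\<close> there. Hence \<open>G\<close> is right continuous,
  and the left limit of \<open>g\<close> along the rationals is also the left limit of
  \<open>G\<close>.\<close>

lemma right_limit_regularization:
  fixes g :: "real \<Rightarrow> real"
  assumes g: "\<And>r. 0 \<le> g r" "\<And>r. g r \<le> 1" and alt: "bounded_alternations g"
  defines "G \<equiv> \<lambda>t. Lim (at t within (pos_rat \<inter> {t<..})) g"
  shows "0 \<le> t \<Longrightarrow> (g \<longlongrightarrow> G t) (at t within (pos_rat \<inter> {t<..}))"
    and "0 \<le> t \<Longrightarrow> continuous (at_right t) G"
    and "0 < t \<Longrightarrow> \<exists>l. (G \<longlongrightarrow> l) (at_left t)"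
    and "0 \<le> t \<Longrightarrow> 0 \<le> G t \<and> G t \<le> 1"
proof -
  have lim: "(g \<longlongrightarrow> G t) (at t within (pos_rat \<inter> {t<..}))" if t: "0 \<le> t" for t
    using right_limit_rat[OF g alt t] tendsto_Lim[OF right_rat_nontrivial[OF t]]
    unfolding G_def by metis
  then show "0 \<le> t \<Longrightarrow> (g \<longlongrightarrow> G t) (at t within (pos_rat \<inter> {t<..}))" .
  have close: "\<bar>G s - l\<bar> \<le> e"
    if s: "0 \<le> s" "s < d" and b: "\<And>r. r \<in> pos_rat \<Longrightarrow> s < r \<Longrightarrow> r < d \<Longrightarrow> \<bar>g r - l\<bar> \<le> e" for s d l e
  proof (rule tendsto_upperbound[OF _ _ right_rat_nontrivial[OF s(1)]])
    show "((\<lambda>r. \<bar>g r - l\<bar>) \<longlongrightarrow> \<bar>G s - l\<bar>) (at s within (pos_rat \<inter> {s<..}))"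
      by (intro tendsto_intros lim s)
    show "\<forall>\<^sub>F i in at s within pos_rat \<inter> {s<..}. \<bar>g i - l\<bar> \<le> e"
      unfolding eventually_right_rat using s(2) b by blast
  qed
  show "continuous (at_right t) G" if t: "0 \<le> t"
    unfolding continuous_at_right_iff
  proof (intro allI impI)
    fix e :: real assume e: "e > 0"
    then have "\<forall>\<^sub>F r in at t within (pos_rat \<inter> {t<..}). dist (g r) (G t) < e / 2"
      using lim[OF t] unfolding tendsto_iff by (meson half_gt_zero)
    then obtain d where d: "d > t" "\<And>r. r \<in> pos_rat \<Longrightarrow> t < r \<Longrightarrow> r < d \<Longrightarrow> \<bar>g r - G t\<bar> < e / 2"
      unfolding eventually_right_rat dist_real_def by blast
    show "\<exists>d>t. \<forall>s. t < s \<longrightarrow> s < d \<longrightarrow> \<bar>G s - G t\<bar> < e"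
    proof (intro exI[of _ d] conjI allI impI)
      fix s assume s: "t < s" "s < d"
      have "\<bar>G s - G t\<bar> \<le> e / 2"
        by (rule close[OF _ s(2)]) (use t s d(2) in \<open>auto intro!: less_imp_le\<close>)
      then show "\<bar>G s - G t\<bar> < e" using e by simp
    qed (rule d)
  qed
  show "\<exists>l. (G \<longlongrightarrow> l) (at_left t)" if t: "0 < t"
  proof -
    obtain l where l: "(g \<longlongrightarrow> l) (at t within (pos_rat \<inter> {..<t}))"
      using left_limit_rat[OF g alt t] by auto
    have "(G \<longlongrightarrow> l) (at_left t)"
      unfolding tendsto_iff
    proof (intro allI impI)
      fix e :: real assume e: "e > 0"
      then have "\<forall>\<^sub>F r in at t within (pos_rat \<inter> {..<t}). dist (g r) l < e / 2"
        using l unfolding tendsto_iff by (meson half_gt_zero)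
      then obtain d where d: "d < t" "\<And>r. r \<in> pos_rat \<Longrightarrow> d < r \<Longrightarrow> r < t \<Longrightarrow> \<bar>g r - l\<bar> < e / 2"
        unfolding eventually_left_rat dist_real_def by blast
      show "\<forall>\<^sub>F x in at_left t. dist (G x) l < e"
        unfolding eventually_at_left_field
      \<comment> \<open>The maximum keeps \<open>s\<close> nonnegative, where \<open>G s\<close> is
        known to be a limit.\<close>
      proof (intro exI[of _ "max d 0"] conjI allI impI)
        fix s assume s: "max d 0 < s" "s < t"
        have "\<bar>G s - l\<bar> \<le> e / 2"
          by (rule close[OF _ s(2)]) (use t s d(2) in \<open>auto intro!: less_imp_le\<close>)
        then show "dist (G s) l < e" using e by (simp add: dist_real_def)
      qed (use d t in auto)
    qed
    then show ?thesis by blast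
  qed
  show "0 \<le> G t \<and> G t \<le> 1" if t: "0 \<le> t"
    using tendsto_lowerbound[OF lim[OF t] _ right_rat_nontrivial[OF t], of 0]
      tendsto_upperbound[OF lim[OF t] _ right_rat_nontrivial[OF t], of 1] g by auto
qed

section \<open>Right-continuous versions of conditional probabilities\<close>

context usual_filtration begin

lemma ex_cond_prob_process:
  assumes C: "C \<in> sets M"
  shows "\<exists>N. cond_prob_process N C \<and> (\<forall>r \<omega>. 0 \<le> N r \<omega> \<and> N r \<omega> \<le> 1)"
proof (intro exI conjI)
  define f where "f r = nn_cond_exp M (FF r) (indicator C)" for r
  \<comment> \<open>A conditional expectation is at most 1 only almost everywhere. Truncation gives
    the bound at every point, as the pathwise lemmas require, and changes the version only on a null
    set.\<close>
  define N where "N r \<omega> = enn2real (min 1 (f r \<omega>))" for r \<omega>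
  show "\<forall>r \<omega>. 0 \<le> N r \<omega> \<and> N r \<omega> \<le> 1"
    unfolding N_def by (auto intro: enn2real_leI)
  show "cond_prob_process N C"
    unfolding cond_prob_process_def
  proof (intro ballI conjI)
    fix r assume r: "r \<in> pos_rat"
    interpret finite_measure_subalgebra M "FF r"
      using subalgebra_FF r by unfold_locales auto
    have fm: "f r \<in> borel_measurable (FF r)" unfolding f_def by simp
    show "N r \<in> borel_measurable (FF r)"
      unfolding N_def using fm by measurable
    show "0 \<le> N r \<omega>" "N r \<omega> \<le> 1" for \<omega>
      unfolding N_def by (auto intro: enn2real_leI)
    have "AE \<omega> in M. f r \<omega> \<le> nn_cond_exp M (FF r) (\<lambda>_. 1) \<omega>"
      unfolding f_def using C by (intro nn_cond_exp_mono) (auto simp: indicator_def)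
    moreover have "AE \<omega> in M. 1 = nn_cond_exp M (FF r) (\<lambda>_. 1) \<omega>"
      by (rule nn_cond_exp_F_meas) auto
    ultimately have AE: "AE \<omega> in M. ennreal (N r \<omega>) = f r \<omega>"
    proof eventually_elim
      case (elim \<omega>)
      then have "f r \<omega> \<le> 1" by simp
      then show ?case unfolding N_def
        by (simp add: min_absorb2 order_le_less_trans[of _ 1 top])
    qed
    fix B assume B: "B \<in> F r"
    then have BM: "B \<in> sets M" "B \<in> sets (FF r)" using r F_sets[of r] sets_FF by auto
    have "(\<integral>\<^sup>+\<omega>. ennreal (N r \<omega>) * indicator B \<omega> \<partial>M) = (\<integral>\<^sup>+\<omega>. indicator B \<omega> * f r \<omega> \<partial>M)"
      using AE by (intro nn_integral_cong_AE) (auto simp: mult.commute)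
    also have "\<dots> = (\<integral>\<^sup>+\<omega>. indicator B \<omega> * indicator C \<omega> \<partial>M)"
      unfolding f_def using C BM by (intro nn_cond_exp_intg) auto
    also have "\<dots> = emeasure M (C \<inter> B)"
      using C BM by (simp add: Int_commute flip: indicator_inter_arith)
    finally show "(\<integral>\<^sup>+\<omega>. ennreal (N r \<omega>) * indicator B \<omega> \<partial>M) = emeasure M (C \<inter> B)" .
  qed
qed

lemma borel_measurable_FF:
  assumes "cond_prob_process N C" "r \<in> pos_rat" "t \<ge> r"
  shows "N r \<in> borel_measurable (FF t)"
  by (rule measurable_from_subalg[OF FF_mono cond_prob_processD(1)[OF assms(1,2)]]) (use assms in auto)

text \<open>A chain ending at \<open>r\<close> looks only at earlier rational times; the induction
  treats all \<open>s \<le> r\<close> at once against the fixed \<sigma>-algebra at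
  \<open>r\<close>.\<close>

lemma alternates_measurable:
  assumes N: "cond_prob_process N C" and r: "r \<in> pos_rat"
  shows "{\<omega> \<in> space M. alternates a b (\<lambda>r. N r \<omega>) j r} \<in> F r"
proof -
  have "\<forall>s\<in>pos_rat. s \<le> r \<longrightarrow> {\<omega> \<in> space (FF r). alternates a b (\<lambda>r. N r \<omega>) j s} \<in> sets (FF r)" for j
  proof (induction j)
    case (Suc j)
    show ?case
    proof (intro ballI impI)
      fix s assume s: "s \<in> pos_rat" "s \<le> r"
      note [measurable] = borel_measurable_FF[OF N s]
      have [measurable]: "{\<omega> \<in> space (FF r). \<exists>q\<in>pos_rat \<inter> {..s}. alternates a b (\<lambda>r. N r \<omega>) j q} \<in> sets (FF r)"
        using Suc s by (intro sets.sets_Collect_countable_Ex' countable_Int1 countable_pos_rat) auto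
      have "{\<omega> \<in> space (FF r). alternates a b (\<lambda>r. N r \<omega>) (Suc j) s} =
        {\<omega> \<in> space (FF r). (if even j then N s \<omega> \<le> a else b \<le> N s \<omega>)} \<inter>
        {\<omega> \<in> space (FF r). \<exists>q\<in>pos_rat \<inter> {..s}. alternates a b (\<lambda>r. N r \<omega>) j q}" by auto
      also have "\<dots> \<in> sets (FF r)" by measurable
      finally show "{\<omega> \<in> space (FF r). alternates a b (\<lambda>r. N r \<omega>) (Suc j) s} \<in> sets (FF r)" .
    qed
  qed simp
  then show ?thesis using r sets_FF[of r] by auto
qed

text \<open>Dubins' inequality: both half-steps of an upcrossing are instances of the first entrance
  principle.\<close>

lemma dubins_upcrossing:
  assumes N: "cond_prob_process N C" and C: "C \<in> sets M" and ab: "0 < a" "a < b"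
  shows "measure M (\<Union>r\<in>pos_rat. {\<omega> \<in> space M. alternates a b (\<lambda>r. N r \<omega>) (2 * k) r}) \<le> (a / b) ^ k"
proof (induction k)
  case (Suc k)
  define E where "E j = (\<Union>r\<in>pos_rat. {\<omega> \<in> space M. alternates a b (\<lambda>r. N r \<omega>) j r})" for j
  have E: "E j \<in> sets M" for j
    unfolding E_def using alternates_measurable[OF N] F_sets
    by (intro sets.countable_UN' countable_pos_rat) auto
  have dec: "E (Suc j) \<subseteq> E j" for j unfolding E_def by auto
  \<comment> \<open>By parity a chain with \<open>Suc (2 * k)\<close> entries ends at a level at
    most \<open>a\<close> and one with two more than \<open>2 * k\<close> at a level at least
    \<open>b\<close>. The intersection with \<open>C\<close> links the two estimates and produces
    the factor \<open>a / b\<close>.\<close>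
  have "ennreal b * emeasure M (E (Suc (Suc (2 * k)))) \<le> emeasure M (C \<inter> E (Suc (Suc (2 * k))))"
    unfolding E_def
    by (rule cond_process_ge[OF cond_prob_processD(4)[OF N] C alternates_measurable[OF N]])
      (use ab in \<open>auto intro!: ennreal_leI\<close>)
  also have "\<dots> \<le> emeasure M (C \<inter> E (Suc (2 * k)))"
    using dec[of "Suc (2 * k)"] C E by (intro emeasure_mono) auto
  also have "\<dots> \<le> ennreal a * emeasure M (E (Suc (2 * k)))"
    unfolding E_def
    by (rule cond_process_le[OF cond_prob_processD(4)[OF N] C alternates_measurable[OF N]])
      (use ab in \<open>auto intro!: ennreal_leI\<close>)
  also have "\<dots> \<le> ennreal a * emeasure M (E (2 * k))"
    using dec[of "2 * k"] E by (intro mult_left_mono emeasure_mono) auto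
  finally have "b * measure M (E (2 * Suc k)) \<le> a * measure M (E (2 * k))"
    using ab by (simp add: emeasure_eq_measure flip: ennreal_mult)
  also have "\<dots> \<le> a * (a / b) ^ k" using Suc ab unfolding E_def by (intro mult_left_mono) auto
  finally have "measure M (E (2 * Suc k)) \<le> (a / b) ^ Suc k" using ab by (simp add: field_simps)
  then show ?case unfolding E_def .
qed simp

text \<open>For each of countably many pairs of levels, \<open>(a / b) ^ k\<close> tends to 0.
  Membership in \<open>FI\<close>, rather than in \<open>M\<close> alone, is what places this null
  set in \<open>F 0\<close>.\<close>

lemma AE_bounded_alternations:
  assumes N: "cond_prob_process N C" and C: "C \<in> sets M"
  shows "{\<omega> \<in> space M. \<not> bounded_alternations (\<lambda>r. N r \<omega>)} \<in> sets FI"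
    and "emeasure M {\<omega> \<in> space M. \<not> bounded_alternations (\<lambda>r. N r \<omega>)} = 0"
proof -
  define E where "E a b j = (\<Union>r\<in>pos_rat. {\<omega> \<in> space M. alternates a b (\<lambda>r. N r \<omega>) j r})" for a b j
  have E: "E a b j \<in> sets FI" for a b j
    unfolding E_def using alternates_measurable[OF N] F_FI
    by (intro sets.countable_UN' countable_pos_rat) auto
  let ?I = "{(a, b). a \<in> \<rat> \<and> b \<in> \<rat> \<and> 0 < a \<and> a < b}"
  have cI: "countable ?I"
    by (rule countable_subset[of _ "\<rat> \<times> \<rat>"]) (auto intro: countable_rat)
  have eq: "{\<omega> \<in> space M. \<not> bounded_alternations (\<lambda>r. N r \<omega>)} = (\<Union>(a,b)\<in>?I. \<Inter>j. E a b j)"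
  proof -
    define P where "P a b \<omega> \<longleftrightarrow> (\<forall>j. \<exists>r\<in>pos_rat. alternates a b (\<lambda>r. N r \<omega>) j r)" for a b \<omega>
    have "(\<Inter>j. E a b j) = {\<omega> \<in> space M. P a b \<omega>}" for a b
      unfolding E_def P_def by (auto simp del: Int_iff)
    then show ?thesis unfolding not_bounded_alternations P_def[symmetric] by auto
  qed
  have IE: "(\<Inter>j. E a b j) \<in> sets FI" for a b using E by auto
  show "{\<omega> \<in> space M. \<not> bounded_alternations (\<lambda>r. N r \<omega>)} \<in> sets FI"
    unfolding eq using IE by (intro sets.countable_UN' cI) auto
  have "(\<Inter>j. E a b j) \<in> null_sets M" if ab: "0 < a" "a < b" for a b
  proof -
    have le: "measure M (\<Inter>j. E a b j) \<le> (a / b) ^ k" for k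
    proof -
      have "measure M (\<Inter>j. E a b j) \<le> measure M (E a b (2 * k))"
        using FI_sets[OF E] by (intro finite_measure_mono) auto
      also have "\<dots> \<le> (a / b) ^ k" unfolding E_def by (rule dubins_upcrossing[OF N C ab])
      finally show ?thesis .
    qed
    have "(\<lambda>k. (a / b) ^ k) \<longlonglongrightarrow> 0" using ab by (intro LIMSEQ_power_zero) auto
    then have "measure M (\<Inter>j. E a b j) \<le> 0"
      by (rule tendsto_lowerbound) (use le in auto)
    then show ?thesis using FI_sets[OF IE] by (intro null_setsI) (auto simp: emeasure_eq_measure measure_le_0_iff)
  qed
  then have "(\<Union>(a,b)\<in>?I. \<Inter>j. E a b j) \<in> null_sets M"
    by (intro null_sets_UN' cI) auto
  then show "emeasure M {\<omega> \<in> space M. \<not> bounded_alternations (\<lambda>r. N r \<omega>)} = 0"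
    unfolding eq by auto
qed

lemma ex_rat_sequence_right:
  assumes t: "0 \<le> t" "t < s"
  obtains r where "\<And>n::nat. r n \<in> pos_rat" "\<And>n. t < r n" "\<And>n. r n < s" 
    "filterlim r (at t within (pos_rat \<inter> {t<..})) sequentially"
proof -
  have "\<exists>r. r \<in> pos_rat \<and> t < r \<and> r < min s (t + 1 / Suc n)" for n
    using pos_rat_between[OF t(1), of "min s (t + 1 / Suc n)"] t(2) by fastforce
  then obtain r where r: "\<And>n. r n \<in> pos_rat" "\<And>n. t < r n" "\<And>n. r n < min s (t + 1 / Suc n)" by metis
  have "r \<longlonglongrightarrow> t"
  proof (rule tendsto_sandwich)
    show "\<forall>\<^sub>F n in sequentially. t \<le> r n" using r(2) by (intro always_eventually allI less_imp_le)
    show "\<forall>\<^sub>F n in sequentially. r n \<le> t + 1 / Suc n" using r(3) by (intro always_eventually allI less_imp_le) auto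
    show "(\<lambda>n. t + 1 / real (Suc n)) \<longlonglongrightarrow> t"
      using tendsto_add[OF tendsto_const LIMSEQ_inverse_real_of_nat, of t] by (simp add: inverse_eq_divide)
  qed simp
  then have "filterlim r (at t within (pos_rat \<inter> {t<..})) sequentially"
    unfolding filterlim_at using r by (auto intro!: always_eventually simp: less_imp_neq)
  moreover have "r n < s" for n using r(3)[of n] by simp
  ultimately show ?thesis by (rule that[OF r(1,2), rotated])
qed

lemma F_right_cont: "0 \<le> t \<Longrightarrow> (\<And>s. t < s \<Longrightarrow> A \<in> F s) \<Longrightarrow> A \<in> F t"
  using right_cont unfolding right_continuous_filtration_def by blast

lemma borel_measurable_FF_right_cont:
  fixes f :: "'w \<Rightarrow> real"
  assumes t: "0 \<le> t" and f: "\<And>s. t < s \<Longrightarrow> f \<in> borel_measurable (FF s)"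
  shows "f \<in> borel_measurable (FF t)"
proof (rule measurableI)
  fix A :: "real set" assume A: "A \<in> sets borel"
  have "f -` A \<inter> space M \<in> F t"
  proof (rule F_right_cont[OF t])
    fix s assume s: "t < s"
    then show "f -` A \<inter> space M \<in> F s"
      using measurable_sets[OF f[OF s] A] t sets_FF[of s] by auto
  qed
  then show "f -` A \<inter> space (FF t) \<in> sets (FF t)" using sets_FF[OF t] by auto
qed simp

text \<open>Right limits along the rationals, after the paths on the null set \<open>Bad\<close>
  have been replaced by 0. Both usual conditions enter: \<open>Bad\<close> lies in every
  \<open>F t\<close>, so the replacement stays adapted, and right continuity of the filtration makes
  the limit \<open>G t\<close> measurable at time \<open>t\<close>.\<close>

theorem cadlag_cond_prob_process:
  assumes C: "C \<in> sets M"
  obtains N where "cond_prob_process N C" "cadlag M N" "adapted M F N"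
proof -
  obtain N where N: "cond_prob_process N C" and N01: "\<And>r \<omega>. 0 \<le> N r \<omega>" "\<And>r \<omega>. N r \<omega> \<le> 1"
    using ex_cond_prob_process[OF C] by blast
  define Bad where "Bad = {\<omega> \<in> space M. \<not> bounded_alternations (\<lambda>r. N r \<omega>)}"
  have Bad: "Bad \<in> sets FI" "emeasure M Bad = 0"
    unfolding Bad_def using AE_bounded_alternations[OF N C] by auto
  define g where "g \<omega> r = (if \<omega> \<in> Bad then 0 else N r \<omega>)" for \<omega> r
  have g01: "0 \<le> g \<omega> r" "g \<omega> r \<le> 1" for \<omega> r unfolding g_def using N01 by auto
  \<comment> \<open>The second entry of a chain would have to be at least
    \<open>b > 0\<close>.\<close>
  have alt0: "bounded_alternations (\<lambda>r. 0)"
    unfolding bounded_alternations_def by (auto intro!: exI[of _ 2] simp: numeral_2_eq_2)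
  have alt: "bounded_alternations (g \<omega>)" if "\<omega> \<in> space M" for \<omega>
    using that alt0 unfolding g_def Bad_def by (cases "bounded_alternations (\<lambda>r. N r \<omega>)") auto
  define G where "G t \<omega> = Lim (at t within (pos_rat \<inter> {t<..})) (g \<omega>)" for t \<omega>
  note reg = right_limit_regularization[OF g01 alt, folded G_def]
  have "cadlag M G" unfolding cadlag_def using reg(2,3) by auto
  have gm: "(\<lambda>\<omega>. g \<omega> r) \<in> borel_measurable (FF s)" if r: "r \<in> pos_rat" "r \<le> s" for r s
  proof -
    have [measurable]: "Bad \<in> sets (FF s)" "N r \<in> borel_measurable (FF s)"
      using null_F[OF Bad, of s] borel_measurable_FF[OF N r] sets_FF[of s] r by auto
    show ?thesis unfolding g_def by measurable
  qed
  have Gm: "G t \<in> borel_measurable (FF t)" if t: "0 \<le> t" for t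
  proof (rule borel_measurable_FF_right_cont[OF t])
    fix s assume s: "t < s"
    obtain r where r: "\<And>n::nat. r n \<in> pos_rat" "\<And>n. r n < s"
      "filterlim r (at t within (pos_rat \<inter> {t<..})) sequentially"
      using ex_rat_sequence_right[OF t s] by metis
    show "G t \<in> borel_measurable (FF s)"
    proof (rule borel_measurable_LIMSEQ_real)
      show "(\<lambda>n. g \<omega> (r n)) \<longlonglongrightarrow> G t \<omega>" if "\<omega> \<in> space (FF s)" for \<omega>
        using filterlim_compose[OF reg(1)[OF _ t] r(3)] that by auto
      show "(\<lambda>\<omega>. g \<omega> (r n)) \<in> borel_measurable (FF s)" for n
        by (rule gm[OF r(1) less_imp_le[OF r(2)]])
    qed
  qed
  have "adapted M F G"
    unfolding adapted_def
  proof (intro allI impI)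
    fix t :: real and U :: "real set" assume t: "0 \<le> t" and U: "open U"
    then have "G t -` U \<inter> space (FF t) \<in> sets (FF t)"
      by (intro measurable_sets[OF Gm[OF t]]) auto
    then show "{\<omega> \<in> space M. G t \<omega> \<in> U} \<in> F t"
      using sets_FF[OF t] by (simp add: vimage_def Int_def conj_commute)
  qed
  have "cond_prob_process G C"
    unfolding cond_prob_process_def
  proof (intro ballI conjI)
    fix t assume "t \<in> pos_rat"
    then have t: "0 \<le> t" by auto
    show "G t \<in> borel_measurable (FF t)" using Gm[OF t] .
    show "0 \<le> G t \<omega>" "G t \<omega> \<le> 1" if "\<omega> \<in> space M" for \<omega> using reg(4)[OF that t] by auto
    fix B assume B: "B \<in> F t"
    obtain r where r: "\<And>n::nat. r n \<in> pos_rat" "\<And>n. t < r n"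
      "filterlim r (at t within (pos_rat \<inter> {t<..})) sequentially"
      using ex_rat_sequence_right[OF t, of "t + 1"] by (metis less_add_one)
    have BM: "B \<in> sets M" using B F_sets t by auto
    have gM: "(\<lambda>\<omega>. g \<omega> (r n)) \<in> borel_measurable M" for n
      using measurable_from_subalg[OF subalgebra_FF gm[OF r(1)]] r(1)[of n] by auto
    have GM: "G t \<in> borel_measurable M"
      using measurable_from_subalg[OF subalgebra_FF[OF t] Gm[OF t]] .
    \<comment> \<open>As \<open>B\<close> lies in every \<open>F (r n)\<close>, these integrals do
      not depend on \<open>n\<close>; dominated convergence then evaluates the integral of the right
      limit.\<close>
    have eq: "(\<integral>\<^sup>+\<omega>. ennreal (g \<omega> (r n)) * indicator B \<omega> \<partial>M) = emeasure M (C \<inter> B)" for n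
    proof -
      have "AE \<omega> in M. \<omega> \<notin> Bad" using Bad FI_sets by (intro AE_not_in) auto
      then have "(\<integral>\<^sup>+\<omega>. ennreal (g \<omega> (r n)) * indicator B \<omega> \<partial>M) = (\<integral>\<^sup>+\<omega>. ennreal (N (r n) \<omega>) * indicator B \<omega> \<partial>M)"
        by (intro nn_integral_cong_AE) (auto simp: g_def)
      also have "\<dots> = emeasure M (C \<inter> B)"
        using N r(1)[of n] F_mono[OF t less_imp_le[OF r(2)] B, of n] unfolding cond_prob_process_def by auto
      finally show ?thesis .
    qed
    have "(\<lambda>n. \<integral>\<^sup>+\<omega>. ennreal (g \<omega> (r n)) * indicator B \<omega> \<partial>M) \<longlonglongrightarrow>
      (\<integral>\<^sup>+\<omega>. ennreal (G t \<omega>) * indicator B \<omega> \<partial>M)"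
    proof (rule nn_integral_dominated_convergence[where w = "\<lambda>_. 1"])
      show "AE \<omega> in M. (\<lambda>n. ennreal (g \<omega> (r n)) * indicator B \<omega>) \<longlonglongrightarrow> ennreal (G t \<omega>) * indicator B \<omega>"
      proof (rule AE_I2)
        fix \<omega> assume "\<omega> \<in> space M"
        then have "(\<lambda>n. g \<omega> (r n)) \<longlonglongrightarrow> G t \<omega>" using filterlim_compose[OF reg(1)[OF _ t] r(3)] by auto
        then show "(\<lambda>n. ennreal (g \<omega> (r n)) * indicator B \<omega>) \<longlonglongrightarrow> ennreal (G t \<omega>) * indicator B \<omega>"
          by (auto simp: indicator_def intro!: tendsto_ennrealI)
      qed
    qed (use gM GM BM g01 in \<open>auto simp: indicator_def emeasure_space_1\<close>)
    then show "(\<integral>\<^sup>+\<omega>. ennreal (G t \<omega>) * indicator B \<omega> \<partial>M) = emeasure M (C \<inter> B)"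
      unfolding eq by (simp add: LIMSEQ_const_iff)
  qed
  with \<open>cadlag M G\<close> \<open>adapted M F G\<close> show ?thesis using that by blast
qed

end

section \<open>The optional sigma-algebra and sums of conditional probabilities\<close>

context usual_filtration begin

lemma space_opt: "space (opt_measure M G) = {0..} \<times> space M"
  unfolding opt_measure_def by (simp add: space_measure_of_conv)

lemma sets_opt: "sets (opt_measure M G) = optional_sets M G"
proof -
  have "sigma_algebra ({0..} \<times> space M) (optional_sets M G)"
    unfolding optional_sets_def by (rule sigma_algebra_sigma_sets) auto
  then show ?thesis unfolding opt_measure_def by (rule sigma_algebra.sets_measure_of_eq)
qed

lemma borel_measurable_opt:
  assumes "adapted M G X" "cadlag M X"
  shows "(\<lambda>(t, \<omega>). X t \<omega>) \<in> borel_measurable (opt_measure M G)"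
proof (rule borel_measurableI)
  fix U :: "real set" assume U: "open U"
  have "(\<lambda>(t, \<omega>). X t \<omega>) -` U \<inter> space (opt_measure M G) = {p \<in> {0..} \<times> space M. X (fst p) (snd p) \<in> U}"
    by (auto simp: space_opt)
  also have "\<dots> \<in> sets (opt_measure M G)"
    unfolding sets_opt optional_sets_def using assms U by (intro sigma_sets.Basic) blast
  finally show "(\<lambda>(t, \<omega>). X t \<omega>) -` U \<inter> space (opt_measure M G) \<in> sets (opt_measure M G)" .
qed

text \<open>Optional processes are adapted; on a generator this is adaptedness of the generating
  process.\<close>

lemma measurable_opt_section:
  assumes t: "0 \<le> t"
  shows "(\<lambda>\<omega>. (t, \<omega>)) \<in> FF t \<rightarrow>\<^sub>M opt_measure M F"
proof (rule measurable_sigma_sets)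
  show "sets (opt_measure M F) = sigma_sets ({0..} \<times> space M)
     {{p \<in> {0..} \<times> space M. X (fst p) (snd p) \<in> U} | X U. adapted M F X \<and> cadlag M X \<and> open U}"
    unfolding sets_opt optional_sets_def ..
next
  fix A assume "A \<in> {{p \<in> {0..} \<times> space M. X (fst p) (snd p) \<in> U} | X U. adapted M F X \<and> cadlag M X \<and> open U}"
  then obtain X and U :: "real set" where A: "A = {p \<in> {0..} \<times> space M. X (fst p) (snd p) \<in> U}"
    and X: "adapted M F X" and U: "open U" by blast
  have "Pair t -` A \<inter> space (FF t) = {\<omega> \<in> space M. X t \<omega> \<in> U}" unfolding A using t by auto
  also have "\<dots> \<in> sets (FF t)" using X U t sets_FF[OF t] unfolding adapted_def by auto
  finally show "Pair t -` A \<inter> space (FF t) \<in> sets (FF t)" .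
qed (use t in auto)

text \<open>With \<open>u\<close> frozen the section is adapted. With \<open>u\<close> varying,
  measurability is joint with \<open>FI\<close>, which is what the exceptional sets call
  for.\<close>

lemma measurable_param_section:
  assumes N: "(\<lambda>(u, t, \<omega>). N u t \<omega>) \<in> borel_measurable (S \<Otimes>\<^sub>M opt_measure M F)"
    and t: "0 \<le> t"
  shows "u \<in> space S \<Longrightarrow> N u t \<in> borel_measurable (FF t)"
    and "(\<lambda>(u, \<omega>). N u t \<omega>) \<in> borel_measurable (S \<Otimes>\<^sub>M FI)"
proof -
  note [measurable] = measurable_opt_section[OF t] measurable_from_subalg[OF FF_subalgebra_FI[OF t] measurable_opt_section[OF t]] N
  have "(\<lambda>\<omega>. (u, t, \<omega>)) \<in> FF t \<rightarrow>\<^sub>M S \<Otimes>\<^sub>M opt_measure M F" if [simp]: "u \<in> space S"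
    by (rule measurable_Pair) auto
  from measurable_comp[OF this N] show "u \<in> space S \<Longrightarrow> N u t \<in> borel_measurable (FF t)"
    by (simp add: comp_def)
  have "(\<lambda>p. (fst p, (t, snd p))) \<in> S \<Otimes>\<^sub>M FI \<rightarrow>\<^sub>M S \<Otimes>\<^sub>M opt_measure M F"
    by (intro measurable_Pair measurable_fst measurable_compose[OF measurable_snd
          measurable_from_subalg[OF FF_subalgebra_FI[OF t] measurable_opt_section[OF t]]])
  from measurable_comp[OF this N] show "(\<lambda>(u, \<omega>). N u t \<omega>) \<in> borel_measurable (S \<Otimes>\<^sub>M FI)"
    by (simp add: comp_def split_beta')
qed

lemma cond_prob_process_compl:
  assumes N: "cond_prob_process N C" and C: "C \<in> sets M"
  shows "cond_prob_process (\<lambda>t \<omega>. 1 - N t \<omega>) (space M - C)"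
  unfolding cond_prob_process_def
proof (intro ballI conjI)
  fix r assume r: "r \<in> pos_rat"
  note D = cond_prob_processD[OF N r]
  note [measurable] = D(1)
  have NM [measurable]: "N r \<in> borel_measurable M"
    using measurable_from_subalg[OF subalgebra_FF D(1)] r by auto
  show "(\<lambda>\<omega>. 1 - N r \<omega>) \<in> borel_measurable (FF r)" by measurable
  show "0 \<le> 1 - N r \<omega>" "1 - N r \<omega> \<le> 1" if "\<omega> \<in> space M" for \<omega> using D(2,3)[OF that] by auto
  fix B assume B: "B \<in> F r"
  have BM [measurable]: "B \<in> sets M" using B F_sets r by auto
  note C [measurable]
  have "emeasure M (C \<inter> B) + (\<integral>\<^sup>+\<omega>. ennreal (1 - N r \<omega>) * indicator B \<omega> \<partial>M) =
    (\<integral>\<^sup>+\<omega>. ennreal (N r \<omega>) * indicator B \<omega> + ennreal (1 - N r \<omega>) * indicator B \<omega> \<partial>M)"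
    unfolding D(4)[OF B, symmetric] by (intro nn_integral_add[symmetric]) measurable
  also have "\<dots> = (\<integral>\<^sup>+\<omega>. indicator B \<omega> \<partial>M)"
    using D(2,3) by (intro nn_integral_cong) (auto simp: indicator_def simp flip: ennreal_plus)
  also have "\<dots> = emeasure M ((C \<inter> B) \<union> ((space M - C) \<inter> B))"
    using sets.sets_into_space[OF BM] by (simp add: Int_absorb1 flip: Int_Un_distrib2) (auto intro!: arg_cong[where f = "emeasure M"])
  also have "\<dots> = emeasure M (C \<inter> B) + emeasure M ((space M - C) \<inter> B)"
    by (intro plus_emeasure[symmetric]) auto
  finally show "(\<integral>\<^sup>+\<omega>. ennreal (1 - N r \<omega>) * indicator B \<omega> \<partial>M) = emeasure M ((space M - C) \<inter> B)"
    by (simp add: emeasure_eq_measure ennreal_add_left_cancel)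
qed

section \<open>Series of conditional probabilities of disjoint events\<close>

text \<open>Monotone convergence and countable additivity. The series is kept in
  \<open>ennreal\<close> because its pointwise convergence to a real number is not yet
  known.\<close>

lemma cond_prob_processes_sum:
  fixes N :: "nat \<Rightarrow> real \<Rightarrow> 'w \<Rightarrow> real"
  assumes N: "\<And>k. cond_prob_process (N k) (C k)" and C: "\<And>k. C k \<in> sets M" and dis: "disjoint_family C"
    and r: "r \<in> pos_rat" and B: "B \<in> F r"
  shows "(\<integral>\<^sup>+\<omega>. (\<Sum>k. ennreal (N k r \<omega>)) * indicator B \<omega> \<partial>M) = emeasure M ((\<Union>k. C k) \<inter> B)"
proof -
  have BM [measurable]: "B \<in> sets M" using B F_sets r by auto
  have NM [measurable]: "N k r \<in> borel_measurable M" for k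
    using measurable_from_subalg[OF subalgebra_FF cond_prob_processD(1)[OF N r]] r by auto
  have "(\<integral>\<^sup>+\<omega>. (\<Sum>k. ennreal (N k r \<omega>)) * indicator B \<omega> \<partial>M) =
     (\<integral>\<^sup>+\<omega>. (\<Sum>k. ennreal (N k r \<omega>) * indicator B \<omega>) \<partial>M)"
    by simp
  also have "\<dots> = (\<Sum>k. \<integral>\<^sup>+\<omega>. ennreal (N k r \<omega>) * indicator B \<omega> \<partial>M)"
    by (rule nn_integral_suminf) measurable
  also have "\<dots> = (\<Sum>k. emeasure M (C k \<inter> B))"
    by (simp add: cond_prob_processD(4)[OF N r B])
  also have "\<dots> = emeasure M (\<Union>k. C k \<inter> B)"
    using C dis BM by (intro suminf_emeasure) (auto simp: disjoint_family_on_def)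
  also have "(\<Union>k. C k \<inter> B) = (\<Union>k. C k) \<inter> B" by auto
  finally show ?thesis .
qed

lemma cond_prob_processes_sum_measurable:
  fixes N :: "nat \<Rightarrow> real \<Rightarrow> 'w \<Rightarrow> real"
  assumes N: "\<And>k. cond_prob_process (N k) (C k)" and r: "r \<in> pos_rat"
  shows "{\<omega> \<in> space M. c \<le> (\<Sum>k. ennreal (N k r \<omega>))} \<in> F r"
proof -
  note [measurable] = cond_prob_processD(1)[OF N r]
  have "{\<omega> \<in> space (FF r). c \<le> (\<Sum>k. ennreal (N k r \<omega>))} \<in> sets (FF r)" by measurable
  then show ?thesis using sets_FF[of r] r by auto
qed

lemma cond_prob_processes_sum_bound:
  fixes N :: "nat \<Rightarrow> real \<Rightarrow> 'w \<Rightarrow> real"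
  assumes N: "\<And>k. cond_prob_process (N k) (C k)" and C: "\<And>k. C k \<in> sets M" and dis: "disjoint_family C"
  shows "c * emeasure M (\<Union>r\<in>pos_rat. {\<omega> \<in> space M. c \<le> (\<Sum>k. ennreal (N k r \<omega>))})
    \<le> emeasure M ((\<Union>k. C k) \<inter> (\<Union>r\<in>pos_rat. {\<omega> \<in> space M. c \<le> (\<Sum>k. ennreal (N k r \<omega>))}))"
  using C cond_prob_processes_sum_measurable[OF N]
  by (intro cond_process_ge[OF cond_prob_processes_sum[OF N C dis]]) auto

lemma scaled_emeasure_le:
  assumes "0 \<le> c" "ennreal c * emeasure M A \<le> emeasure M B"
  shows "c * measure M A \<le> measure M B"
  using assms by (simp add: emeasure_eq_measure flip: ennreal_mult)

text \<open>The maximal inequality makes the series converge uniformly in time. At a level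
  \<open>c > 1\<close> it reads c times the measure of \<open>T 0 c\<close> is at most that measure,
  so the set is null. For tails, the measure of the disjoint events from index \<open>n\<close> on
  tends to 0, so almost surely every level \<open>1 / Suc j\<close> is eventually not exceeded at
  any rational time.\<close>

lemma AE_cond_prob_processes_sum:
  fixes N :: "nat \<Rightarrow> real \<Rightarrow> 'w \<Rightarrow> real"
  assumes N: "\<And>k. cond_prob_process (N k) (C k)" and C: "\<And>k. C k \<in> sets M" and dis: "disjoint_family C"
  shows "AE \<omega> in M. \<forall>r\<in>pos_rat. (\<Sum>k. ennreal (N k r \<omega>)) \<le> 1"
    and "AE \<omega> in M. \<forall>j. \<exists>n. \<forall>r\<in>pos_rat. (\<Sum>k. ennreal (N (k + n) r \<omega>)) \<le> ennreal (1 / Suc j)"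
proof -
  define T where "T n c = (\<Union>r\<in>pos_rat. {\<omega> \<in> space M. c \<le> (\<Sum>k. ennreal (N (k + n) r \<omega>))})" for n c
  have dis': "disjoint_family (\<lambda>k. C (k + n))" for n
    using dis unfolding disjoint_family_on_def by auto
  have T: "T n c \<in> sets M" for n c
    unfolding T_def using cond_prob_processes_sum_measurable[of "\<lambda>k. N (k + n)" "\<lambda>k. C (k + n)", OF N] F_sets
    by (intro sets.countable_UN' countable_pos_rat) auto
  have le: "c * emeasure M (T n c) \<le> emeasure M ((\<Union>k. C (k + n)) \<inter> T n c)" for n c
    unfolding T_def by (rule cond_prob_processes_sum_bound[OF N C dis'])
  have "emeasure M (T 0 (ennreal (1 + 1 / Suc j))) = 0" for j
  proof -
    have "ennreal (1 + 1 / Suc j) * emeasure M (T 0 (ennreal (1 + 1 / Suc j))) \<le> emeasure M (T 0 (ennreal (1 + 1 / Suc j)))"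
      by (rule order_trans[OF le]) (intro emeasure_mono T, auto)
    then have "(1 + 1 / Suc j) * measure M (T 0 (ennreal (1 + 1 / Suc j))) \<le> measure M (T 0 (ennreal (1 + 1 / Suc j)))"
      by (intro scaled_emeasure_le) auto
    then have "1 / Suc j * measure M (T 0 (ennreal (1 + 1 / Suc j))) \<le> 0"
      by (simp only: distrib_right mult_1)
    then show ?thesis
      by (simp add: emeasure_eq_measure measure_le_0_iff divide_le_0_iff)
  qed
  then have "AE \<omega> in M. \<forall>j. \<omega> \<notin> T 0 (ennreal (1 + 1 / Suc j))"
    using T by (auto simp: AE_all_countable intro!: AE_not_in null_setsI)
  then show "AE \<omega> in M. \<forall>r\<in>pos_rat. (\<Sum>k. ennreal (N k r \<omega>)) \<le> 1"
  proof (rule AE_mp[OF _ AE_I2[OF impI]])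
    fix \<omega> assume that: "\<omega> \<in> space M" and elim: "\<forall>j. \<omega> \<notin> T 0 (ennreal (1 + 1 / Suc j))"
    show "\<forall>r\<in>pos_rat. (\<Sum>k. ennreal (N k r \<omega>)) \<le> 1"
    proof
      fix r assume "r \<in> pos_rat"
      then have "(\<Sum>k. ennreal (N k r \<omega>)) \<le> ennreal (1 + 1 / Suc j)" for j
        using elim that unfolding T_def by (auto simp: not_le intro: less_imp_le)
      moreover have "(\<lambda>j. ennreal (1 + 1 / Suc j)) \<longlonglongrightarrow> ennreal (1 + 0)"
        using LIMSEQ_inverse_real_of_nat by (intro tendsto_ennrealI tendsto_intros) (simp add: inverse_eq_divide)
      ultimately show "(\<Sum>k. ennreal (N k r \<omega>)) \<le> 1"
        by (intro tendsto_lowerbound[of "\<lambda>j. ennreal (1 + 1 / Suc j)" 1 sequentially]) auto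
    qed
  qed
  have "AE \<omega> in M. \<exists>n. \<omega> \<notin> T n (ennreal (1 / Suc j))" for j
  proof -
    let ?c = "1 / Suc j" and ?T = "\<Inter>n. T n (ennreal (1 / Suc j))"
    have "?c * measure M ?T \<le> measure M (\<Union>k. C (k + n))" for n
    proof -
      have "?c * measure M ?T \<le> ?c * measure M (T n (ennreal ?c))"
        using T by (intro mult_left_mono finite_measure_mono) auto
      also have "\<dots> \<le> measure M ((\<Union>k. C (k + n)) \<inter> T n (ennreal ?c))"
        by (rule scaled_emeasure_le[OF _ le]) simp
      also have "\<dots> \<le> measure M (\<Union>k. C (k + n))"
        using C by (intro finite_measure_mono) auto
      finally show ?thesis .
    qed
    moreover have "(\<lambda>n. measure M (\<Union>k. C (k + n))) \<longlonglongrightarrow> measure M (\<Inter>n. \<Union>k. C (k + n))"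
      using C by (intro finite_Lim_measure_decseq) (auto simp: decseq_def image_subset_iff, metis le_add_diff_inverse2 add.assoc)
    moreover have "(\<Inter>n. \<Union>k. C (k + n)) = {}"
    proof (intro equalityI subsetI)
      fix x assume x: "x \<in> (\<Inter>n. \<Union>k. C (k + n))"
      then obtain i where i: "x \<in> C i" by auto
      from x obtain k where "x \<in> C (k + Suc i)" by blast
      then show "x \<in> {}" using i dis unfolding disjoint_family_on_def
        by (metis IntI UNIV_I add_Suc_right less_add_Suc2 less_irrefl)
    qed simp
    ultimately have "?c * measure M ?T \<le> 0"
      by (intro tendsto_lowerbound[of "\<lambda>n. measure M (\<Union>k. C (k + n))" 0 sequentially]) auto
    then have "emeasure M ?T = 0"
      by (simp add: emeasure_eq_measure measure_le_0_iff mult_le_0_iff divide_le_0_iff)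
    then have "AE \<omega> in M. \<omega> \<notin> ?T" using T by (intro AE_not_in) auto
    then show ?thesis by auto
  qed
  then have "AE \<omega> in M. \<forall>j. \<exists>n. \<omega> \<notin> T n (ennreal (1 / Suc j))"
    by (simp add: AE_all_countable)
  then show "AE \<omega> in M. \<forall>j. \<exists>n. \<forall>r\<in>pos_rat. (\<Sum>k. ennreal (N (k + n) r \<omega>)) \<le> ennreal (1 / Suc j)"
  proof (rule AE_mp[OF _ AE_I2[OF impI]])
    fix \<omega> assume \<omega>: "\<omega> \<in> space M" and elim: "\<forall>j. \<exists>n. \<omega> \<notin> T n (ennreal (1 / Suc j))"
    show "\<forall>j. \<exists>n. \<forall>r\<in>pos_rat. (\<Sum>k. ennreal (N (k + n) r \<omega>)) \<le> ennreal (1 / Suc j)"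
    proof
      fix j
      obtain n where n: "\<omega> \<notin> T n (ennreal (1 / Suc j))" using elim by blast
      have "(\<Sum>k. ennreal (N (k + n) r \<omega>)) \<le> ennreal (1 / Suc j)" if "r \<in> pos_rat" for r
        using n \<omega> that unfolding T_def by (auto simp: not_le intro: less_imp_le)
      then show "\<exists>n. \<forall>r\<in>pos_rat. (\<Sum>k. ennreal (N (k + n) r \<omega>)) \<le> ennreal (1 / Suc j)" by blast
    qed
  qed
qed

end

section \<open>From rational times to all times by right continuity\<close>

lemma right_cont_le_of_rat:
  fixes h :: "real \<Rightarrow> real"
  assumes t: "0 \<le> t" and h: "continuous (at_right t) h" and le: "\<And>r. r \<in> pos_rat \<Longrightarrow> t < r \<Longrightarrow> r < d \<Longrightarrow> h r \<le> c"
    and d: "t < d"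
  shows "h t \<le> c"
proof (rule ccontr)
  assume "\<not> h t \<le> c"
  then have "0 < h t - c" by simp
  then obtain d' where d': "d' > t" "\<And>s. t < s \<Longrightarrow> s < d' \<Longrightarrow> \<bar>h s - h t\<bar> < h t - c"
    using h unfolding continuous_at_right_iff by blast
  obtain r where r: "r \<in> pos_rat" "t < r" "r < min d d'"
    using pos_rat_between[OF t, of "min d d'"] d d'(1) by auto
  show False using le[of r] d'(2)[of r] r by (auto simp: abs_if split: if_splits)
qed

lemma right_cont_ge_of_rat:
  fixes h :: "real \<Rightarrow> real"
  assumes t: "0 \<le> t" and h: "continuous (at_right t) h" and ge: "\<And>r. r \<in> pos_rat \<Longrightarrow> t < r \<Longrightarrow> r < d \<Longrightarrow> c \<le> h r"
    and d: "t < d"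
  shows "c \<le> h t"
  using right_cont_le_of_rat[OF t continuous_minus[OF h], of d "- c"] ge d by auto

text \<open>Uniformly small tails turn right continuity of the terms into right continuity of the
  sum. The hypotheses speak of rational times only, hence the detour through partial sums, which are
  right continuous and carry the bounds to every \<open>t\<close>.\<close>

lemma right_continuous_series:
  fixes f :: "nat \<Rightarrow> real \<Rightarrow> real"
  assumes cont: "\<And>k t. 0 \<le> t \<Longrightarrow> continuous (at_right t) (f k)"
    and nonneg: "\<And>k r. r \<in> pos_rat \<Longrightarrow> 0 \<le> f k r"
    and le1: "\<And>r. r \<in> pos_rat \<Longrightarrow> (\<Sum>k. ennreal (f k r)) \<le> 1"
    and tail: "\<And>j. \<exists>n. \<forall>r\<in>pos_rat. (\<Sum>k. ennreal (f (k + n) r)) \<le> ennreal (1 / Suc j)"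
    and t: "0 \<le> t"
  shows "summable (\<lambda>k. f k t)" "0 \<le> (\<Sum>k. f k t)" "(\<Sum>k. f k t) \<le> 1"
    and "continuous (at_right t) (\<lambda>t. \<Sum>k. f k t)"
proof -
  have nonneg': "0 \<le> f k t" if "0 \<le> t" for k t
    by (rule right_cont_ge_of_rat[OF that cont[OF that], of "t + 1"]) (use nonneg in auto)
  have partial: "(\<Sum>k<p. f (k + n) t) \<le> c"
    if t: "0 \<le> t" and c: "0 \<le> c" and le: "\<forall>r\<in>pos_rat. (\<Sum>k. ennreal (f (k + n) r)) \<le> ennreal c" for t n p c
  proof (rule right_cont_le_of_rat[OF t, of _ "t + 1"])
    show "continuous (at_right t) (\<lambda>t. \<Sum>k<p. f (k + n) t)"
      by (intro continuous_intros cont t)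
    fix r assume r: "r \<in> pos_rat"
    have "ennreal (\<Sum>k<p. f (k + n) r) = (\<Sum>k<p. ennreal (f (k + n) r))"
      using nonneg[OF r] by (simp add: sum_ennreal)
    also have "\<dots> \<le> (\<Sum>k. ennreal (f (k + n) r))" by (rule sum_le_suminf) auto
    also have "\<dots> \<le> ennreal c" using le r by auto
    finally show "(\<Sum>k<p. f (k + n) r) \<le> c" using c by simp
  qed simp
  have sm: "summable (\<lambda>k. f k t)" if "0 \<le> t" for t
    using partial[OF that, of 1 0] le1 nonneg'[OF that]
    by (intro summableI_nonneg_bounded[where x = 1]) auto
  have tl: "\<exists>n. \<forall>t\<ge>0. 0 \<le> (\<Sum>k. f (k + n) t) \<and> (\<Sum>k. f (k + n) t) \<le> 1 / Suc j" for j
  proof -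
    obtain n where n: "\<forall>r\<in>pos_rat. (\<Sum>k. ennreal (f (k + n) r)) \<le> ennreal (1 / Suc j)" using tail by blast
    show ?thesis
    proof (intro exI[of _ n] allI impI conjI)
      fix t :: real assume t: "0 \<le> t"
      have s: "summable (\<lambda>k. f (k + n) t)" using sm[OF t] by (subst summable_iff_shift)
      show "0 \<le> (\<Sum>k. f (k + n) t)" using s nonneg'[OF t] by (intro suminf_nonneg) auto
      show "(\<Sum>k. f (k + n) t) \<le> 1 / Suc j" using partial[OF t _ n] s by (intro suminf_le_const) auto
    qed
  qed
  show "summable (\<lambda>k. f k t)" by (rule sm[OF t])
  show "0 \<le> (\<Sum>k. f k t)" using sm[OF t] nonneg'[OF t] by (intro suminf_nonneg) auto
  show "(\<Sum>k. f k t) \<le> 1" using partial[OF t, of 1 0] le1 sm[OF t] by (intro suminf_le_const) auto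
  show "continuous (at_right t) (\<lambda>t. \<Sum>k. f k t)"
    unfolding continuous_at_right_iff
  proof (intro allI impI)
    fix e :: real assume e: "e > 0"
    then obtain j where j: "1 / Suc j < e / 3" using nat_approx_posE[of "e / 3"] by auto
    obtain n where n: "\<And>t. t \<ge> 0 \<Longrightarrow> 0 \<le> (\<Sum>k. f (k + n) t) \<and> (\<Sum>k. f (k + n) t) \<le> 1 / Suc j"
      using tl by blast
    have "continuous (at_right t) (\<lambda>t. \<Sum>k<n. f k t)" by (intro continuous_intros cont t)
    then obtain d where d: "d > t" "\<And>s. t < s \<Longrightarrow> s < d \<Longrightarrow> \<bar>(\<Sum>k<n. f k s) - (\<Sum>k<n. f k t)\<bar> < e / 3"
      unfolding continuous_at_right_iff using e by (meson divide_pos_pos zero_less_numeral)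
    show "\<exists>d>t. \<forall>s. t < s \<longrightarrow> s < d \<longrightarrow> \<bar>(\<Sum>k. f k s) - (\<Sum>k. f k t)\<bar> < e"
    proof (intro exI[of _ d] conjI allI impI)
      fix s assume s: "t < s" "s < d"
      have "(\<Sum>k. f k s) = (\<Sum>k. f (k + n) s) + (\<Sum>k<n. f k s)"
        using s t by (intro suminf_split_initial_segment sm) auto
      moreover have "(\<Sum>k. f k t) = (\<Sum>k. f (k + n) t) + (\<Sum>k<n. f k t)"
        using t by (intro suminf_split_initial_segment sm) auto
      ultimately show "\<bar>(\<Sum>k. f k s) - (\<Sum>k. f k t)\<bar> < e"
        using d(2)[OF s] n[of s] n[of t] s t j by linarith
    qed (rule d)
  qed
qed

section \<open>Conditional probabilities and stochastic intervals with a parameter\<close>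

context usual_filtration begin

section \<open>Exceptional sets that depend on a parameter\<close>

lemma sets_Collect_mem: "A \<in> sets N \<Longrightarrow> {x \<in> space N. x \<in> A} \<in> sets N"
  by (metis Collect_mem_eq Collect_conj_eq sets.Int sets.top)

text \<open>An exceptional set for a whole family of almost sure statements: the union of its
  sections over all \<open>u\<close> need not be null. No measure on \<open>S\<close> appears, so
  the condition holds at each single \<open>u\<close>.\<close>

definition null_sections :: "'u measure \<Rightarrow> ('u \<times> 'w) set \<Rightarrow> bool" where
  "null_sections S B \<longleftrightarrow> B \<in> sets (S \<Otimes>\<^sub>M FI) \<and> (\<forall>u\<in>space S. emeasure M (Pair u -` B) = 0)"

lemma FI_section: "D \<in> sets (S \<Otimes>\<^sub>M FI) \<Longrightarrow> Pair u -` D \<in> sets M"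
  using sets_Pair1[of D S FI u] FI_sets by auto

lemma null_sections_UN:
  assumes "countable I" "\<And>i. i \<in> I \<Longrightarrow> null_sections S (B i)"
  shows "null_sections S (\<Union>i\<in>I. B i)"
  unfolding null_sections_def
proof (intro conjI ballI)
  show "(\<Union>i\<in>I. B i) \<in> sets (S \<Otimes>\<^sub>M FI)"
    using assms unfolding null_sections_def by (intro sets.countable_UN') auto
  fix u assume u: "u \<in> space S"
  have "(\<Union>i\<in>I. Pair u -` B i) \<in> null_sets M"
    using assms u FI_section[where S = S] unfolding null_sections_def
    by (intro null_sets_UN') (auto intro!: null_setsI)
  then show "emeasure M (Pair u -` (\<Union>i\<in>I. B i)) = 0" by (simp add: vimage_UN null_setsD1)
qed

lemma null_sections_Un: "null_sections S A \<Longrightarrow> null_sections S B \<Longrightarrow> null_sections S (A \<union> B)"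
  using null_sections_UN[of "UNIV :: bool set" S "\<lambda>b. if b then A else B"] by (auto simp: UNIV_bool Un_commute)

lemma null_sections_Collect:
  assumes "{p \<in> space (S \<Otimes>\<^sub>M FI). \<not> P p} \<in> sets (S \<Otimes>\<^sub>M FI)"
    and "\<And>u. u \<in> space S \<Longrightarrow> AE \<omega> in M. P (u, \<omega>)"
  shows "null_sections S {p \<in> space (S \<Otimes>\<^sub>M FI). \<not> P p}"
  unfolding null_sections_def
proof (intro conjI ballI assms(1))
  fix u assume u: "u \<in> space S"
  have eq: "Pair u -` {p \<in> space (S \<Otimes>\<^sub>M FI). \<not> P p} = {\<omega> \<in> space M. \<not> P (u, \<omega>)}"
    using u by (auto simp: space_pair_measure)
  show "emeasure M (Pair u -` {p \<in> space (S \<Otimes>\<^sub>M FI). \<not> P p}) = 0"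
    using assms(2)[OF u] FI_section[OF assms(1), of u] unfolding eq
    by (subst (asm) AE_iff_measurable[OF _ refl]) auto
qed

text \<open>Dynkin's argument over rectangles. A rectangle \<open>A \<times> C\<close> gives the
  indicator of \<open>A\<close> times a cadlag version for \<open>C\<close>, complements give
  \<open>1 - N\<close>, and disjoint unions give series. Measurability in all three variables is
  preserved at each stage, while right continuity of a series may fail on a set with null
  sections.\<close>

theorem ex_parametrized_cond_prob_process:
  assumes D: "D \<in> sets (S \<Otimes>\<^sub>M FI)"
  shows "\<exists>N Bad. (\<lambda>(u, t, \<omega>). N u t \<omega>) \<in> borel_measurable (S \<Otimes>\<^sub>M opt_measure M F) \<and> null_sections S Bad \<and>
    (\<forall>u\<in>space S. cond_prob_process (N u) (Pair u -` D)) \<and>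
    (\<forall>u\<in>space S. \<forall>\<omega>\<in>space M. (u, \<omega>) \<notin> Bad \<longrightarrow> (\<forall>t\<ge>0. continuous (at_right t) (\<lambda>t. N u t \<omega>)))"
    (is "?P D")
proof -
  let ?G = "{a \<times> b |a b. a \<in> sets S \<and> b \<in> sets FI}"
  have null0: "null_sections S {}" unfolding null_sections_def by auto
  have "D \<in> sigma_sets (space S \<times> space FI) ?G" using D unfolding sets_pair_measure .
  with Int_stable_pair_measure_generator pair_measure_closed show "?P D"
  proof (induction D rule: sigma_sets_induct_disjoint)
    case (basic D)
    then obtain A C where AC: "D = A \<times> C" "A \<in> sets S" "C \<in> sets FI" by auto
    obtain N where N: "cond_prob_process N C" "cadlag M N" "adapted M F N"
      using cadlag_cond_prob_process[OF FI_sets[OF AC(3)]] by blast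
    note [measurable] = borel_measurable_opt[OF N(3,2)] AC(2)
    have "(\<lambda>p. indicator A (fst p) * (\<lambda>(t, \<omega>). N t \<omega>) (snd p) :: real) \<in> borel_measurable (S \<Otimes>\<^sub>M opt_measure M F)"
      by measurable
    then have "(\<lambda>(u, t, \<omega>). indicator A u * N t \<omega> :: real) \<in> borel_measurable (S \<Otimes>\<^sub>M opt_measure M F)"
      by (simp add: split_beta')
    moreover have "cond_prob_process (\<lambda>t \<omega>. indicator A u * N t \<omega>) (Pair u -` D)" for u
    proof (cases "u \<in> A")
      case True
      then show ?thesis using N(1) AC(1) by (simp add: vimage_def)
    next
      case False
      then show ?thesis using AC(1) by (simp add: vimage_def cond_prob_process_def)
    qed
    moreover have "\<forall>\<omega>\<in>space M. \<forall>t\<ge>0. continuous (at_right t) (\<lambda>t. indicator A u * N t \<omega> :: real)" for u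
      using N(2) unfolding cadlag_def by (auto intro!: continuous_intros)
    ultimately show ?case using null0
      by (intro exI[of _ "\<lambda>u t \<omega>. indicator A u * N t \<omega>"] exI[of _ "{}"]) auto
  next
    case empty
    show ?case using null0
      by (intro exI[of _ "\<lambda>u t \<omega>. 0"] exI[of _ "{}"]) (auto simp: cond_prob_process_def)
  next
    case (compl D)
    then obtain N Bad where m [measurable]: "(\<lambda>(u, t, \<omega>). N u t \<omega>) \<in> borel_measurable (S \<Otimes>\<^sub>M opt_measure M F)"
      and Bad: "null_sections S Bad"
      and N: "\<forall>u\<in>space S. cond_prob_process (N u) (Pair u -` D)"
      and cont: "\<forall>u\<in>space S. \<forall>\<omega>\<in>space M. (u, \<omega>) \<notin> Bad \<longrightarrow> (\<forall>t\<ge>0. continuous (at_right t) (\<lambda>t. N u t \<omega>))"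
      by blast
    have Ds: "Pair u -` D \<in> sets M" for u using compl(1) by (intro FI_section[of _ S]) (simp add: sets_pair_measure)
    have "(\<lambda>p. 1 - (\<lambda>(u, t, \<omega>). N u t \<omega>) p) \<in> borel_measurable (S \<Otimes>\<^sub>M opt_measure M F)"
      by measurable
    then have "(\<lambda>(u, t, \<omega>). 1 - N u t \<omega>) \<in> borel_measurable (S \<Otimes>\<^sub>M opt_measure M F)"
      by (simp add: split_beta')
    moreover have "cond_prob_process (\<lambda>t \<omega>. 1 - N u t \<omega>) (Pair u -` (space S \<times> space FI - D))"
      if u: "u \<in> space S" for u
    proof -
      have "Pair u -` (space S \<times> space FI - D) = space M - Pair u -` D" using u by auto
      then show ?thesis using cond_prob_process_compl[OF _ Ds] N u by auto
    qed
    ultimately show ?case using Bad cont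
      by (intro exI[of _ "\<lambda>u t \<omega>. 1 - N u t \<omega>"] exI[of _ "Bad"]) (auto intro!: continuous_intros)
  next
    case (union D)
    from union(3) obtain N Bad where m [measurable]: "\<And>k::nat. (\<lambda>(u, t, \<omega>). N k u t \<omega>) \<in> borel_measurable (S \<Otimes>\<^sub>M opt_measure M F)"
      and Bad: "\<And>k. null_sections S (Bad k)"
      and N: "\<And>k u. u \<in> space S \<Longrightarrow> cond_prob_process (N k u) (Pair u -` D k)"
      and cont: "\<And>k u \<omega> t. u \<in> space S \<Longrightarrow> \<omega> \<in> space M \<Longrightarrow> (u, \<omega>) \<notin> Bad k \<Longrightarrow> 0 \<le> t \<Longrightarrow> continuous (at_right t) (\<lambda>t. N k u t \<omega>)"
      by metis
    have Ds: "Pair u -` D k \<in> sets M" for u k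
      using union(2) by (intro FI_section[of _ S]) (auto simp: sets_pair_measure)
    have dis: "disjoint_family (\<lambda>k. Pair u -` D k)" for u
      using union(1) unfolding disjoint_family_on_def by auto
    \<comment> \<open>Off \<open>Bad'\<close> the series already lies in [0, 1] and clamping does
      nothing; on \<open>Bad'\<close> it enforces the bounds, which \<open>cond_prob_process\<close>
      demands at every point.\<close>
    define N' where "N' u t \<omega> = min 1 (max 0 (\<Sum>k. N k u t \<omega>))" for u t \<omega>
    define Q1 where "Q1 p \<longleftrightarrow> (\<forall>r\<in>pos_rat. (\<Sum>k. ennreal (N k (fst p) r (snd p))) \<le> 1)" for p
    define Q2 where "Q2 p \<longleftrightarrow> (\<forall>j. \<exists>n. \<forall>r\<in>pos_rat. (\<Sum>k. ennreal (N (k + n) (fst p) r (snd p))) \<le> ennreal (1 / Suc j))" for p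
    define Bad' where "Bad' = (\<Union>k. Bad k) \<union> ({p \<in> space (S \<Otimes>\<^sub>M FI). \<not> Q1 p} \<union> {p \<in> space (S \<Otimes>\<^sub>M FI). \<not> Q2 p})"
    have Nr [measurable]: "(\<lambda>p. N k (fst p) r (snd p)) \<in> borel_measurable (S \<Otimes>\<^sub>M FI)" if "r \<in> pos_rat" for k r
      using measurable_param_section(2)[OF m, of r k] that by (simp add: split_beta')
    have Q1m: "{p \<in> space (S \<Otimes>\<^sub>M FI). \<not> Q1 p} \<in> sets (S \<Otimes>\<^sub>M FI)"
      unfolding Q1_def
      by (intro sets.sets_Collect_neg sets.sets_Collect_countable_All' countable_pos_rat) measurable
    have Q2m: "{p \<in> space (S \<Otimes>\<^sub>M FI). \<not> Q2 p} \<in> sets (S \<Otimes>\<^sub>M FI)"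
      unfolding Q2_def
      by (intro sets.sets_Collect_neg sets.sets_Collect_countable_All sets.sets_Collect_countable_Ex
          sets.sets_Collect_countable_All' countable_pos_rat) measurable
    have Bad': "null_sections S Bad'"
      unfolding Bad'_def
    proof (intro null_sections_Un null_sections_UN Bad null_sections_Collect Q1m Q2m)
      fix u assume u: "u \<in> space S"
      show "AE \<omega> in M. Q1 (u, \<omega>)" unfolding Q1_def using AE_cond_prob_processes_sum(1)[OF N[OF u] Ds dis] by simp
      show "AE \<omega> in M. Q2 (u, \<omega>)" unfolding Q2_def using AE_cond_prob_processes_sum(2)[OF N[OF u] Ds dis] by simp
    qed auto
    have series: "summable (\<lambda>k. N k u t \<omega>) \<and> 0 \<le> (\<Sum>k. N k u t \<omega>) \<and> (\<Sum>k. N k u t \<omega>) \<le> 1 \<and>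
        continuous (at_right t) (\<lambda>t. \<Sum>k. N k u t \<omega>)"
      if u: "u \<in> space S" "\<omega> \<in> space M" "(u, \<omega>) \<notin> Bad'" and t: "0 \<le> t" for u \<omega> t
    proof -
      have Q: "Q1 (u, \<omega>)" "Q2 (u, \<omega>)" "(u, \<omega>) \<notin> Bad k" for k
        using u unfolding Bad'_def by (auto simp: space_pair_measure)
      have n: "0 \<le> N k u r \<omega>" if "r \<in> pos_rat" for k r
        using cond_prob_processD(2)[OF N[OF u(1)] that u(2)] .
      have l: "(\<Sum>k. ennreal (N k u r \<omega>)) \<le> 1" if "r \<in> pos_rat" for r
        using Q(1) that unfolding Q1_def by (simp only: fst_conv snd_conv)
      have tl: "\<exists>n. \<forall>r\<in>pos_rat. (\<Sum>k. ennreal (N (k + n) u r \<omega>)) \<le> ennreal (1 / Suc j)" for j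
        using Q(2) unfolding Q2_def by (simp only: fst_conv snd_conv)
      note series = right_continuous_series[of "\<lambda>k t. N k u t \<omega>", OF cont[OF u(1,2) Q(3)] n l tl t]
      show ?thesis by (intro conjI series)
    qed
    have N'm: "(\<lambda>(u, t, \<omega>). N' u t \<omega>) \<in> borel_measurable (S \<Otimes>\<^sub>M opt_measure M F)"
    proof -
      have "(\<lambda>p. min 1 (max 0 (\<Sum>k. (\<lambda>(u, t, \<omega>). N k u t \<omega>) p))) \<in> borel_measurable (S \<Otimes>\<^sub>M opt_measure M F)"
        by measurable
      then show ?thesis by (simp add: split_beta' N'_def)
    qed
    moreover have "cond_prob_process (N' u) (Pair u -` (\<Union>k. D k))" if u: "u \<in> space S" for u
      unfolding cond_prob_process_def
    proof (intro ballI conjI)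
      fix r assume r: "r \<in> pos_rat"
      show "N' u r \<in> borel_measurable (FF r)" using measurable_param_section(1)[OF N'm _ u] r by auto
      show "0 \<le> N' u r \<omega>" "N' u r \<omega> \<le> 1" for \<omega> unfolding N'_def by auto
      fix B assume B: "B \<in> F r"
      have "AE \<omega> in M. \<omega> \<notin> Pair u -` Bad'"
        using Bad' u FI_section[where S = S] unfolding null_sections_def by (intro AE_not_in null_setsI) auto
      then have "AE \<omega> in M. ennreal (N' u r \<omega>) = (\<Sum>k. ennreal (N k u r \<omega>))"
      proof (rule AE_mp[OF _ AE_I2[OF impI]])
        fix \<omega> assume \<omega>: "\<omega> \<in> space M" "\<omega> \<notin> Pair u -` Bad'"
        have "0 \<le> N k u r \<omega>" for k using cond_prob_processD(2)[OF N[OF u] r \<omega>(1)] .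
        then show "ennreal (N' u r \<omega>) = (\<Sum>k. ennreal (N k u r \<omega>))"
          using series[OF u \<omega>(1), of r] \<omega>(2) r unfolding N'_def by (subst suminf_ennreal2) auto
      qed
      then have "(\<integral>\<^sup>+\<omega>. ennreal (N' u r \<omega>) * indicator B \<omega> \<partial>M) = (\<integral>\<^sup>+\<omega>. (\<Sum>k. ennreal (N k u r \<omega>)) * indicator B \<omega> \<partial>M)"
        by (intro nn_integral_cong_AE) auto
      also have "\<dots> = emeasure M (Pair u -` (\<Union>k. D k) \<inter> B)"
        by (subst cond_prob_processes_sum[OF N[OF u] Ds dis r B]) (simp add: vimage_UN)
      finally show "(\<integral>\<^sup>+\<omega>. ennreal (N' u r \<omega>) * indicator B \<omega> \<partial>M) = emeasure M (Pair u -` (\<Union>k. D k) \<inter> B)" .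
    qed
    moreover have "continuous (at_right t) (\<lambda>t. N' u t \<omega>)"
      if "u \<in> space S" "\<omega> \<in> space M" "(u, \<omega>) \<notin> Bad'" "0 \<le> t" for u \<omega> t
      unfolding N'_def using series[OF that] by (intro continuous_min continuous_max continuous_const) auto
    ultimately show ?case using Bad' by blast
  qed
qed

text \<open>The set \<open>K\<close> is the stochastic interval \<open>[0, T)\<close>, where \<open>T u \<omega>\<close> is the infimum of the
  rational times \<open>r\<close> with \<open>(u, \<omega>) \<in> e r\<close>. Before \<open>T\<close> the conditional probability of \<open>{T \<ge> q}\<close> stays
  positive for some \<open>q > t\<close>; after \<open>T\<close> it vanishes.\<close>

theorem parametrized_stochastic_interval:
  assumes e: "\<And>r. r \<in> pos_rat \<Longrightarrow> e r \<in> sets (S \<Otimes>\<^sub>M FI)"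
    and eF: "\<And>r u. r \<in> pos_rat \<Longrightarrow> u \<in> space S \<Longrightarrow> Pair u -` e r \<in> F r"
  shows "\<exists>K Bad. K \<in> sets (S \<Otimes>\<^sub>M opt_measure M F) \<and> null_sections S Bad \<and>
    (\<forall>u\<in>space S. \<forall>\<omega>\<in>space M. (u, \<omega>) \<notin> Bad \<longrightarrow> (\<forall>t\<ge>0.
      (u, t, \<omega>) \<in> K \<longleftrightarrow> (\<exists>q>t. \<forall>r\<in>pos_rat. r < q \<longrightarrow> (u, \<omega>) \<notin> e r)))"
proof -
  \<comment> \<open>\<open>D q\<close> is the event that T is at least \<open>q\<close>.\<close>
  define D where "D q = {p \<in> space (S \<Otimes>\<^sub>M FI). \<forall>r\<in>pos_rat \<inter> {..<q}. p \<notin> e r}" for q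
  have D: "D q \<in> sets (S \<Otimes>\<^sub>M FI)" for q
    unfolding D_def
    by (intro sets.sets_Collect_countable_All' countable_Int1 countable_pos_rat sets.sets_Collect_neg)
      (use e in \<open>auto intro!: sets_Collect_mem\<close>)
  obtain N B0 where m [measurable]: "\<And>q. (\<lambda>(u, t, \<omega>). N q u t \<omega>) \<in> borel_measurable (S \<Otimes>\<^sub>M opt_measure M F)"
      and B0: "\<And>q. null_sections S (B0 q)"
      and N: "\<And>q u. u \<in> space S \<Longrightarrow> cond_prob_process (N q u) (Pair u -` D q)"
      and cont: "\<And>q u \<omega> t. u \<in> space S \<Longrightarrow> \<omega> \<in> space M \<Longrightarrow> (u, \<omega>) \<notin> B0 q \<Longrightarrow> 0 \<le> t \<Longrightarrow> continuous (at_right t) (\<lambda>t. N q u t \<omega>)"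
    using ex_parametrized_cond_prob_process[OF D] by metis
  have Nr [measurable]: "(\<lambda>p. N q (fst p) r (snd p)) \<in> borel_measurable (S \<Otimes>\<^sub>M FI)" if "r \<in> pos_rat" for q r
    using measurable_param_section(2)[OF m, of r q] that by (simp add: split_beta')
  \<comment> \<open>Strict positivity at rational times could be lost in a right limit; a lower
    bound \<open>1 / Suc j\<close> common to all rational times survives it.\<close>
  define Q1 where "Q1 q p \<longleftrightarrow> (p \<in> D q \<longrightarrow> (\<exists>j. \<forall>r\<in>pos_rat. 1 / Suc j \<le> N q (fst p) r (snd p)))" for q p
  define Q2 where "Q2 q p \<longleftrightarrow> (\<forall>r\<in>pos_rat. \<forall>s\<in>pos_rat \<inter> {r..}. p \<in> e r \<longrightarrow> r < q \<longrightarrow> N q (fst p) s (snd p) \<le> 0)" for q p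
  have Q1m: "{p \<in> space (S \<Otimes>\<^sub>M FI). \<not> Q1 q p} \<in> sets (S \<Otimes>\<^sub>M FI)" for q
    unfolding Q1_def
    by (intro sets.sets_Collect_neg sets.sets_Collect_imp sets_Collect_mem D sets.sets_Collect_countable_Ex
          sets.sets_Collect_countable_All' countable_pos_rat) measurable
  have Q2m: "{p \<in> space (S \<Otimes>\<^sub>M FI). \<not> Q2 q p} \<in> sets (S \<Otimes>\<^sub>M FI)" for q
    unfolding Q2_def
    by (intro sets.sets_Collect_neg sets.sets_Collect_imp sets_Collect_mem e
          sets.sets_Collect_countable_All' countable_pos_rat countable_Int1) (measurable; auto)+
  define Bad where "Bad = (\<Union>q\<in>pos_rat. B0 q \<union> ({p \<in> space (S \<Otimes>\<^sub>M FI). \<not> Q1 q p} \<union> {p \<in> space (S \<Otimes>\<^sub>M FI). \<not> Q2 q p}))"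
  have Bad: "null_sections S Bad"
    unfolding Bad_def
  proof (intro null_sections_UN countable_pos_rat null_sections_Un B0 null_sections_Collect Q1m Q2m)
    fix q u assume u: "u \<in> space S"
    note Nu = N[OF u, of q]
    let ?D = "Pair u -` D q"
    have Du: "?D \<in> sets M" using FI_section[OF D] .
    define L where "L j r = {\<omega> \<in> space M. N q u r \<omega> < 1 / Suc j}" for j :: nat and r
    have L: "L j r \<in> F r" if "r \<in> pos_rat" for j r
    proof -
      note [measurable] = cond_prob_processD(1)[OF Nu that]
      have "{\<omega> \<in> space (FF r). N q u r \<omega> < 1 / Suc j} \<in> sets (FF r)" by measurable
      then show ?thesis using that sets_FF[of r] unfolding L_def by auto
    qed
    define LL where "LL j = (\<Union>r\<in>pos_rat. L j r)" for j
    have LL: "LL j \<in> sets M" for j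
      unfolding LL_def using L F_sets by (intro sets.countable_UN' countable_pos_rat) auto
    \<comment> \<open>The part of \<open>D q\<close> on which its conditional probability drops
      below \<open>1 / Suc j\<close> has probability at most \<open>1 / Suc j\<close>.\<close>
    have le: "measure M (\<Inter>j. ?D \<inter> LL j) \<le> 1 / Suc j" for j
    proof -
      have "emeasure M (?D \<inter> LL j) \<le> ennreal (1 / Suc j) * emeasure M (LL j)"
        unfolding LL_def
        by (rule cond_process_le[OF cond_prob_processD(4)[OF Nu] Du L]) (auto simp: L_def intro!: ennreal_leI)
      then have "measure M (?D \<inter> LL j) \<le> 1 / Suc j * measure M (LL j)"
        by (simp add: emeasure_eq_measure flip: ennreal_mult)
      also have "\<dots> \<le> 1 / Suc j" by (simp add: divide_right_mono)
      finally have "measure M (?D \<inter> LL j) \<le> 1 / Suc j" .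
      moreover have "measure M (\<Inter>j. ?D \<inter> LL j) \<le> measure M (?D \<inter> LL j)"
        using Du LL by (intro finite_measure_mono) auto
      ultimately show ?thesis by simp
    qed
    have "(\<lambda>j. 1 / real (Suc j)) \<longlonglongrightarrow> 0" using LIMSEQ_inverse_real_of_nat by (simp add: inverse_eq_divide)
    then have "measure M (\<Inter>j. ?D \<inter> LL j) \<le> 0"
      by (rule tendsto_lowerbound) (use le in auto)
    then have "(\<Inter>j. ?D \<inter> LL j) \<in> null_sets M"
      using Du LL by (intro null_setsI) (auto simp: emeasure_eq_measure measure_le_0_iff)
    then have "AE \<omega> in M. \<omega> \<notin> (\<Inter>j. ?D \<inter> LL j)" by (rule AE_not_in)
    then show "AE \<omega> in M. Q1 q (u, \<omega>)"
    proof (rule AE_mp[OF _ AE_I2[OF impI]])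
      fix \<omega> assume \<omega>: "\<omega> \<in> space M" "\<omega> \<notin> (\<Inter>j. ?D \<inter> LL j)"
      show "Q1 q (u, \<omega>)"
        unfolding Q1_def
      proof
        assume "(u, \<omega>) \<in> D q"
        then obtain j where "\<omega> \<notin> LL j" using \<omega>(2) by auto
        then have "\<forall>r\<in>pos_rat. 1 / Suc j \<le> N q u r \<omega>"
          using \<omega>(1) unfolding LL_def L_def by (auto simp: not_less)
        then show "\<exists>j. \<forall>r\<in>pos_rat. 1 / Suc j \<le> N q (fst (u, \<omega>)) r (snd (u, \<omega>))"
          by (auto simp del: Int_iff)
      qed
    qed
    \<comment> \<open>The section of \<open>e r\<close> belongs to \<open>F s\<close> and is
      disjoint from that of \<open>D q\<close> when \<open>r < q\<close>, so the conditional
      probability of the latter integrates to 0 over it.\<close>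
    have "AE \<omega> in M. \<forall>r\<in>pos_rat. \<forall>s\<in>pos_rat \<inter> {r..}. (u, \<omega>) \<in> e r \<longrightarrow> r < q \<longrightarrow> N q u s \<omega> \<le> 0"
    proof (intro AE_ball_countable[THEN iffD2] countable_pos_rat countable_Int1 ballI)
      fix r s assume r: "r \<in> pos_rat" and s: "s \<in> pos_rat \<inter> {r..}"
      show "AE \<omega> in M. (u, \<omega>) \<in> e r \<longrightarrow> r < q \<longrightarrow> N q u s \<omega> \<le> 0"
      proof (cases "r < q")
        case True
        let ?B = "Pair u -` e r"
        have sp: "s \<in> pos_rat" using s by auto
        have B: "?B \<in> F s" using F_mono[OF _ _ eF[OF r u], of s] r s by auto
        have [measurable]: "?B \<in> sets M" using F_sets[OF _ B] s by auto
        have [measurable]: "N q u s \<in> borel_measurable M"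
          using measurable_from_subalg[OF subalgebra_FF cond_prob_processD(1)[OF Nu sp]] s by auto
        have "(\<integral>\<^sup>+\<omega>. ennreal (N q u s \<omega>) * indicator ?B \<omega> \<partial>M) = emeasure M (?D \<inter> ?B)"
          by (rule cond_prob_processD(4)[OF Nu sp B])
        also have "?D \<inter> ?B = {}" using True r unfolding D_def by auto
        finally have "AE \<omega> in M. ennreal (N q u s \<omega>) * indicator ?B \<omega> = 0"
          by (intro nn_integral_0_iff_AE[THEN iffD1]) simp_all
        then show ?thesis by eventually_elim (auto simp: indicator_def ennreal_eq_0_iff)
      qed auto
    qed
    then show "AE \<omega> in M. Q2 q (u, \<omega>)" unfolding Q2_def by simp
  qed
  define K where "K = (\<Union>q\<in>pos_rat. {p \<in> space (S \<Otimes>\<^sub>M opt_measure M F). fst (snd p) < q \<and> 0 < (\<lambda>(u, t, \<omega>). N q u t \<omega>) p})"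
  have [measurable]: "fst \<in> borel_measurable (opt_measure M F)"
  proof -
    have "adapted M F (\<lambda>t \<omega>. t)" unfolding adapted_def
    proof (intro allI impI)
      fix t :: real and U :: "real set" assume "0 \<le> t"
      then interpret sigma_algebra "space M" "F t" by (rule F_sigma_algebra)
      show "{\<omega> \<in> space M. t \<in> U} \<in> F t" by (cases "t \<in> U") auto
    qed
    moreover have "cadlag M (\<lambda>t \<omega>. t)" unfolding cadlag_def by (auto intro!: tendsto_intros)
    ultimately show ?thesis using borel_measurable_opt[of F "\<lambda>t \<omega>. t"] by (simp add: split_beta')
  qed
  have K: "K \<in> sets (S \<Otimes>\<^sub>M opt_measure M F)"
    unfolding K_def by (intro sets.countable_UN' countable_pos_rat) (auto, measurable)
  have iff: "(u, t, \<omega>) \<in> K \<longleftrightarrow> (\<exists>q>t. \<forall>r\<in>pos_rat. r < q \<longrightarrow> (u, \<omega>) \<notin> e r)"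
    if u: "u \<in> space S" "\<omega> \<in> space M" "(u, \<omega>) \<notin> Bad" and t: "0 \<le> t" for u \<omega> t
  proof -
    have Q: "Q1 q (u, \<omega>)" "Q2 q (u, \<omega>)" "(u, \<omega>) \<notin> B0 q" if "q \<in> pos_rat" for q
      using u that unfolding Bad_def by (auto simp: space_pair_measure)
    have "(u, t, \<omega>) \<in> K \<longleftrightarrow> (\<exists>q\<in>pos_rat. t < q \<and> 0 < N q u t \<omega>)"
      unfolding K_def using u t by (auto simp: space_pair_measure space_opt)
    also have "\<dots> \<longleftrightarrow> (\<exists>q>t. \<forall>r\<in>pos_rat. r < q \<longrightarrow> (u, \<omega>) \<notin> e r)"
    proof
      assume "\<exists>q\<in>pos_rat. t < q \<and> 0 < N q u t \<omega>"
      then obtain q where q: "q \<in> pos_rat" "t < q" "0 < N q u t \<omega>" by blast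
      show "\<exists>q>t. \<forall>r\<in>pos_rat. r < q \<longrightarrow> (u, \<omega>) \<notin> e r"
      proof (rule ccontr)
        \<comment> \<open>The assumption says that T is at most \<open>t\<close>. Every rational
          \<open>s\<close> in \<open>(t, q)\<close> is then preceded by some \<open>r\<close> with
          \<open>(u, \<omega>) \<in> e r\<close>, which forces the conditional probability to vanish
          at \<open>s\<close>.\<close>
        assume *: "\<not> ?thesis"
        have "N q u t \<omega> \<le> 0"
        proof (rule right_cont_le_of_rat[OF t cont[OF u(1,2) Q(3)[OF q(1)] t] _ q(2)])
          fix s assume s: "s \<in> pos_rat" "t < s" "s < q"
          obtain r where r: "r \<in> pos_rat" "r < s" "(u, \<omega>) \<in> e r" using * s(2) by blast
          then show "N q u s \<omega> \<le> 0" using Q(2)[OF q(1)] s unfolding Q2_def by force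
        qed
        then show False using q(3) by simp
      qed
    next
      assume "\<exists>q>t. \<forall>r\<in>pos_rat. r < q \<longrightarrow> (u, \<omega>) \<notin> e r"
      then obtain q' where q': "t < q'" "\<And>r. r \<in> pos_rat \<Longrightarrow> r < q' \<Longrightarrow> (u, \<omega>) \<notin> e r" by blast
      obtain q where q: "q \<in> pos_rat" "t < q" "q < q'" using pos_rat_between[OF t q'(1)] by blast
      have "(u, \<omega>) \<in> D q" unfolding D_def using q q' u by (auto simp: space_pair_measure)
      then obtain j where j: "\<And>r. r \<in> pos_rat \<Longrightarrow> 1 / Suc j \<le> N q u r \<omega>"
        using Q(1)[OF q(1)] unfolding Q1_def by auto
      have "1 / Suc j \<le> N q u t \<omega>"
        by (rule right_cont_ge_of_rat[OF t cont[OF u(1,2) Q(3)[OF q(1)] t] j q(2)])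
      moreover have "0 < 1 / real (Suc j)" by simp
      ultimately have "0 < N q u t \<omega>" by (rule less_le_trans[rotated])
      then show "\<exists>q\<in>pos_rat. t < q \<and> 0 < N q u t \<omega>" using q by (intro bexI[of _ q]) auto
    qed
    finally show ?thesis .
  qed
  show ?thesis by (intro exI[of _ K] exI[of _ Bad] conjI ballI impI allI K Bad iff)
qed

end

section \<open>Sets of the enlarged filtration at a fixed time\<close>

abbreviation times_space :: "nat \<Rightarrow> (nat \<Rightarrow> ennreal) measure" where
  "times_space k \<equiv> PiM {..<k} (\<lambda>_. borel)"

definition seen :: "nat \<Rightarrow> real \<Rightarrow> (nat \<Rightarrow> ennreal) \<Rightarrow> nat \<Rightarrow> ennreal" where
  "seen k t u = (\<lambda>j\<in>{..<k}. nmid (u j) (ennreal t))"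

lemma measurable_nmid [measurable]: "(\<lambda>a. nmid a b) \<in> borel_measurable borel"
  unfolding nmid_def by measurable

lemma measurable_seen [measurable]: "seen k t \<in> times_space k \<rightarrow>\<^sub>M times_space k"
proof -
  have "(\<lambda>u. \<lambda>j\<in>{..<k}. nmid (u j) (ennreal t)) \<in> times_space k \<rightarrow>\<^sub>M times_space k"
    by (rule measurable_restrict) measurable
  then show ?thesis by (simp add: seen_def[abs_def])
qed

lemma seen_space: "seen k t u \<in> space (times_space k)"
  unfolding seen_def by (simp add: space_PiM)

text \<open>A coordinate changes only at the time \<open>u j\<close>, and because of the weak
  inequality in \<open>nmid\<close> the new value is already taken there. It is thus a
  right-continuous step function of \<open>t\<close>, and there are finitely many
  coordinates.\<close>

lemma seen_locally_constant:
  assumes t: "0 \<le> t"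
  shows "\<exists>d>t. \<forall>s. t \<le> s \<longrightarrow> s < d \<longrightarrow> seen k s u = seen k t u"
proof -
  have "\<forall>\<^sub>F s in at_right t. nmid (u j) (ennreal s) = nmid (u j) (ennreal t)" for j
  proof -
    have "\<exists>d>t. \<forall>s. t < s \<longrightarrow> s < d \<longrightarrow> nmid (u j) (ennreal s) = nmid (u j) (ennreal t)"
    proof (cases "u j \<le> ennreal t")
      case True
      then show ?thesis
        by (intro exI[of _ "t + 1"])
          (auto simp: nmid_def dest: order_trans[OF True ennreal_leI[OF less_imp_le]])
    next
      case False
      show ?thesis
      proof (cases "u j")
        case (real x)
        then have "t < x" using False t by auto
        then show ?thesis using real t by (intro exI[of _ x]) (auto simp: nmid_def)
      next
        case top
        then show ?thesis using t by (intro exI[of _ "t + 1"]) (auto simp: nmid_def top_unique)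
      qed
    qed
    then show ?thesis unfolding eventually_at_right_field .
  qed
  then have "\<forall>\<^sub>F s in at_right t. \<forall>j\<in>{..<k}. nmid (u j) (ennreal s) = nmid (u j) (ennreal t)"
    by (intro eventually_ball_finite) auto
  then obtain d where d: "d > t" "\<And>s. t < s \<Longrightarrow> s < d \<Longrightarrow> \<forall>j\<in>{..<k}. nmid (u j) (ennreal s) = nmid (u j) (ennreal t)"
    unfolding eventually_at_right_field by blast
  show ?thesis
  proof (intro exI[of _ d] conjI allI impI)
    fix s assume "t \<le> s" "s < d"
    then show "seen k s u = seen k t u"
      using d(2)[of s] by (cases "s = t") (auto simp: seen_def)
  qed (rule d)
qed

locale random_times = usual_filtration M F
  for M :: "'w measure" and F :: "real \<Rightarrow> 'w set set" +
  fixes \<tau> :: "nat \<Rightarrow> 'w \<Rightarrow> ennreal" and m :: nat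
  assumes \<tau>_measurable: "j < m \<Longrightarrow> \<tau> j \<in> borel_measurable M"
begin

abbreviation tv :: "nat \<Rightarrow> real \<Rightarrow> 'w \<Rightarrow> nat \<Rightarrow> ennreal" where
  "tv k t \<omega> \<equiv> seen k t (\<lambda>j. \<tau> j \<omega>)"

definition HH :: "nat \<Rightarrow> 'w set set" where
  "HH k = sigma_sets (space M) ((\<Union>j<k. sig_of M (\<tau> j)) \<union> Finf M F)"

text \<open>The cover must be measurable for the \<sigma>-algebra \<open>HH m\<close> of the times
  and \<open>Finf\<close>: arbitrary null sets of \<open>M\<close> are not in
  \<open>Nk\<close>.\<close>

definition negligible :: "'w set \<Rightarrow> bool" where
  "negligible N \<longleftrightarrow> (\<exists>B\<in>HH m. N \<subseteq> B \<and> B \<in> sets M \<and> emeasure M B = 0)"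

lemma HH_generators_sets:
  assumes "k \<le> m"
  shows "(\<Union>j<k. sig_of M (\<tau> j)) \<union> Finf M F \<subseteq> sets M"
proof -
  have "sig_of M (\<tau> j) \<subseteq> sets M" if "j < k" for j
    using measurable_sets[OF \<tau>_measurable[of j]] that assms unfolding sig_of_def by auto
  then show ?thesis using FI_sets unfolding sets_FI by blast
qed

lemma HH_sets: "k \<le> m \<Longrightarrow> A \<in> HH k \<Longrightarrow> A \<in> sets M"
  unfolding HH_def using sets.sigma_sets_subset[OF HH_generators_sets] by blast

lemma HH_sigma_algebra: "k \<le> m \<Longrightarrow> sigma_algebra (space M) (HH k)"
  unfolding HH_def
  by (rule sigma_algebra_sigma_sets) (use HH_generators_sets[of k] sets.space_closed[of M] in blast)

lemma HH_mono: "k \<le> m \<Longrightarrow> HH k \<subseteq> HH m"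
  unfolding HH_def by (rule sigma_sets_mono') (fastforce intro: less_le_trans)

lemma negligible_UN:
  assumes I: "countable I" and "\<And>i. i \<in> I \<Longrightarrow> negligible (N i)"
  shows "negligible (\<Union>i\<in>I. N i)"
proof -
  interpret H: sigma_algebra "space M" "HH m" by (rule HH_sigma_algebra) simp
  obtain B where B: "\<And>i. i \<in> I \<Longrightarrow> B i \<in> HH m \<and> N i \<subseteq> B i \<and> B i \<in> sets M \<and> emeasure M (B i) = 0"
    using assms(2) unfolding negligible_def by metis
  have "(\<Union>i\<in>I. B i) \<in> HH m" using B by (intro H.countable_UN' I) auto
  moreover have "(\<Union>i\<in>I. B i) \<in> null_sets M" using B by (intro null_sets_UN' I) auto
  moreover have "(\<Union>i\<in>I. N i) \<subseteq> (\<Union>i\<in>I. B i)" using B by blast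
  ultimately show ?thesis unfolding negligible_def by (auto simp: null_sets_def)
qed

lemma negligible_empty: "negligible {}"
  using negligible_UN[of "{}"] by simp

text \<open>Only the sections of \<open>D\<close> are required to lie in \<open>F t\<close>; in contrast to the product
  \<open>\<sigma>\<close>-algebra this is stable under right limits in \<open>t\<close>.\<close>

definition represented :: "nat \<Rightarrow> real \<Rightarrow> 'w set \<Rightarrow> bool" where
  "represented k t C \<longleftrightarrow> (\<exists>D\<in>sets (times_space k \<Otimes>\<^sub>M FI).
     (\<forall>u\<in>space (times_space k). Pair u -` D \<in> F t) \<and>
     (\<exists>N. negligible N \<and> (\<forall>\<omega>\<in>space M - N. \<omega> \<in> C \<longleftrightarrow> (tv k t \<omega>, \<omega>) \<in> D)))"

lemma represented_sigma_sets:
  assumes t: "0 \<le> t" and A: "\<And>a. a \<in> A \<Longrightarrow> represented k t a"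
  shows "C \<in> sigma_sets (space M) A \<Longrightarrow> represented k t C"
proof (induction rule: sigma_sets.induct)
  case (Basic a)
  then show ?case using A by blast
next
  case Empty
  interpret sigma_algebra "space M" "F t" by (rule F_sigma_algebra[OF t])
  show ?case unfolding represented_def
    by (intro bexI[of _ "{}"] conjI exI[of _ "{}"] negligible_empty) auto
next
  case (Compl a)
  interpret sigma_algebra "space M" "F t" by (rule F_sigma_algebra[OF t])
  from Compl obtain D N where D: "D \<in> sets (times_space k \<Otimes>\<^sub>M FI)"
    "\<And>u. u \<in> space (times_space k) \<Longrightarrow> Pair u -` D \<in> F t" and N: "negligible N"
    "\<And>\<omega>. \<omega> \<in> space M - N \<Longrightarrow> \<omega> \<in> a \<longleftrightarrow> (tv k t \<omega>, \<omega>) \<in> D" unfolding represented_def by blast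
  show ?case unfolding represented_def
  proof (intro bexI[of _ "space (times_space k \<Otimes>\<^sub>M FI) - D"] conjI exI[of _ N] ballI)
    fix u assume u: "u \<in> space (times_space k)"
    have "Pair u -` (space (times_space k \<Otimes>\<^sub>M FI) - D) = space M - Pair u -` D"
      using u by (auto simp: space_pair_measure)
    then show "Pair u -` (space (times_space k \<Otimes>\<^sub>M FI) - D) \<in> F t" using D(2)[OF u] by auto
  next
    fix \<omega> assume "\<omega> \<in> space M - N"
    then show "\<omega> \<in> space M - a \<longleftrightarrow> (tv k t \<omega>, \<omega>) \<in> space (times_space k \<Otimes>\<^sub>M FI) - D"
      using N(2)[of \<omega>] seen_space by (auto simp: space_pair_measure)
  qed (use D N in auto)
next
  case (Union a)
  interpret sigma_algebra "space M" "F t" by (rule F_sigma_algebra[OF t])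
  from Union(2) obtain D N where D: "\<And>i. D i \<in> sets (times_space k \<Otimes>\<^sub>M FI)"
    "\<And>i u. u \<in> space (times_space k) \<Longrightarrow> Pair u -` D i \<in> F t" and N: "\<And>i. negligible (N i)"
    "\<And>i \<omega>. \<omega> \<in> space M - N i \<Longrightarrow> \<omega> \<in> a i \<longleftrightarrow> (tv k t \<omega>, \<omega>) \<in> D i"
    unfolding represented_def by metis
  show ?case unfolding represented_def
  proof (intro bexI[of _ "\<Union>i. D i"] conjI exI[of _ "\<Union>i. N i"] ballI)
    show "Pair u -` (\<Union>i. D i) \<in> F t" if "u \<in> space (times_space k)" for u
      unfolding vimage_UN using D(2)[OF that] by (intro countable_UN) auto
    show "negligible (\<Union>i. N i)" using N(1) by (intro negligible_UN) auto
    show "\<omega> \<in> (\<Union>i. a i) \<longleftrightarrow> (tv k t \<omega>, \<omega>) \<in> (\<Union>i. D i)" if "\<omega> \<in> space M - (\<Union>i. N i)" for \<omega>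
      using N(2)[of \<omega>] that by auto
    show "(\<Union>i. D i) \<in> sets (times_space k \<Otimes>\<^sub>M FI)" using D(1) by auto
  qed
qed

text \<open>Along times \<open>s n\<close> decreasing to \<open>t\<close> the lower limit of the
  sets \<open>D n\<close> represents \<open>C\<close>: for each \<omega> the visible vector is
  eventually the one at \<open>t\<close>, and then all \<open>D n\<close> give the same answer. A
  section of the lower limit depends only on a tail of the sequence, so it lies in
  \<open>F s'\<close> for all \<open>s' > t\<close>, hence in \<open>F t\<close>.\<close>

lemma represented_right_limit:
  assumes t: "0 \<le> t" and C: "\<And>s. t < s \<Longrightarrow> represented k s C"
  shows "represented k t C"
proof -
  define s where "s n = t + 1 / Suc n" for n :: nat
  have st: "t < s n" for n unfolding s_def by simp
  have s0: "0 \<le> s n" for n using st[of n] t by simp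
  have s_lt: "\<exists>n0. \<forall>n\<ge>n0. s n < d" if d: "d > t" for d
  proof -
    obtain n0 where n0: "1 / Suc n0 < d - t" using nat_approx_posE[of "d - t"] d by auto
    have "s n < d" if "n \<ge> n0" for n
    proof -
      have "1 / real (Suc n) \<le> 1 / real (Suc n0)" using that by (simp add: frac_le)
      then show ?thesis unfolding s_def using n0 by linarith
    qed
    then show ?thesis by blast
  qed
  obtain D N where D: "\<And>n. D n \<in> sets (times_space k \<Otimes>\<^sub>M FI)"
    "\<And>n u. u \<in> space (times_space k) \<Longrightarrow> Pair u -` D n \<in> F (s n)" and N: "\<And>n. negligible (N n)"
    "\<And>n \<omega>. \<omega> \<in> space M - N n \<Longrightarrow> \<omega> \<in> C \<longleftrightarrow> (tv k (s n) \<omega>, \<omega>) \<in> D n"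
    using C[OF st] unfolding represented_def by metis
  show ?thesis unfolding represented_def
  proof (intro bexI[of _ "\<Union>i. \<Inter>n. D (i + n)"] conjI exI[of _ "\<Union>n. N n"] ballI)
    show "negligible (\<Union>n. N n)" using N(1) by (intro negligible_UN) auto
    show "(\<Union>i. \<Inter>n. D (i + n)) \<in> sets (times_space k \<Otimes>\<^sub>M FI)" using D(1) by auto
  next
    fix u assume u: "u \<in> space (times_space k)"
    show "Pair u -` (\<Union>i. \<Inter>n. D (i + n)) \<in> F t"
    proof (rule F_right_cont[OF t])
      fix s' assume s': "t < s'"
      then interpret sigma_algebra "space M" "F s'" using t by (intro F_sigma_algebra) auto
      obtain n0 where n0: "\<And>n. n \<ge> n0 \<Longrightarrow> s n < s'" using s_lt[OF s'] by blast
      have "Pair u -` (\<Union>i. \<Inter>n. D (i + n)) = (\<Union>i. \<Inter>n. Pair u -` D (n0 + i + n))"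
      proof (intro equalityI subsetI)
        fix \<omega> assume "\<omega> \<in> Pair u -` (\<Union>i. \<Inter>n. D (i + n))"
        then obtain i where i: "\<And>n. (u, \<omega>) \<in> D (i + n)" by auto
        have "(u, \<omega>) \<in> D (n0 + i + n)" for n using i[of "n0 + n"] by (simp add: ac_simps)
        then show "\<omega> \<in> (\<Union>i. \<Inter>n. Pair u -` D (n0 + i + n))" by auto
      qed auto
      also have "\<dots> \<in> F s'"
      proof (intro countable_UN image_subsetI countable_INT)
        fix i n :: nat
        show "Pair u -` D (n0 + i + n) \<in> F s'"
          using n0[of "n0 + i + n"] by (intro F_mono[OF s0 _ D(2)[OF u]]) auto
      qed simp
      finally show "Pair u -` (\<Union>i. \<Inter>n. D (i + n)) \<in> F s'" .
    qed
  next
    fix \<omega> assume \<omega>: "\<omega> \<in> space M - (\<Union>n. N n)"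
    obtain d where d: "d > t" "\<And>s. t \<le> s \<Longrightarrow> s < d \<Longrightarrow> tv k s \<omega> = tv k t \<omega>"
      using seen_locally_constant[OF t] by blast
    obtain n0 where n0: "\<And>n. n \<ge> n0 \<Longrightarrow> s n < d" using s_lt[OF d(1)] by blast
    have eq: "\<omega> \<in> C \<longleftrightarrow> (tv k t \<omega>, \<omega>) \<in> D n" if "n \<ge> n0" for n
      using N(2)[of \<omega> n] \<omega> d(2)[OF less_imp_le[OF st] n0[OF that]] by auto
    show "\<omega> \<in> C \<longleftrightarrow> (tv k t \<omega>, \<omega>) \<in> (\<Union>i. \<Inter>n. D (i + n))"
    proof
      assume "\<omega> \<in> C"
      then have "\<forall>n. (tv k t \<omega>, \<omega>) \<in> D (n0 + n)" using eq by auto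
      then show "(tv k t \<omega>, \<omega>) \<in> (\<Union>i. \<Inter>n. D (i + n))" by blast
    next
      assume "(tv k t \<omega>, \<omega>) \<in> (\<Union>i. \<Inter>n. D (i + n))"
      then obtain i where i: "\<And>n. (tv k t \<omega>, \<omega>) \<in> D (i + n)" by auto
      show "\<omega> \<in> C" using eq[of "i + n0"] i[of n0] by auto
    qed
  qed
qed

lemma represented_Suc:
  assumes "represented k t C"
  shows "represented (Suc k) t C"
proof -
  obtain D N where D: "D \<in> sets (times_space k \<Otimes>\<^sub>M FI)"
    "\<And>u. u \<in> space (times_space k) \<Longrightarrow> Pair u -` D \<in> F t" and N: "negligible N"
    "\<And>\<omega>. \<omega> \<in> space M - N \<Longrightarrow> \<omega> \<in> C \<longleftrightarrow> (tv k t \<omega>, \<omega>) \<in> D" using assms unfolding represented_def by blast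
  define f where "f p = (restrict (fst p) {..<k}, snd p)" for p :: "(nat \<Rightarrow> ennreal) \<times> 'w"
  have f: "f \<in> times_space (Suc k) \<Otimes>\<^sub>M FI \<rightarrow>\<^sub>M times_space k \<Otimes>\<^sub>M FI"
    unfolding f_def by (intro measurable_Pair measurable_compose[OF measurable_fst] measurable_restrict_subset) auto
  show ?thesis unfolding represented_def
  proof (intro bexI[of _ "f -` D \<inter> space (times_space (Suc k) \<Otimes>\<^sub>M FI)"] conjI exI[of _ N] ballI)
    fix u assume u: "u \<in> space (times_space (Suc k))"
    have "restrict u {..<k} \<in> space (times_space k)" using u by (auto simp: space_PiM)
    note D(2)[OF this]
    moreover have "Pair u -` (f -` D \<inter> space (times_space (Suc k) \<Otimes>\<^sub>M FI)) = Pair (restrict u {..<k}) -` D"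
      using u sets.sets_into_space[OF D(1)] unfolding f_def by (auto simp: space_pair_measure)
    ultimately show "Pair u -` (f -` D \<inter> space (times_space (Suc k) \<Otimes>\<^sub>M FI)) \<in> F t" by simp
  next
    fix \<omega> assume \<omega>: "\<omega> \<in> space M - N"
    have "restrict (tv (Suc k) t \<omega>) {..<k} = tv k t \<omega>" unfolding seen_def by (auto simp: restrict_def)
    then show "\<omega> \<in> C \<longleftrightarrow> (tv (Suc k) t \<omega>, \<omega>) \<in> f -` D \<inter> space (times_space (Suc k) \<Otimes>\<^sub>M FI)"
      using N(2)[OF \<omega>] \<omega> seen_space unfolding f_def by (auto simp: space_pair_measure)
  qed (use measurable_sets[OF f D(1)] N in auto)
qed

text \<open>A hidden time is stored as \<top>, whose minimum with \<open>t\<close> is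
  \<open>t\<close>, so the stopped time can be read off the visible vector. As \<open>D\<close>
  ignores \<omega>, its sections are trivial events.\<close>

lemma represented_sig_of:
  assumes t: "0 \<le> t" and C: "C \<in> sig_of M (\<lambda>\<omega>. min (\<tau> k \<omega>) (ennreal t))"
  shows "represented (Suc k) t C"
proof -
  interpret sigma_algebra "space M" "F t" by (rule F_sigma_algebra[OF t])
  obtain B where B [measurable]: "B \<in> sets borel" and CB: "C = (\<lambda>\<omega>. min (\<tau> k \<omega>) (ennreal t)) -` B \<inter> space M"
    using C unfolding sig_of_def by auto
  define D where "D = {p \<in> space (times_space (Suc k) \<Otimes>\<^sub>M FI). min (fst p k) (ennreal t) \<in> B}"
  have [measurable]: "(\<lambda>p. fst p k) \<in> borel_measurable (times_space (Suc k) \<Otimes>\<^sub>M FI)"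
    by (rule measurable_compose[OF measurable_fst measurable_component_singleton]) simp
  show ?thesis unfolding represented_def
  proof (intro bexI[of _ D] conjI exI[of _ "{}"] ballI negligible_empty)
    show "D \<in> sets (times_space (Suc k) \<Otimes>\<^sub>M FI)" unfolding D_def by measurable
    fix u assume u: "u \<in> space (times_space (Suc k))"
    have "Pair u -` D = (if min (u k) (ennreal t) \<in> B then space M else {})"
      unfolding D_def using u by (auto simp: space_pair_measure)
    then show "Pair u -` D \<in> F t" by auto
  next
    fix \<omega> assume \<omega>: "\<omega> \<in> space M - {}"
    have "min (tv (Suc k) t \<omega> k) (ennreal t) = min (\<tau> k \<omega>) (ennreal t)"
      by (auto simp: seen_def nmid_def min_def top_unique)
    then show "\<omega> \<in> C \<longleftrightarrow> (tv (Suc k) t \<omega>, \<omega>) \<in> D"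
      using \<omega> seen_space unfolding D_def CB by (auto simp: space_pair_measure)
  qed
qed

lemma Gk_represented:
  "k \<le> m \<Longrightarrow> 0 \<le> t \<Longrightarrow> C \<in> Gk M F \<tau> k t \<Longrightarrow> represented k t C"
proof (induction k arbitrary: t C)
  case 0
  have eq: "Pair u -` (space (times_space 0) \<times> C) = C" if "u \<in> space (times_space 0)" for u using that by auto
  show ?case unfolding represented_def
    using 0 seen_space[of 0, simplified] eq F_FI[of t C]
    by (intro bexI[of _ "space (times_space 0) \<times> C"] conjI exI[of _ "{}"] ballI negligible_empty) auto
next
  case (Suc k)
  have "represented (Suc k) t B" if B: "B \<in> Nk M F \<tau> (Suc k)" for B
  proof -
    from B have "B \<in> sigma_sets (space M) {N. \<exists>B\<in>HH (Suc k). N \<subseteq> B \<and> B \<in> sets M \<and> measure M B = 0}"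
      unfolding Nk_def null_sa_def HH_def .
    then show ?thesis
    proof (rule represented_sigma_sets[OF Suc.prems(2), rotated])
      \<comment> \<open>A generator is represented by the empty set, with the generator itself as
        exceptional set; complements and unions are left to
        \<open>represented_sigma_sets\<close>.\<close>
      fix a assume "a \<in> {N. \<exists>B\<in>HH (Suc k). N \<subseteq> B \<and> B \<in> sets M \<and> measure M B = 0}"
      then have "negligible a"
        using HH_mono[OF Suc.prems(1)] unfolding negligible_def by (auto simp: emeasure_eq_measure)
      moreover have "{} \<in> F t"
        using F_sigma_algebra[OF Suc.prems(2)] by (metis sigma_algebra.sigma_sets_eq sigma_sets.Empty)
      ultimately show "represented (Suc k) t a" unfolding represented_def
        by (intro bexI[of _ "{}"] conjI exI[of _ a]) (simp_all del: Gk.simps)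
    qed
  qed
  moreover have "represented (Suc k) t B"
    if B: "B \<in> (\<Inter>s\<in>{t<..}. join_sa (space M) (Gk M F \<tau> k s) (sig_of M (\<lambda>\<omega>. min (\<tau> k \<omega>) (ennreal s))))" for B
  proof (rule represented_right_limit[OF Suc.prems(2)])
    fix s assume s: "t < s"
    then have s0: "0 \<le> s" using Suc.prems(2) by simp
    have "B \<in> sigma_sets (space M) (Gk M F \<tau> k s \<union> sig_of M (\<lambda>\<omega>. min (\<tau> k \<omega>) (ennreal s)))"
      using B s unfolding join_sa_def by auto
    then show "represented (Suc k) s B"
    proof (rule represented_sigma_sets[OF s0, rotated])
      fix a assume "a \<in> Gk M F \<tau> k s \<union> sig_of M (\<lambda>\<omega>. min (\<tau> k \<omega>) (ennreal s))"
      then show "represented (Suc k) s a"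
        using represented_Suc[OF Suc.IH[OF _ s0]] represented_sig_of[OF s0] Suc.prems(1) by auto
    qed
  qed
  ultimately have *: "represented (Suc k) t B"
    if "B \<in> Nk M F \<tau> (Suc k) \<union>
      (\<Inter>s\<in>{t<..}. join_sa (space M) (Gk M F \<tau> k s) (sig_of M (\<lambda>\<omega>. min (\<tau> k \<omega>) (ennreal s))))" for B
    using that by blast
  from Suc.prems(3) show ?case
    unfolding Gk.simps join_sa_def[of _ "Nk M F \<tau> (Suc k)"]
    by (rule represented_sigma_sets[OF Suc.prems(2) *, rotated])
qed

end

section \<open>Null sets under the density hypothesis\<close>

context random_times begin

text \<open>The hypothesis makes the joint law of the times and \<omega> absolutely continuous with
  respect to the product of the power of \<mu> and the restriction of \<open>M\<close> to
  \<open>FI\<close>. By Fubini that product does not charge a set with null sections.\<close>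

lemma density_transfer:
  fixes \<mu> :: "ennreal measure" and \<gamma> :: "(nat \<Rightarrow> ennreal) \<Rightarrow> 'w \<Rightarrow> ennreal"
  assumes \<mu>: "prob_space \<mu>" "sets \<mu> = sets borel"
    and \<gamma>: "(\<lambda>(u, \<omega>). \<gamma> u \<omega>) \<in> borel_measurable (PiM {..<m} (\<lambda>_. \<mu>) \<Otimes>\<^sub>M FI)"
    and dens: "\<And>A. A \<in> sets (PiM {..<m} (\<lambda>_. \<mu>)) \<Longrightarrow>
           AE \<omega> in M. nn_cond_exp M FI (\<lambda>\<omega>. indicator A (\<lambda>j\<in>{..<m}. \<tau> j \<omega>)) \<omega>
                     = (\<integral>\<^sup>+ u. \<gamma> u \<omega> * indicator A u \<partial>(PiM {..<m} (\<lambda>_. \<mu>)))"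
    and Bad: "null_sections (times_space m) Bad"
  shows "negligible {\<omega> \<in> space M. (tv m r \<omega>, \<omega>) \<in> Bad}"
proof -
  define P where "P = PiM {..<m} (\<lambda>_. \<mu>)"
  \<comment> \<open>Since \<gamma> is measurable jointly with \<open>FI\<close>, the product measure
    is formed with the restriction of \<open>M\<close> to \<open>FI\<close>.\<close>
  define R where "R = restr_to_subalg M FI"
  define T where "T \<omega> = (\<lambda>j\<in>{..<m}. \<tau> j \<omega>)" for \<omega>
  interpret \<mu>: prob_space \<mu> by fact
  interpret P: prob_space P unfolding P_def by (intro prob_space_PiM \<mu>(1))
  interpret R: finite_measure R
    unfolding R_def using finite_measure_restr_to_subalg[OF subalgebra_FI] by auto
  interpret PR: pair_sigma_finite P R ..
  interpret FI: finite_measure_subalgebra M FI using subalgebra_FI by unfold_locales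
  have sP: "sets P = sets (times_space m)" unfolding P_def using \<mu>(2) by (intro sets_PiM_cong) auto
  have sR: "sets R = sets FI" "space R = space M" unfolding R_def
    using subalgebra_FI by (auto simp: sets_restr_to_subalg space_restr_to_subalg)
  have T [measurable]: "T \<in> M \<rightarrow>\<^sub>M P"
    unfolding measurable_cong_sets[OF refl sP] T_def[abs_def]
    by (rule measurable_restrict) (use \<tau>_measurable in auto)
  have idR [measurable]: "(\<lambda>\<omega>. \<omega>) \<in> M \<rightarrow>\<^sub>M R"
    by (rule measurableI) (use sR FI_sets sets.sets_into_space in \<open>auto simp: Int_absorb2\<close>)
  have sPR: "sets (P \<Otimes>\<^sub>M R) = sets (P \<Otimes>\<^sub>M FI)" using sR(1) by (intro sets_pair_measure_cong) auto
  define g where "g p = \<gamma> (fst p) (snd p)" for p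
  have g [measurable]: "g \<in> borel_measurable (P \<Otimes>\<^sub>M R)"
    by (subst measurable_cong_sets[OF sPR refl]) (use \<gamma> in \<open>simp add: g_def[abs_def] P_def split_beta'\<close>)
  define N1 where "N1 = distr M (P \<Otimes>\<^sub>M R) (\<lambda>\<omega>. (T \<omega>, \<omega>))"
  define N2 where "N2 = density (P \<Otimes>\<^sub>M R) g"
  \<comment> \<open>On \<open>A \<times> C\<close> with \<open>C\<close> in \<open>FI\<close> the
    joint law is the integral over \<open>C\<close> of the conditional probability of
    \<open>A\<close>, into which the density is then substituted.\<close>
  have "N1 = N2"
  proof (rule measure_eqI_generator_eq[where A = "\<lambda>_. space P \<times> space R" and \<Omega> = "space P \<times> space R"])
    let ?E = "{a \<times> b |a b. a \<in> sets P \<and> b \<in> sets R}"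
    show "Int_stable ?E" by (rule Int_stable_pair_measure_generator)
    show "?E \<subseteq> Pow (space P \<times> space R)" by (rule pair_measure_closed)
    show "sets N1 = sigma_sets (space P \<times> space R) ?E" "sets N2 = sigma_sets (space P \<times> space R) ?E"
      unfolding N1_def N2_def by (simp_all add: sets_pair_measure)
    fix X assume "X \<in> ?E"
    then obtain A C where X: "X = A \<times> C" and A [measurable]: "A \<in> sets P" and C [measurable]: "C \<in> sets R" by auto
    have CF [measurable]: "C \<in> sets FI" "C \<in> sets M" using C sR FI_sets by auto
    have im [measurable]: "(\<lambda>\<omega>. indicator A (T \<omega>) :: ennreal) \<in> borel_measurable M" by measurable
    have inner: "(\<lambda>\<omega>. \<integral>\<^sup>+ u. \<gamma> u \<omega> * indicator A u \<partial>P) \<in> borel_measurable R"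
    proof -
      have "(\<lambda>\<omega>. \<integral>\<^sup>+ u. (\<lambda>p. g p * indicator A (fst p)) (u, \<omega>) \<partial>P) \<in> borel_measurable R"
        by measurable
      then show ?thesis by (simp add: g_def)
    qed
    have "emeasure N1 X = emeasure M ((\<lambda>\<omega>. (T \<omega>, \<omega>)) -` (A \<times> C) \<inter> space M)"
      unfolding N1_def X by (intro emeasure_distr) auto
    also have "\<dots> = (\<integral>\<^sup>+\<omega>. indicator ((\<lambda>\<omega>. (T \<omega>, \<omega>)) -` (A \<times> C) \<inter> space M) \<omega> \<partial>M)"
      by (intro nn_integral_indicator[symmetric]) measurable
    also have "\<dots> = (\<integral>\<^sup>+\<omega>. indicator C \<omega> * indicator A (T \<omega>) \<partial>M)"
      by (intro nn_integral_cong) (auto simp: indicator_def)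
    also have "\<dots> = (\<integral>\<^sup>+\<omega>. indicator C \<omega> * nn_cond_exp M FI (\<lambda>\<omega>. indicator A (T \<omega>)) \<omega> \<partial>M)"
      by (intro FI.nn_cond_exp_intg[symmetric]) auto
    also have "\<dots> = (\<integral>\<^sup>+\<omega>. indicator C \<omega> * (\<integral>\<^sup>+ u. \<gamma> u \<omega> * indicator A u \<partial>P) \<partial>M)"
      using dens[of A] A unfolding P_def T_def by (intro nn_integral_cong_AE) auto
    also have "\<dots> = (\<integral>\<^sup>+\<omega>. indicator C \<omega> * (\<integral>\<^sup>+ u. \<gamma> u \<omega> * indicator A u \<partial>P) \<partial>R)"
      unfolding R_def
    proof (intro nn_integral_subalgebra2[symmetric] subalgebra_FI)
      note [measurable] = inner
      show "(\<lambda>\<omega>. indicator C \<omega> * (\<integral>\<^sup>+ u. \<gamma> u \<omega> * indicator A u \<partial>P)) \<in> borel_measurable FI"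
        by (subst measurable_cong_sets[OF sR(1)[symmetric] refl]) measurable
    qed
    also have "\<dots> = (\<integral>\<^sup>+\<omega>. (\<integral>\<^sup>+ u. (\<lambda>p. g p * indicator X p) (u, \<omega>) \<partial>P) \<partial>R)"
    proof (intro nn_integral_cong)
      fix \<omega> assume "\<omega> \<in> space R"
      show "indicator C \<omega> * (\<integral>\<^sup>+ u. \<gamma> u \<omega> * indicator A u \<partial>P) = (\<integral>\<^sup>+ u. (\<lambda>p. g p * indicator X p) (u, \<omega>) \<partial>P)"
        by (cases "\<omega> \<in> C") (auto simp: g_def X indicator_times)
    qed
    also have "\<dots> = (\<integral>\<^sup>+p. g p * indicator X p \<partial>(P \<Otimes>\<^sub>M R))"
      by (intro PR.nn_integral_snd) (auto simp: X)
    also have "\<dots> = emeasure N2 X" unfolding N2_def by (intro emeasure_density[symmetric]) (auto simp: X)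
    finally show "emeasure N1 X = emeasure N2 X" .
  next
    have "prob_space N1" unfolding N1_def by (intro prob_space_distr) auto
    then interpret N1: prob_space N1 .
    show "emeasure N1 (space P \<times> space R) \<noteq> \<infinity>" for i :: nat by simp
  qed auto
  \<comment> \<open>Hiding comes before Fubini: the section of the pulled-back set at
    \<open>u\<close> is the section of \<open>Bad\<close> at \<open>seen m r u\<close>, which is
    null although that vector may contain \<top>.\<close>
  define f where "f p = (seen m r (fst p), snd p)" for p :: "(nat \<Rightarrow> ennreal) \<times> 'w"
  have f: "f \<in> P \<Otimes>\<^sub>M R \<rightarrow>\<^sub>M times_space m \<Otimes>\<^sub>M FI"
  proof -
    have "seen m r \<in> P \<rightarrow>\<^sub>M times_space m" unfolding measurable_cong_sets[OF sP refl] by measurable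
    moreover have "(\<lambda>\<omega>. \<omega>) \<in> R \<rightarrow>\<^sub>M FI" unfolding measurable_cong_sets[OF sR(1) refl] by simp
    ultimately show ?thesis unfolding f_def by measurable
  qed
  define B' where "B' = f -` Bad \<inter> space (P \<Otimes>\<^sub>M R)"
  have B': "B' \<in> sets (P \<Otimes>\<^sub>M R)" unfolding B'_def using Bad f unfolding null_sections_def by (auto intro: measurable_sets)
  have "emeasure (P \<Otimes>\<^sub>M R) B' = (\<integral>\<^sup>+u. emeasure R (Pair u -` B') \<partial>P)"
    by (rule R.emeasure_pair_measure_alt[OF B'])
  also have "\<dots> = (\<integral>\<^sup>+u. 0 \<partial>P)"
  proof (intro nn_integral_cong)
    fix u assume u: "u \<in> space P"
    have eq: "Pair u -` B' = Pair (seen m r u) -` Bad"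
      using u Bad sR sets.sets_into_space unfolding B'_def f_def null_sections_def by (fastforce simp: space_pair_measure)
    have "Pair (seen m r u) -` Bad \<in> sets FI"
      using Bad unfolding null_sections_def by (auto intro: sets_Pair1)
    then show "emeasure R (Pair u -` B') = 0"
      unfolding eq R_def using Bad seen_space unfolding null_sections_def
      by (subst emeasure_restr_to_subalg[OF subalgebra_FI]) auto
  qed
  finally have "B' \<in> null_sets (P \<Otimes>\<^sub>M R)" using B' by (auto intro: null_setsI)
  then have "emeasure N2 B' = 0"
    unfolding N2_def using absolutely_continuousI_density[OF g] unfolding absolutely_continuous_def by auto
  then have "emeasure N1 B' = 0" using \<open>N1 = N2\<close> by simp
  moreover have "emeasure N1 B' = emeasure M {\<omega> \<in> space M. (tv m r \<omega>, \<omega>) \<in> Bad}"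
  proof -
    have seenT: "seen m r (T \<omega>) = tv m r \<omega>" for \<omega> unfolding seen_def T_def by auto
    have "emeasure N1 B' = emeasure M ((\<lambda>\<omega>. (T \<omega>, \<omega>)) -` B' \<inter> space M)"
      unfolding N1_def by (intro emeasure_distr B') auto
    also have "(\<lambda>\<omega>. (T \<omega>, \<omega>)) -` B' \<inter> space M = {\<omega> \<in> space M. (tv m r \<omega>, \<omega>) \<in> Bad}"
      using measurable_space[OF T] sR(2) unfolding B'_def f_def by (auto simp: space_pair_measure seenT)
    finally show ?thesis .
  qed
  ultimately have em0: "emeasure M {\<omega> \<in> space M. (tv m r \<omega>, \<omega>) \<in> Bad} = 0" by simp
  \<comment> \<open>Negligibility asks for more than measure 0: the set has to lie in
    \<open>HH m\<close>, where the times and \<open>FI\<close> are measurable.\<close>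
  let ?H = "sigma (space M) (HH m)"
  have spH: "space ?H = space M" by (simp add: space_measure_of_conv)
  have sH: "sets ?H = HH m" by (rule sigma_algebra.sets_measure_of_eq[OF HH_sigma_algebra]) simp
  have "(\<lambda>\<omega>. \<lambda>j\<in>{..<m}. \<tau> j \<omega>) \<in> ?H \<rightarrow>\<^sub>M times_space m"
  proof (rule measurable_restrict)
    fix j assume "j \<in> {..<m}"
    then have "sig_of M (\<tau> j) \<subseteq> sets ?H" unfolding sH unfolding HH_def by (auto intro!: sigma_sets.Basic)
    then show "\<tau> j \<in> borel_measurable ?H"
      unfolding sig_of_def by (intro measurableI) (auto simp: spH)
  qed
  from measurable_comp[OF this measurable_seen[of m r]] have "(\<lambda>\<omega>. tv m r \<omega>) \<in> ?H \<rightarrow>\<^sub>M times_space m"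
    by (simp add: comp_def seen_def cong: restrict_cong)
  moreover have "(\<lambda>\<omega>. \<omega>) \<in> ?H \<rightarrow>\<^sub>M FI"
  proof (rule measurableI)
    fix A assume A: "A \<in> sets FI"
    then have "A \<in> HH m" unfolding HH_def sets_FI by auto
    then show "(\<lambda>\<omega>. \<omega>) -` A \<inter> space ?H \<in> sets ?H"
      using sets.sets_into_space[OF A] spH sH by (simp add: Int_absorb2)
  qed (simp add: spH)
  ultimately have "(\<lambda>\<omega>. (tv m r \<omega>, \<omega>)) \<in> ?H \<rightarrow>\<^sub>M times_space m \<Otimes>\<^sub>M FI" by measurable
  from measurable_sets[OF this, of Bad] have "{\<omega> \<in> space M. (tv m r \<omega>, \<omega>) \<in> Bad} \<in> HH m"
    using Bad unfolding null_sections_def sH spH by (simp add: vimage_def Int_def conj_commute)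
  then show ?thesis using em0 HH_sets[of m] unfolding negligible_def by blast
qed

end

section \<open>Order statistics\<close>

text \<open>A time at most \<open>t\<close> has position \<open>p < i\<close> in the sorted list,
  because position \<open>i\<close>, counted from 0, already holds the statistic
  \<open>Suc i\<close>, which exceeds \<open>t\<close>. It is then bounded by the statistic
  \<open>i\<close>.\<close>

lemma ostat_between_seen:
  assumes i: "i \<le> m" and t: "ostat m \<tau> i \<omega> \<le> ennreal t" "ennreal t < ostat m \<tau> (Suc i) \<omega>" and j: "j < m"
  shows "nmid (\<tau> j \<omega>) (ostat m \<tau> i \<omega>) = nmid (\<tau> j \<omega>) (ennreal t)"
proof -
  let ?xs = "sort (map (\<lambda>j. \<tau> j \<omega>) [0..<m])"
  have len: "length ?xs = m" by simp
  have "\<tau> j \<omega> \<in> set ?xs" using j by simp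
  then obtain p where p: "p < m" "?xs ! p = \<tau> j \<omega>" unfolding in_set_conv_nth len by blast
  have "\<tau> j \<omega> \<le> ostat m \<tau> i \<omega>" if le: "\<tau> j \<omega> \<le> ennreal t"
  proof -
    have pi: "p < i"
    proof (rule ccontr)
      assume "\<not> p < i"
      then have "?xs ! i \<le> ?xs ! p" using p by (intro sorted_nth_mono) auto
      moreover have im: "i < m" using \<open>\<not> p < i\<close> p by simp
      moreover have "ostat m \<tau> (Suc i) \<omega> = ?xs ! i" using im unfolding ostat_def by simp
      ultimately show False using t(2) le p(2) by (simp add: not_le[symmetric])
    qed
    then have "?xs ! p \<le> ?xs ! (i - 1)" using i by (intro sorted_nth_mono) auto
    then show ?thesis using pi i p unfolding ostat_def by simp
  qed
  then show ?thesis using t(1) unfolding nmid_def by auto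
qed

lemma ostat_mono: "i \<le> i' \<Longrightarrow> ostat m \<tau> i \<omega> \<le> ostat m \<tau> i' \<omega>"
  unfolding ostat_def by (auto intro!: sorted_nth_mono)

text \<open>Ties make some intervals empty; the largest index whose statistic is at most
  \<open>t\<close> avoids them. The conventions 0 and \<top> at the two ends provide such an index
  and close the last interval.\<close>

lemma ex1_ostat_interval:
  shows "\<exists>i\<le>m. (ostat m \<tau> i \<omega> \<le> ennreal t \<and> ennreal t < ostat m \<tau> (Suc i) \<omega>) \<and>
    (\<forall>i'\<le>m. i' \<noteq> i \<longrightarrow> \<not> (ostat m \<tau> i' \<omega> \<le> ennreal t \<and> ennreal t < ostat m \<tau> (Suc i') \<omega>))"
proof -
  define i where "i = Max {i. i \<le> m \<and> ostat m \<tau> i \<omega> \<le> ennreal t}"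
  have fin: "finite {i. i \<le> m \<and> ostat m \<tau> i \<omega> \<le> ennreal t}" by simp
  have "0 \<in> {i. i \<le> m \<and> ostat m \<tau> i \<omega> \<le> ennreal t}" by (simp add: ostat_def)
  then have i: "i \<le> m" "ostat m \<tau> i \<omega> \<le> ennreal t"
    using Max_in[OF fin] unfolding i_def[symmetric] by blast+
  have lt: "ennreal t < ostat m \<tau> (Suc i) \<omega>"
  proof (cases "Suc i \<le> m")
    case True
    then have "\<not> ostat m \<tau> (Suc i) \<omega> \<le> ennreal t"
      using Max_ge[OF fin, of "Suc i"] unfolding i_def[symmetric] by auto
    then show ?thesis by simp
  qed (simp add: ostat_def)
  show ?thesis
  proof (intro exI[of _ i] conjI i lt allI impI)
    fix i' assume "i' \<le> m" "i' \<noteq> i"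
    then show "\<not> (ostat m \<tau> i' \<omega> \<le> ennreal t \<and> ennreal t < ostat m \<tau> (Suc i') \<omega>)"
      using ostat_mono[of "Suc i" i' m \<tau> \<omega>] ostat_mono[of "Suc i'" i m \<tau> \<omega>] i lt
      by (cases "i' < i") (auto simp: not_less not_le)
  qed
qed

section \<open>Splitting of optional sets\<close>

text \<open>The two sides compare \<open>x t\<close> with \<open>a\<close> through the first passages of \<open>x\<close> above \<open>b\<close> and then
  below \<open>c\<close>, observed at admissible rational times only. The admissible times are
  a final segment starting before \<open>t\<close>, or at \<open>t\<close>; the latter occurs when \<open>t\<close> is one of
  the random times.\<close>

lemma cadlag_level_iff_passage:
  fixes x :: "real \<Rightarrow> real"
  assumes t: "0 \<le> t" and right: "continuous (at_right t) x"
    and left: "t > 0 \<Longrightarrow> \<exists>l. (x \<longlongrightarrow> l) (at_left t)"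
    and ok: "\<And>r. r \<in> pos_rat \<Longrightarrow> t \<le> r \<Longrightarrow> ok r"
    and start: "(\<forall>r\<in>pos_rat. r < t \<longrightarrow> \<not> ok r) \<or> (\<exists>e<t. \<forall>r\<in>pos_rat. e < r \<longrightarrow> ok r)"
  shows "a < x t \<longleftrightarrow> (\<exists>q\<in>pos_rat. \<exists>b\<in>\<rat>. \<exists>c\<in>\<rat>. a < c \<and> c < b \<and>
    (\<forall>q1>t. \<exists>r\<in>pos_rat. r < q1 \<and> q \<le> r \<and> ok r \<and> b < x r) \<and>
    (\<exists>q1>t. \<forall>r\<in>pos_rat. r < q1 \<longrightarrow> \<not> (x r < c \<and> (\<exists>r0\<in>pos_rat. r0 \<le> r \<and> q \<le> r0 \<and> ok r0 \<and> b < x r0))))"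
proof
  assume "\<exists>q\<in>pos_rat. \<exists>b\<in>\<rat>. \<exists>c\<in>\<rat>. a < c \<and> c < b \<and>
    (\<forall>q1>t. \<exists>r\<in>pos_rat. r < q1 \<and> q \<le> r \<and> ok r \<and> b < x r) \<and>
    (\<exists>q1>t. \<forall>r\<in>pos_rat. r < q1 \<longrightarrow> \<not> (x r < c \<and> (\<exists>r0\<in>pos_rat. r0 \<le> r \<and> q \<le> r0 \<and> ok r0 \<and> b < x r0)))"
  then obtain q b c q1 where ac: "a < c" and T: "\<And>q1. q1 > t \<Longrightarrow> \<exists>r\<in>pos_rat. r < q1 \<and> q \<le> r \<and> ok r \<and> b < x r"
    and q1: "q1 > t" and S: "\<And>r r0. r \<in> pos_rat \<Longrightarrow> r < q1 \<Longrightarrow> x r < c \<Longrightarrow> r0 \<in> pos_rat \<Longrightarrow> r0 \<le> r \<Longrightarrow> q \<le> r0 \<Longrightarrow> ok r0 \<Longrightarrow> b < x r0 \<Longrightarrow> False"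
    by metis
  \<comment> \<open>If \<open>x t\<close> were at most \<open>a\<close>, then \<open>x\<close> would
    lie below \<open>c\<close> just after \<open>t\<close>. As \<open>b\<close> is passed before
    every \<open>q1 > t\<close>, such a drop would come after a passage, against the second
    condition.\<close>
  show "a < x t"
  proof (rule ccontr)
    assume "\<not> a < x t"
    then have "0 < c - x t" using ac by simp
    then obtain d where d: "d > t" "\<And>s. t < s \<Longrightarrow> s < d \<Longrightarrow> \<bar>x s - x t\<bar> < c - x t"
      using right unfolding continuous_at_right_iff by blast
    obtain r0 where r0: "r0 \<in> pos_rat" "r0 < min q1 d" "q \<le> r0" "ok r0" "b < x r0"
      using T[of "min q1 d"] q1 d(1) by auto
    obtain r where r: "r \<in> pos_rat" "max r0 t < r" "r < min q1 d"
    proof (rule pos_rat_between)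
      show "0 \<le> max r0 t" "max r0 t < min q1 d" using t r0 q1 d(1) by auto
    qed
    have "x r < c" using d(2)[of r] r by auto
    then show False using S[of r r0] r r0 by auto
  qed
next
  assume ax: "a < x t"
  have rat: "\<exists>b\<in>\<rat>. \<exists>c\<in>\<rat>. a < c \<and> c < b \<and> b < y" if y: "a < y" for y
  proof -
    obtain b where b: "b \<in> \<rat>" "a < b" "b < y" using Rats_dense_in_real[OF y] by auto
    obtain c where "c \<in> \<rat>" "a < c" "c < b" using Rats_dense_in_real[OF b(2)] by auto
    then show ?thesis using b by blast
  qed
  have near: "\<exists>d>t. \<forall>s. t \<le> s \<longrightarrow> s < d \<longrightarrow> b < x s" if bx: "b < x t" for b
  proof -
    obtain d where d: "d > t" "\<And>s. t < s \<Longrightarrow> s < d \<Longrightarrow> \<bar>x s - x t\<bar> < x t - b"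
      using right bx unfolding continuous_at_right_iff by (metis diff_gt_0_iff_gt)
    have "b < x s" if "t \<le> s" "s < d" for s
      using d(2)[of s] that bx by (cases "s = t") (auto simp: abs_if split: if_splits)
    then show ?thesis using d(1) by blast
  qed
  have pass: "\<exists>r\<in>pos_rat. r < q1 \<and> q \<le> r \<and> ok r \<and> b < x r"
    if "q \<le> t" "t < q1" "t < d" "\<And>s. t \<le> s \<Longrightarrow> s < d \<Longrightarrow> b < x s" for b d q q1
  proof -
    obtain r where "r \<in> pos_rat" "t < r" "r < min q1 d"
      using pos_rat_between[OF t, of "min q1 d"] \<open>t < q1\<close> \<open>t < d\<close> by auto
    then show ?thesis using that ok by (intro bexI[of _ r]) auto
  qed
  let ?goal = "\<lambda>q b c. (\<forall>q1>t. \<exists>r\<in>pos_rat. r < q1 \<and> q \<le> r \<and> ok r \<and> b < x r) \<and>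
    (\<exists>q1>t. \<forall>r\<in>pos_rat. r < q1 \<longrightarrow> \<not> (x r < c \<and> (\<exists>r0\<in>pos_rat. r0 \<le> r \<and> q \<le> r0 \<and> ok r0 \<and> b < x r0)))"
  have "\<exists>q\<in>pos_rat. \<exists>b\<in>\<rat>. \<exists>c\<in>\<rat>. (a < c \<and> c < b) \<and> ?goal q b c"
  proof (cases "\<forall>r\<in>pos_rat. r < t \<longrightarrow> \<not> ok r")
    case True
    \<comment> \<open>No admissible time precedes \<open>t\<close>, so no passage does either, and
      \<open>q = 0\<close> is allowed.\<close>
    obtain b c where bc: "b \<in> \<rat>" "c \<in> \<rat>" "a < c" "c < b" "b < x t" using rat[OF ax] by blast
    obtain d where d: "d > t" "\<And>s. t \<le> s \<Longrightarrow> s < d \<Longrightarrow> b < x s" using near[OF bc(5)] by blast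
    have "?goal 0 b c"
    proof (intro conjI allI impI exI[of _ d] d(1) ballI notI)
      show "\<exists>r\<in>pos_rat. r < q1 \<and> 0 \<le> r \<and> ok r \<and> b < x r" if "t < q1" for q1
        using pass[OF t that d] .
      fix r assume r: "r \<in> pos_rat" "r < d"
        "x r < c \<and> (\<exists>r0\<in>pos_rat. r0 \<le> r \<and> 0 \<le> r0 \<and> ok r0 \<and> b < x r0)"
      then obtain r0 where "r0 \<in> pos_rat" "r0 \<le> r" "ok r0" by blast
      then have "t \<le> r" using True by (meson linorder_not_le order_trans)
      then show False using d(2)[of r] r bc by auto
    qed
    then show ?thesis using bc by (intro bexI[of _ 0] bexI[of _ b] bexI[of _ c]) auto
  next
    case False
    then have t0: "0 < t" by auto
    obtain e where e: "e < t" "\<And>r. r \<in> pos_rat \<Longrightarrow> e < r \<Longrightarrow> ok r" using start False by blast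
    obtain l where l: "(x \<longlongrightarrow> l) (at_left t)" using left[OF t0] by blast
    show ?thesis
    proof (cases "a < l")
      case True
      \<comment> \<open>With the left limit above \<open>a\<close>, the level \<open>b\<close> is
        put below it too. The path then stays above \<open>b\<close> from \<open>q\<close> up to
        \<open>d\<close>, so no drop below \<open>c\<close> occurs.\<close>
      then obtain b c where bc: "b \<in> \<rat>" "c \<in> \<rat>" "a < c" "c < b" "b < min l (x t)" using rat[of "min l (x t)"] ax by auto
      obtain d where d: "d > t" "\<And>s. t \<le> s \<Longrightarrow> s < d \<Longrightarrow> b < x s" using near[of b] bc(5) by auto
      have "\<forall>\<^sub>F s in at_left t. b < x s" using l bc(5) by (intro order_tendstoD(1)[OF l]) auto
      then obtain e' where e': "e' < t" "\<And>s. e' < s \<Longrightarrow> s < t \<Longrightarrow> b < x s"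
        unfolding eventually_at_left_field by blast
      obtain q where q: "q \<in> pos_rat" "max (max e e') 0 < q" "q < t"
      proof (rule pos_rat_between)
        show "0 \<le> max (max e e') 0" "max (max e e') 0 < t" using t0 e(1) e'(1) by auto
      qed
      have "?goal q b c"
      proof (intro conjI allI impI exI[of _ d] d(1) ballI notI)
        show "\<exists>r\<in>pos_rat. r < q1 \<and> q \<le> r \<and> ok r \<and> b < x r" if "t < q1" for q1
          using pass[OF less_imp_le[OF q(3)] that d] .
        fix r assume r: "r \<in> pos_rat" "r < d"
          "x r < c \<and> (\<exists>r0\<in>pos_rat. r0 \<le> r \<and> q \<le> r0 \<and> ok r0 \<and> b < x r0)"
        then have "q \<le> r" by auto
        then have "b < x r" using d(2)[of r] e'(2)[of r] r(2) q(2) by (cases "t \<le> r") auto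
        then show False using r bc by auto
      qed
      then show ?thesis using bc q by (intro bexI[of _ q] bexI[of _ b] bexI[of _ c]) auto
    next
      case False
      \<comment> \<open>Here the left limit is at most \<open>a < b\<close>, so the path is below
        \<open>b\<close> just before \<open>t\<close> and no passage after \<open>q\<close> happens
        before \<open>t\<close>.\<close>
      obtain b c where bc: "b \<in> \<rat>" "c \<in> \<rat>" "a < c" "c < b" "b < x t" using rat[OF ax] by blast
      obtain d where d: "d > t" "\<And>s. t \<le> s \<Longrightarrow> s < d \<Longrightarrow> b < x s" using near[OF bc(5)] by blast
      have "\<forall>\<^sub>F s in at_left t. x s < b" using False bc by (intro order_tendstoD(2)[OF l]) auto
      then obtain e' where e': "e' < t" "\<And>s. e' < s \<Longrightarrow> s < t \<Longrightarrow> x s < b"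
        unfolding eventually_at_left_field by blast
      obtain q where q: "q \<in> pos_rat" "max e' 0 < q" "q < t"
      proof (rule pos_rat_between)
        show "0 \<le> max e' 0" "max e' 0 < t" using t0 e'(1) by auto
      qed
      have "?goal q b c"
      proof (intro conjI allI impI exI[of _ d] d(1) ballI notI)
        show "\<exists>r\<in>pos_rat. r < q1 \<and> q \<le> r \<and> ok r \<and> b < x r" if "t < q1" for q1
          using pass[OF less_imp_le[OF q(3)] that d] .
        fix r assume r: "r \<in> pos_rat" "r < d"
          "x r < c \<and> (\<exists>r0\<in>pos_rat. r0 \<le> r \<and> q \<le> r0 \<and> ok r0 \<and> b < x r0)"
        then obtain r0 where r0: "r0 \<le> r" "q \<le> r0" "b < x r0" by blast
        then have "t \<le> r0" using e'(2)[of r0] q(2) by (cases "r0 < t") auto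
        then show False using d(2)[of r] r bc r0 by auto
      qed
      then show ?thesis using bc q by (intro bexI[of _ q] bexI[of _ b] bexI[of _ c]) auto
    qed
  qed
  then show "\<exists>q\<in>pos_rat. \<exists>b\<in>\<rat>. \<exists>c\<in>\<rat>. a < c \<and> c < b \<and> ?goal q b c" by (simp only: conj_assoc)
qed

section \<open>Times at which a frozen vector can be the visible one\<close>

text \<open>Hiding at time \<open>r\<close> would leave such a vector unchanged: its finite entries
  have all occurred by \<open>r\<close>.\<close>

definition settled :: "nat \<Rightarrow> real \<Rightarrow> (nat \<Rightarrow> ennreal) \<Rightarrow> bool" where
  "settled m r u \<longleftrightarrow> (\<forall>j<m. u j \<le> ennreal r \<or> u j = \<top>)"

lemma settled_mono: "settled m r u \<Longrightarrow> r \<le> s \<Longrightarrow> settled m s u"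
  unfolding settled_def by (meson ennreal_leI order_trans)

lemma settled_seen: "t \<le> r \<Longrightarrow> settled m r (seen m t v)"
  unfolding settled_def seen_def nmid_def by (auto intro: order_trans ennreal_leI)

text \<open>For \<open>r < t\<close>, a time visible at \<open>t\<close> but not at \<open>r\<close>
  would be a finite entry above \<open>r\<close>.\<close>

lemma seen_eq_of_settled:
  assumes d: "\<forall>s. t \<le> s \<longrightarrow> s < d \<longrightarrow> seen m s v = seen m t v" and r: "r < d" "settled m r (seen m t v)"
  shows "seen m r v = seen m t v"
proof (cases "t \<le> r")
  case True
  then show ?thesis using d r by blast
next
  case False
  then have rt: "ennreal r \<le> ennreal t" by (simp add: ennreal_leI)
  have "nmid (v j) (ennreal r) = nmid (v j) (ennreal t)" if j: "j < m" for j
  proof (cases "v j \<le> ennreal t")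
    case True
    then have "v j \<le> ennreal r \<or> v j = \<top>" using r(2) j unfolding settled_def seen_def nmid_def by auto
    then have "v j \<le> ennreal r" using True by (auto simp: top_unique)
    then show ?thesis using True by (simp add: nmid_def)
  next
    case False
    then show ?thesis using rt by (auto simp: nmid_def dest: order_trans)
  qed
  then show ?thesis unfolding seen_def by (auto intro: restrict_ext)
qed

lemma settled_start:
  assumes t: "0 \<le> t"
  shows "(\<forall>r\<in>pos_rat. r < t \<longrightarrow> \<not> settled m r (seen m t v)) \<or>
    (\<exists>e<t. \<forall>r\<in>pos_rat. e < r \<longrightarrow> settled m r (seen m t v))"
proof (cases "\<exists>j<m. v j = ennreal t")
  case True
  then obtain j where j: "j < m" "v j = ennreal t" by blast
  have "\<not> settled m r (seen m t v)" if "r \<in> pos_rat" "r < t" for r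
    using j that unfolding settled_def seen_def nmid_def by (auto intro!: exI[of _ j] simp: not_le ennreal_less_iff)
  then show ?thesis by blast
next
  case False
  have ex: "\<exists>e<t. \<forall>r. e < r \<longrightarrow> r < t \<longrightarrow> seen m t v j \<le> ennreal r \<or> seen m t v j = \<top>" if j: "j < m" for j
  proof (cases "v j \<le> ennreal t")
    case True
    then have "v j < ennreal t" using False j by (simp add: le_less)
    then obtain x where x: "v j = ennreal x" "0 \<le> x" "x < t"
      by (cases "v j") (auto simp: ennreal_less_iff)
    then show ?thesis using True j by (intro exI[of _ x]) (auto simp: seen_def nmid_def intro: ennreal_leI)
  next
    case False
    then show ?thesis using j by (intro exI[of _ "t - 1"]) (auto simp: seen_def nmid_def)
  qed
  have "\<forall>\<^sub>F r in at_left t. \<forall>j\<in>{..<m}. seen m t v j \<le> ennreal r \<or> seen m t v j = \<top>"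
  proof (intro eventually_ball_finite ballI)
    fix j assume "j \<in> {..<m}"
    then show "\<forall>\<^sub>F r in at_left t. seen m t v j \<le> ennreal r \<or> seen m t v j = \<top>"
      unfolding eventually_at_left_field using ex[of j] by blast
  qed simp
  then obtain e where e: "e < t" "\<And>r. e < r \<Longrightarrow> r < t \<Longrightarrow> settled m r (seen m t v)"
    unfolding eventually_at_left_field settled_def by auto
  have "settled m r (seen m t v)" if "e < r" for r
    using e(2)[OF that] settled_seen[of t r] by (cases "r < t") auto
  then show ?thesis using e(1) by blast
qed

text \<open>The condition also concerns \<open>r\<close> to the left of \<open>t\<close>, so
  agreement is required for all \<open>r < d\<close> and not merely near \<open>t\<close>.\<close>

lemma ex_right_nbhd_cong:
  fixes t d :: real
  assumes "t < d" "\<And>r. r < d \<Longrightarrow> P r \<longleftrightarrow> Q r"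
  shows "(\<exists>q>t. \<forall>r\<in>R. r < q \<longrightarrow> P r) \<longleftrightarrow> (\<exists>q>t. \<forall>r\<in>R. r < q \<longrightarrow> Q r)"
proof -
  have *: "\<exists>q>t. \<forall>r\<in>R. r < q \<longrightarrow> Q r" if PQ: "\<And>r. r < d \<Longrightarrow> P r \<Longrightarrow> Q r" and P: "\<exists>q>t. \<forall>r\<in>R. r < q \<longrightarrow> P r" for P Q
  proof -
    obtain q where "q > t" "\<forall>r\<in>R. r < q \<longrightarrow> P r" using P by blast
    then show ?thesis using assms(1) PQ by (intro exI[of _ "min q d"]) auto
  qed
  show ?thesis using *[of P Q] *[of Q P] assms(2) by blast
qed

context random_times begin

text \<open>The visible vector at \<open>t\<close> replaces the vectors cut at an order statistic,
  so that one set \<open>A'\<close> serves all the intervals of the splitting formula.\<close>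

definition split_representable :: "(real \<times> 'w) set \<Rightarrow> bool" where
  "split_representable A \<longleftrightarrow> (\<exists>A'\<in>sets (times_space m \<Otimes>\<^sub>M opt_measure M F). \<exists>N. negligible N \<and>
     (\<forall>\<omega>\<in>space M - N. \<forall>t\<ge>0. (t, \<omega>) \<in> A \<longleftrightarrow> (tv m t \<omega>, t, \<omega>) \<in> A'))"

lemma split_representable_sigma_sets:
  assumes A: "\<And>a. a \<in> A \<Longrightarrow> split_representable a"
  shows "C \<in> sigma_sets ({0..} \<times> space M) A \<Longrightarrow> split_representable C"
proof (induction rule: sigma_sets.induct)
  case (Basic a)
  then show ?case using A by blast
next
  case Empty
  show ?case unfolding split_representable_def
    by (intro bexI[of _ "{}"] exI[of _ "{}"] conjI negligible_empty) auto
next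
  case (Compl a)
  then obtain A' N where A': "A' \<in> sets (times_space m \<Otimes>\<^sub>M opt_measure M F)" and N: "negligible N"
    "\<And>\<omega> t. \<omega> \<in> space M - N \<Longrightarrow> 0 \<le> t \<Longrightarrow> (t, \<omega>) \<in> a \<longleftrightarrow> (tv m t \<omega>, t, \<omega>) \<in> A'"
    unfolding split_representable_def by blast
  show ?case unfolding split_representable_def
  proof (intro bexI[of _ "space (times_space m \<Otimes>\<^sub>M opt_measure M F) - A'"] exI[of _ N] conjI ballI allI impI N(1))
    fix \<omega> and t :: real assume "\<omega> \<in> space M - N" "0 \<le> t"
    then show "(t, \<omega>) \<in> {0..} \<times> space M - a \<longleftrightarrow>
        (tv m t \<omega>, t, \<omega>) \<in> space (times_space m \<Otimes>\<^sub>M opt_measure M F) - A'"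
      using N(2)[of \<omega> t] seen_space by (auto simp: space_pair_measure space_opt)
  qed (use A' in auto)
next
  case (Union a)
  then obtain A' N where A': "\<And>i. A' i \<in> sets (times_space m \<Otimes>\<^sub>M opt_measure M F)" and N: "\<And>i. negligible (N i)"
    "\<And>i \<omega> t. \<omega> \<in> space M - N i \<Longrightarrow> 0 \<le> t \<Longrightarrow> (t, \<omega>) \<in> a i \<longleftrightarrow> (tv m t \<omega>, t, \<omega>) \<in> A' i"
    unfolding split_representable_def by metis
  show ?case unfolding split_representable_def
  proof (intro bexI[of _ "\<Union>i. A' i"] exI[of _ "\<Union>i. N i"] conjI ballI allI impI)
    show "negligible (\<Union>i. N i)" using N(1) by (intro negligible_UN) auto
    fix \<omega> and t :: real assume "\<omega> \<in> space M - (\<Union>i. N i)" "0 \<le> t"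
    then show "(t, \<omega>) \<in> (\<Union>i. a i) \<longleftrightarrow> (tv m t \<omega>, t, \<omega>) \<in> (\<Union>i. A' i)" using N(2) by auto
  qed (use A' in auto)
qed

lemma settled_sets:
  "{p \<in> space (times_space m \<Otimes>\<^sub>M FI). settled m r (fst p)} \<in> sets (times_space m \<Otimes>\<^sub>M FI)"
proof -
  have "{p \<in> space (times_space m \<Otimes>\<^sub>M FI). \<forall>j\<in>{..<m}. fst p j \<le> ennreal r \<or> fst p j = \<top>}
      \<in> sets (times_space m \<Otimes>\<^sub>M FI)"
  proof (rule sets.sets_Collect_countable_All')
    fix j assume j: "j \<in> {..<m}"
    note [measurable] = measurable_compose[OF measurable_fst measurable_component_singleton[OF j]]
    show "{p \<in> space (times_space m \<Otimes>\<^sub>M FI). fst p j \<le> ennreal r \<or> fst p j = \<top>}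
      \<in> sets (times_space m \<Otimes>\<^sub>M FI)" by measurable
  qed simp
  then show ?thesis unfolding settled_def by (simp add: Ball_def)
qed

lemma represented_family:
  assumes "\<And>r b. r \<in> pos_rat \<Longrightarrow> C r b \<in> Gk M F \<tau> m r"
  shows "\<exists>D N. \<forall>r b. r \<in> pos_rat \<longrightarrow> D r b \<in> sets (times_space m \<Otimes>\<^sub>M FI) \<and>
     (\<forall>u\<in>space (times_space m). Pair u -` D r b \<in> F r) \<and> negligible (N r b) \<and>
     (\<forall>\<omega>\<in>space M - N r b. \<omega> \<in> C r b \<longleftrightarrow> (tv m r \<omega>, \<omega>) \<in> D r b)"
proof -
  have "\<forall>r b. \<exists>D N. r \<in> pos_rat \<longrightarrow> D \<in> sets (times_space m \<Otimes>\<^sub>M FI) \<and>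
     (\<forall>u\<in>space (times_space m). Pair u -` D \<in> F r) \<and> negligible N \<and>
     (\<forall>\<omega>\<in>space M - N. \<omega> \<in> C r b \<longleftrightarrow> (tv m r \<omega>, \<omega>) \<in> D)"
  proof (intro allI)
    fix r b
    show "\<exists>D N. r \<in> pos_rat \<longrightarrow> D \<in> sets (times_space m \<Otimes>\<^sub>M FI) \<and>
     (\<forall>u\<in>space (times_space m). Pair u -` D \<in> F r) \<and> negligible N \<and>
     (\<forall>\<omega>\<in>space M - N. \<omega> \<in> C r b \<longleftrightarrow> (tv m r \<omega>, \<omega>) \<in> D)"
    proof (cases "r \<in> pos_rat")
      case True
      then have "represented m r (C r b)" using Gk_represented[OF order_refl _ assms[OF True]] by auto
      then show ?thesis unfolding represented_def by blast
    qed auto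
  qed
  then show ?thesis by metis
qed

text \<open>The vector visible at \<open>t\<close> is inserted as a frozen parameter into the
  passage criterion. For each choice of \<open>q\<close>, \<open>b\<close>, \<open>c\<close> the
  passage above \<open>b\<close> and the later drop below \<open>c\<close> become stochastic
  intervals with a parameter.\<close>

lemma split_representable_cadlag:
  assumes transfer: "\<And>Bad r. null_sections (times_space m) Bad \<Longrightarrow> negligible {\<omega> \<in> space M. (tv m r \<omega>, \<omega>) \<in> Bad}"
    and X: "adapted M (Gk M F \<tau> m) X" "cadlag M X"
  shows "split_representable {p \<in> {0..} \<times> space M. a < X (fst p) (snd p)}"
proof -
  let ?E = "times_space m"
  have G: "{\<omega> \<in> space M. b < X r \<omega>} \<in> Gk M F \<tau> m r" "{\<omega> \<in> space M. X r \<omega> < b} \<in> Gk M F \<tau> m r"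
    if "r \<in> pos_rat" for r b
  proof -
    have "\<forall>U. open U \<longrightarrow> {\<omega> \<in> space M. X r \<omega> \<in> U} \<in> Gk M F \<tau> m r"
      using X(1) that unfolding adapted_def by blast
    from this[rule_format, of "{b<..}"] this[rule_format, of "{..<b}"]
    show "{\<omega> \<in> space M. b < X r \<omega>} \<in> Gk M F \<tau> m r" "{\<omega> \<in> space M. X r \<omega> < b} \<in> Gk M F \<tau> m r" by simp_all
  qed
  obtain H NH where H_NH: "\<forall>r b. r \<in> pos_rat \<longrightarrow> H r b \<in> sets (?E \<Otimes>\<^sub>M FI) \<and>
     (\<forall>u\<in>space ?E. Pair u -` H r b \<in> F r) \<and> negligible (NH r b) \<and>
     (\<forall>\<omega>\<in>space M - NH r b. \<omega> \<in> {\<omega> \<in> space M. b < X r \<omega>} \<longleftrightarrow> (tv m r \<omega>, \<omega>) \<in> H r b)"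
    using represented_family[of "\<lambda>r b. {\<omega> \<in> space M. b < X r \<omega>}"] G(1) by (atomize_elim) simp
  have H: "H r b \<in> sets (?E \<Otimes>\<^sub>M FI)" "u \<in> space ?E \<Longrightarrow> Pair u -` H r b \<in> F r"
    and NH: "negligible (NH r b)"
      "\<omega> \<in> space M \<Longrightarrow> \<omega> \<notin> NH r b \<Longrightarrow> b < X r \<omega> \<longleftrightarrow> (tv m r \<omega>, \<omega>) \<in> H r b"
    if "r \<in> pos_rat" for r b u \<omega>
    using H_NH[rule_format, OF that, of b] by simp_all
  obtain L NL where L_NL: "\<forall>r b. r \<in> pos_rat \<longrightarrow> L r b \<in> sets (?E \<Otimes>\<^sub>M FI) \<and>
     (\<forall>u\<in>space ?E. Pair u -` L r b \<in> F r) \<and> negligible (NL r b) \<and>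
     (\<forall>\<omega>\<in>space M - NL r b. \<omega> \<in> {\<omega> \<in> space M. X r \<omega> < b} \<longleftrightarrow> (tv m r \<omega>, \<omega>) \<in> L r b)"
    using represented_family[of "\<lambda>r b. {\<omega> \<in> space M. X r \<omega> < b}"] G(2) by (atomize_elim) simp
  have L: "L r b \<in> sets (?E \<Otimes>\<^sub>M FI)" "u \<in> space ?E \<Longrightarrow> Pair u -` L r b \<in> F r"
    and NL: "negligible (NL r b)"
      "\<omega> \<in> space M \<Longrightarrow> \<omega> \<notin> NL r b \<Longrightarrow> X r \<omega> < b \<longleftrightarrow> (tv m r \<omega>, \<omega>) \<in> L r b"
    if "r \<in> pos_rat" for r b u \<omega>
    using L_NL[rule_format, OF that, of b] by simp_all
  \<comment> \<open>\<open>H r b\<close> describes \<open>X r\<close> through the vector visible at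
    \<open>r\<close>; the factor \<open>settled\<close> admits a frozen vector only at times where
    it can be that vector.\<close>
  define eT where "eT q b r = (if q \<le> r then {p \<in> space (?E \<Otimes>\<^sub>M FI). settled m r (fst p)} \<inter> H r b else {})" for q b r
  define eS where "eS q b c r = L r c \<inter> (\<Union>r0\<in>pos_rat \<inter> {..r}. eT q b r0)" for q b c r
  have eT: "eT q b r \<in> sets (?E \<Otimes>\<^sub>M FI)" if "r \<in> pos_rat" for q b r
    unfolding eT_def using settled_sets H(1)[OF that] by auto
  have eTF: "Pair u -` eT q b r \<in> F r" if r: "r \<in> pos_rat" and u: "u \<in> space ?E" for q b r u
  proof -
    interpret sigma_algebra "space M" "F r" using r by (intro F_sigma_algebra) auto
    have "Pair u -` eT q b r = (if q \<le> r \<and> settled m r u then Pair u -` H r b else {})"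
      using u sets.sets_into_space[OF H(1)[OF r, of b]] unfolding eT_def by (auto simp: space_pair_measure)
    then show ?thesis using H(2)[OF r u, of b] by auto
  qed
  have eS: "eS q b c r \<in> sets (?E \<Otimes>\<^sub>M FI)" if "r \<in> pos_rat" for q b c r
    unfolding eS_def using eT L(1)[OF that]
    by (intro sets.Int sets.countable_UN' countable_Int1 countable_pos_rat) auto
  have eSF: "Pair u -` eS q b c r \<in> F r" if r: "r \<in> pos_rat" and u: "u \<in> space ?E" for q b c r u
  proof -
    interpret sigma_algebra "space M" "F r" using r by (intro F_sigma_algebra) auto
    have "Pair u -` eS q b c r = Pair u -` L r c \<inter> (\<Union>r0\<in>pos_rat \<inter> {..r}. Pair u -` eT q b r0)"
      unfolding eS_def by auto
    also have "\<dots> \<in> F r"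
      using L(2)[OF r u] eTF[OF _ u] F_mono[OF _ _ eTF[OF _ u]]
      by (intro Int countable_UN' countable_Int1 countable_pos_rat) auto
    finally show ?thesis .
  qed
  have "\<exists>K B. K \<in> sets (?E \<Otimes>\<^sub>M opt_measure M F) \<and> null_sections ?E B \<and>
    (\<forall>u\<in>space ?E. \<forall>\<omega>\<in>space M. (u, \<omega>) \<notin> B \<longrightarrow> (\<forall>t\<ge>0.
      (u, t, \<omega>) \<in> K \<longleftrightarrow> (\<exists>q1>t. \<forall>r\<in>pos_rat. r < q1 \<longrightarrow> (u, \<omega>) \<notin> eT q b r)))" for q b
    by (rule parametrized_stochastic_interval[OF eT eTF])
  then obtain KT BT where KT: "\<And>q b. KT q b \<in> sets (?E \<Otimes>\<^sub>M opt_measure M F)" and BT: "\<And>q b. null_sections ?E (BT q b)"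
    and KT_iff: "\<And>q b u \<omega> t. u \<in> space ?E \<Longrightarrow> \<omega> \<in> space M \<Longrightarrow> (u, \<omega>) \<notin> BT q b \<Longrightarrow> 0 \<le> t \<Longrightarrow>
      (u, t, \<omega>) \<in> KT q b \<longleftrightarrow> (\<exists>q1>t. \<forall>r\<in>pos_rat. r < q1 \<longrightarrow> (u, \<omega>) \<notin> eT q b r)"
    by metis
  have "\<exists>K B. K \<in> sets (?E \<Otimes>\<^sub>M opt_measure M F) \<and> null_sections ?E B \<and>
    (\<forall>u\<in>space ?E. \<forall>\<omega>\<in>space M. (u, \<omega>) \<notin> B \<longrightarrow> (\<forall>t\<ge>0.
      (u, t, \<omega>) \<in> K \<longleftrightarrow> (\<exists>q1>t. \<forall>r\<in>pos_rat. r < q1 \<longrightarrow> (u, \<omega>) \<notin> eS q b c r)))" for q b c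
    by (rule parametrized_stochastic_interval[OF eS eSF])
  then obtain KS BS where KS: "\<And>q b c. KS q b c \<in> sets (?E \<Otimes>\<^sub>M opt_measure M F)" and BS: "\<And>q b c. null_sections ?E (BS q b c)"
    and KS_iff: "\<And>q b c u \<omega> t. u \<in> space ?E \<Longrightarrow> \<omega> \<in> space M \<Longrightarrow> (u, \<omega>) \<notin> BS q b c \<Longrightarrow> 0 \<le> t \<Longrightarrow>
      (u, t, \<omega>) \<in> KS q b c \<longleftrightarrow> (\<exists>q1>t. \<forall>r\<in>pos_rat. r < q1 \<longrightarrow> (u, \<omega>) \<notin> eS q b c r)"
    by metis
  \<comment> \<open>Off the exceptional sets \<open>KT\<close> is [0, T) and \<open>KS\<close> is
    [0, S), so each term is an interval [T, S).\<close>
  define A' where "A' = (\<Union>q\<in>pos_rat. \<Union>b\<in>\<rat>. \<Union>c\<in>\<rat>. if a < c \<and> c < b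
     then (space (?E \<Otimes>\<^sub>M opt_measure M F) - KT q b) \<inter> KS q b c else {})"
  have A': "A' \<in> sets (?E \<Otimes>\<^sub>M opt_measure M F)"
    unfolding A'_def
    by (intro sets.countable_UN' countable_pos_rat countable_rat image_subsetI)
      (use KT KS in \<open>auto intro: sets.Int\<close>)
  define N1 where "N1 = (\<Union>r\<in>pos_rat. \<Union>b\<in>\<rat>. NH r b)"
  define N2 where "N2 = (\<Union>r\<in>pos_rat. \<Union>b\<in>\<rat>. NL r b)"
  define N3 where "N3 = (\<Union>r\<in>pos_rat. \<Union>q\<in>pos_rat. \<Union>b\<in>\<rat>. {\<omega> \<in> space M. (tv m r \<omega>, \<omega>) \<in> BT q b})"
  define N4 where "N4 = (\<Union>r\<in>pos_rat. \<Union>q\<in>pos_rat. \<Union>b\<in>\<rat>. \<Union>c\<in>\<rat>. {\<omega> \<in> space M. (tv m r \<omega>, \<omega>) \<in> BS q b c})"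
  define N where "N = N1 \<union> N2 \<union> N3 \<union> N4"
  have negl_Un: "negligible (A \<union> B)" if "negligible A" "negligible B" for A B
    using negligible_UN[of "UNIV :: bool set" "\<lambda>i. if i then A else B"] that by (simp add: UNIV_bool Un_commute)
  have N: "negligible N"
    unfolding N_def N1_def N2_def N3_def N4_def
    by (intro negl_Un negligible_UN countable_pos_rat countable_rat NH NL transfer BT BS)
  have "(t, \<omega>) \<in> {p \<in> {0..} \<times> space M. a < X (fst p) (snd p)} \<longleftrightarrow> (tv m t \<omega>, t, \<omega>) \<in> A'"
    if \<omega>: "\<omega> \<in> space M - N" and t: "0 \<le> t" for \<omega> t
  proof -
    let ?u = "tv m t \<omega>"
    obtain d where d: "d > t" "\<forall>s. t \<le> s \<longrightarrow> s < d \<longrightarrow> tv m s \<omega> = ?u"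
      using seen_locally_constant[OF t] by blast
    \<comment> \<open>Uncountably many \<open>t\<close> are reduced to countably many exceptional
      sets: the vector visible at \<open>t\<close> is also the one visible at a slightly later
      rational time.\<close>
    obtain s where s: "s \<in> pos_rat" "t < s" "s < d" using pos_rat_between[OF t d(1)] by blast
    have us: "tv m s \<omega> = ?u" by (rule d(2)[rule_format, OF less_imp_le[OF s(2)] s(3)])
    have uE: "?u \<in> space ?E" by (rule seen_space)
    have \<omega>M: "\<omega> \<in> space M" and notN: "\<omega> \<notin> N1" "\<omega> \<notin> N2" "\<omega> \<notin> N3" "\<omega> \<notin> N4"
      using \<omega> unfolding N_def by simp_all
    have B: "(?u, \<omega>) \<notin> BT q b" "(?u, \<omega>) \<notin> BS q b c" if "q \<in> pos_rat" "b \<in> \<rat>" "c \<in> \<rat>" for q b c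
    proof -
      have "\<not> (\<omega> \<in> space M \<and> (tv m s \<omega>, \<omega>) \<in> BT q b)"
        using notN(3) s(1) that(1,2) unfolding N3_def UN_iff mem_Collect_eq by meson
      moreover have "\<not> (\<omega> \<in> space M \<and> (tv m s \<omega>, \<omega>) \<in> BS q b c)"
        using notN(4) s(1) that unfolding N4_def UN_iff mem_Collect_eq by meson
      ultimately show "(?u, \<omega>) \<notin> BT q b" "(?u, \<omega>) \<notin> BS q b c" using us \<omega>M by simp_all
    qed
    have seen_eq: "tv m r \<omega> = ?u" if "r < d" "settled m r ?u" for r
      using seen_eq_of_settled[OF d(2) that] .
    have eT_iff: "(?u, \<omega>) \<in> eT q b r \<longleftrightarrow> q \<le> r \<and> settled m r ?u \<and> b < X r \<omega>"
      if r: "r \<in> pos_rat" "r < d" and b: "b \<in> \<rat>" for q b r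
    proof -
      have "\<omega> \<notin> NH r b" using notN(1) r(1) b unfolding N1_def UN_iff by meson
      then have "b < X r \<omega> \<longleftrightarrow> (tv m r \<omega>, \<omega>) \<in> H r b" using NH(2)[OF r(1) \<omega>M] by blast
      then show ?thesis
        using seen_eq[OF r(2)] uE \<omega>M unfolding eT_def by (auto simp: space_pair_measure)
    qed
    have eS_iff: "(?u, \<omega>) \<in> eS q b c r \<longleftrightarrow> X r \<omega> < c \<and> (\<exists>r0\<in>pos_rat. r0 \<le> r \<and> q \<le> r0 \<and> settled m r0 ?u \<and> b < X r0 \<omega>)"
      if r: "r \<in> pos_rat" "r < d" and bc: "b \<in> \<rat>" "c \<in> \<rat>" for q b c r
    proof -
      have "\<omega> \<notin> NL r c" using notN(2) r(1) bc unfolding N2_def UN_iff by meson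
      then have l: "X r \<omega> < c \<longleftrightarrow> (tv m r \<omega>, \<omega>) \<in> L r c" using NL(2)[OF r(1) \<omega>M] by blast
      have "(?u, \<omega>) \<in> (\<Union>r0\<in>pos_rat \<inter> {..r}. eT q b r0) \<longleftrightarrow>
        (\<exists>r0\<in>pos_rat. r0 \<le> r \<and> q \<le> r0 \<and> settled m r0 ?u \<and> b < X r0 \<omega>)"
      proof -
        have "(?u, \<omega>) \<in> eT q b r0 \<longleftrightarrow> q \<le> r0 \<and> settled m r0 ?u \<and> b < X r0 \<omega>" if "r0 \<in> pos_rat \<inter> {..r}" for r0
          using that r(2) bc(1) by (intro eT_iff) auto
        then show ?thesis by blast
      qed
      \<comment> \<open>\<open>L\<close> carries no factor \<open>settled\<close>; it is inherited
        from the earlier passage time \<open>r0\<close>.\<close>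
      moreover have "(?u, \<omega>) \<in> L r c \<longleftrightarrow> X r \<omega> < c" if "r0 \<le> r" "settled m r0 ?u" for r0
        using l seen_eq[OF r(2) settled_mono[OF that(2,1)]] by simp
      ultimately show ?thesis unfolding eS_def by blast
    qed
    have kt: "(?u, t, \<omega>) \<in> KT q b \<longleftrightarrow> \<not> (\<forall>q1>t. \<exists>r\<in>pos_rat. r < q1 \<and> q \<le> r \<and> settled m r ?u \<and> b < X r \<omega>)"
      if q: "q \<in> pos_rat" "b \<in> \<rat>" for q b
    proof -
      have "(?u, t, \<omega>) \<in> KT q b \<longleftrightarrow> (\<exists>q1>t. \<forall>r\<in>pos_rat. r < q1 \<longrightarrow> (?u, \<omega>) \<notin> eT q b r)"
        by (rule KT_iff[OF uE \<omega>M B(1)[OF q q(2)] t])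
      \<comment> \<open>The conjunct \<open>r \<in> pos_rat\<close> inside the negation lets the two
        sides agree for every real \<open>r < d\<close>, the form \<open>ex_right_nbhd_cong\<close>
        asks for.\<close>
      also have "\<dots> \<longleftrightarrow> (\<exists>q1>t. \<forall>r\<in>pos_rat. r < q1 \<longrightarrow> \<not> (r \<in> pos_rat \<and> (?u, \<omega>) \<in> eT q b r))" by blast
      also have "\<dots> \<longleftrightarrow> (\<exists>q1>t. \<forall>r\<in>pos_rat. r < q1 \<longrightarrow> \<not> (r \<in> pos_rat \<and> q \<le> r \<and> settled m r ?u \<and> b < X r \<omega>))"
        using eT_iff q(2) by (intro ex_right_nbhd_cong[OF d(1)]) blast
      finally show ?thesis by blast
    qed
    have ks: "(?u, t, \<omega>) \<in> KS q b c \<longleftrightarrow> (\<exists>q1>t. \<forall>r\<in>pos_rat. r < q1 \<longrightarrow>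
        \<not> (X r \<omega> < c \<and> (\<exists>r0\<in>pos_rat. r0 \<le> r \<and> q \<le> r0 \<and> settled m r0 ?u \<and> b < X r0 \<omega>)))"
      if q: "q \<in> pos_rat" "b \<in> \<rat>" "c \<in> \<rat>" for q b c
    proof -
      have "(?u, t, \<omega>) \<in> KS q b c \<longleftrightarrow> (\<exists>q1>t. \<forall>r\<in>pos_rat. r < q1 \<longrightarrow> (?u, \<omega>) \<notin> eS q b c r)"
        by (rule KS_iff[OF uE \<omega>M B(2)[OF q] t])
      also have "\<dots> \<longleftrightarrow> (\<exists>q1>t. \<forall>r\<in>pos_rat. r < q1 \<longrightarrow> \<not> (r \<in> pos_rat \<and> (?u, \<omega>) \<in> eS q b c r))" by blast
      also have "\<dots> \<longleftrightarrow> (\<exists>q1>t. \<forall>r\<in>pos_rat. r < q1 \<longrightarrow> \<not> (r \<in> pos_rat \<and>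
          X r \<omega> < c \<and> (\<exists>r0\<in>pos_rat. r0 \<le> r \<and> q \<le> r0 \<and> settled m r0 ?u \<and> b < X r0 \<omega>)))"
        using eS_iff[OF _ _ q(2,3)] by (intro ex_right_nbhd_cong[OF d(1)]) blast
      finally show ?thesis by blast
    qed
    have "a < X t \<omega> \<longleftrightarrow> (\<exists>q\<in>pos_rat. \<exists>b\<in>\<rat>. \<exists>c\<in>\<rat>. a < c \<and> c < b \<and>
      (\<forall>q1>t. \<exists>r\<in>pos_rat. r < q1 \<and> q \<le> r \<and> settled m r ?u \<and> b < X r \<omega>) \<and>
      (\<exists>q1>t. \<forall>r\<in>pos_rat. r < q1 \<longrightarrow>
        \<not> (X r \<omega> < c \<and> (\<exists>r0\<in>pos_rat. r0 \<le> r \<and> q \<le> r0 \<and> settled m r0 ?u \<and> b < X r0 \<omega>))))"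
      using X(2) \<omega>M t unfolding cadlag_def
      by (intro cadlag_level_iff_passage[OF t _ _ settled_seen settled_start[OF t]]) auto
    also have "\<dots> \<longleftrightarrow> (\<exists>q\<in>pos_rat. \<exists>b\<in>\<rat>. \<exists>c\<in>\<rat>. a < c \<and> c < b \<and> (?u, t, \<omega>) \<notin> KT q b \<and> (?u, t, \<omega>) \<in> KS q b c)"
      by (intro bex_cong refl) (simp only: kt ks not_not)
    also have "\<dots> \<longleftrightarrow> (?u, t, \<omega>) \<in> A'"
    proof -
      have sp: "(?u, t, \<omega>) \<in> space (?E \<Otimes>\<^sub>M opt_measure M F)"
        using uE t \<omega>M by (auto simp: space_pair_measure space_opt)
      show ?thesis unfolding A'_def UN_iff
        by (intro bex_cong refl) (use sp in auto)
    qed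
    finally show ?thesis using t \<omega>M by simp
  qed
  then show ?thesis unfolding split_representable_def using A' N
    by (intro bexI[of _ A'] exI[of _ N] conjI ballI allI impI)
qed

lemma split_representable_optional:
  assumes transfer: "\<And>Bad r. null_sections (times_space m) Bad \<Longrightarrow> negligible {\<omega> \<in> space M. (tv m r \<omega>, \<omega>) \<in> Bad}"
    and A: "A \<in> optional_sets M (Gk M F \<tau> m)"
  shows "split_representable A"
  using A unfolding optional_sets_def
proof (rule split_representable_sigma_sets[rotated])
  fix B assume "B \<in> {{p \<in> {0..} \<times> space M. X (fst p) (snd p) \<in> U} |X U.
      adapted M (Gk M F \<tau> m) X \<and> cadlag M X \<and> open U}"
  then obtain X and U :: "real set" where B: "B = {p \<in> {0..} \<times> space M. X (fst p) (snd p) \<in> U}"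
    and X: "adapted M (Gk M F \<tau> m) X" "cadlag M X" and U: "open U" by blast
  \<comment> \<open>Generating a \<sigma>-algebra from the representable sets lets Borel
    measurability pass from half-lines to the open set \<open>U\<close>.\<close>
  let ?R = "sigma ({0..} \<times> space M) {A. A \<subseteq> {0..} \<times> space M \<and> split_representable A}"
  have sp: "space ?R = {0..} \<times> space M" by (simp add: space_measure_of_conv)
  have sR: "sets ?R = sigma_sets ({0..} \<times> space M) {A. A \<subseteq> {0..} \<times> space M \<and> split_representable A}"
    by (rule sets_measure_of) auto
  have "(\<lambda>p. X (fst p) (snd p)) \<in> borel_measurable ?R"
  proof (rule borel_measurableI_greater)
    fix a
    show "{p \<in> space ?R. a < X (fst p) (snd p)} \<in> sets ?R"
      unfolding sR sp using split_representable_cadlag[OF transfer X] by (intro sigma_sets.Basic) auto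
  qed
  from measurable_sets[OF this, of U] U have "B \<in> sets ?R"
    unfolding B sp by (auto simp: vimage_def Int_def conj_commute)
  then show "split_representable B" unfolding sR
    by (rule split_representable_sigma_sets[rotated]) auto
qed

text \<open>\<open>Y\<close> is rebuilt from its rational level sets as one function of the visible
  vector, the time and \<omega>. The same \<open>H\<close> serves as every \<open>Yi i\<close>,
  because on the interval with index \<open>i\<close> the cut vector is the visible one.\<close>

theorem optional_splitting_of_transfer:
  assumes transfer: "\<And>Bad r. null_sections (times_space m) Bad \<Longrightarrow> negligible {\<omega> \<in> space M. (tv m r \<omega>, \<omega>) \<in> Bad}"
  shows "optional_splitting M F \<tau> m"
  unfolding optional_splitting_def
proof (intro allI impI)
  fix Y :: "real \<Rightarrow> 'w \<Rightarrow> real"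
  assume Y: "(\<lambda>(t, \<omega>). Y t \<omega>) \<in> borel_measurable (opt_measure M (Gk M F \<tau> m))"
  let ?EO = "times_space m \<Otimes>\<^sub>M opt_measure M F"
  have "split_representable {p \<in> {0..} \<times> space M. c < Y (fst p) (snd p)}" for c
  proof (rule split_representable_optional[OF transfer])
    have "{p \<in> space (opt_measure M (Gk M F \<tau> m)). c < (\<lambda>(t, \<omega>). Y t \<omega>) p} \<in> sets (opt_measure M (Gk M F \<tau> m))"
      using Y by measurable
    then show "{p \<in> {0..} \<times> space M. c < Y (fst p) (snd p)} \<in> optional_sets M (Gk M F \<tau> m)"
      by (simp add: space_opt sets_opt split_beta')
  qed
  then have "\<forall>c. \<exists>A N. A \<in> sets ?EO \<and> negligible N \<and>
      (\<forall>\<omega>\<in>space M - N. \<forall>t\<ge>0. c < Y t \<omega> \<longleftrightarrow> (tv m t \<omega>, t, \<omega>) \<in> A)"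
    unfolding split_representable_def by simp blast
  then obtain A N where AN': "\<And>c. A c \<in> sets ?EO \<and> negligible (N c) \<and>
      (\<forall>\<omega>\<in>space M - N c. \<forall>t\<ge>0. c < Y t \<omega> \<longleftrightarrow> (tv m t \<omega>, t, \<omega>) \<in> A c)"
    by metis
  then have A: "\<And>c. A c \<in> sets ?EO" and N: "\<And>c. negligible (N c)" by simp_all
  have AN: "c < Y t \<omega> \<longleftrightarrow> (tv m t \<omega>, t, \<omega>) \<in> A c" if "\<omega> \<in> space M - N c" "0 \<le> t" for c \<omega> t
    using AN'[of c] that by blast
  \<comment> \<open>The supremum may be infinite at points that are not visible vectors of a good
    \<omega>; \<open>real_of_ereal\<close> assigns 0 there.\<close>
  define H where "H p = real_of_ereal (SUP c\<in>\<rat>. if p \<in> A c then ereal c else - \<infinity>)" for p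
  have H: "H \<in> borel_measurable ?EO"
  proof -
    note [measurable] = A
    have "(\<lambda>p. SUP c\<in>\<rat>. if p \<in> A c then ereal c else - \<infinity>) \<in> borel_measurable ?EO"
      by (intro borel_measurable_SUP countable_rat) measurable
    then show ?thesis unfolding H_def by measurable
  qed
  have "negligible (\<Union>c\<in>\<rat>. N c)" using N by (intro negligible_UN countable_rat)
  \<comment> \<open>The measurable cover \<open>B\<close> is itself a generator of
    \<open>Nk M F \<tau> m\<close>, as the splitting formula demands of its exceptional set.\<close>
  then obtain B where B: "B \<in> HH m" "(\<Union>c\<in>\<rat>. N c) \<subseteq> B" "B \<in> sets M" "emeasure M B = 0"
    unfolding negligible_def by blast
  have YH: "Y t \<omega> = H (tv m t \<omega>, t, \<omega>)" if \<omega>: "\<omega> \<in> space M - B" and t: "0 \<le> t" for \<omega> t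
  proof -
    have iff: "(tv m t \<omega>, t, \<omega>) \<in> A c \<longleftrightarrow> c < Y t \<omega>" if "c \<in> \<rat>" for c
      using AN[of \<omega> c t] \<omega> t that B(2) by auto
    have "(SUP c\<in>\<rat>. if (tv m t \<omega>, t, \<omega>) \<in> A c then ereal c else - \<infinity>) = ereal (Y t \<omega>)"
    proof (rule antisym)
      show "(SUP c\<in>\<rat>. if (tv m t \<omega>, t, \<omega>) \<in> A c then ereal c else - \<infinity>) \<le> ereal (Y t \<omega>)"
        by (rule SUP_least) (auto simp: iff)
      show "ereal (Y t \<omega>) \<le> (SUP c\<in>\<rat>. if (tv m t \<omega>, t, \<omega>) \<in> A c then ereal c else - \<infinity>)" (is "_ \<le> ?S")
      proof (rule ccontr)
        assume "\<not> ereal (Y t \<omega>) \<le> ?S"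
        then have "?S < ereal (Y t \<omega>)" by (simp only: not_le)
        from ereal_dense3[OF this] obtain c
          where c: "?S < ereal (real_of_rat c)" "ereal (real_of_rat c) < ereal (Y t \<omega>)" by blast
        have "ereal (real_of_rat c) \<le> ?S"
          using c(2) iff[of "real_of_rat c"] by (intro SUP_upper2[of "real_of_rat c"]) auto
        with c(1) show False by simp
      qed
    qed
    then show ?thesis unfolding H_def by simp
  qed
  have tail: "Y t \<omega> = (\<Sum>i\<le>m. H (\<lambda>j\<in>{..<m}. nmid (\<tau> j \<omega>) (ostat m \<tau> i \<omega>), t, \<omega>) *
      (if ostat m \<tau> i \<omega> \<le> ennreal t \<and> ennreal t < ostat m \<tau> (Suc i) \<omega> then 1 else 0))"
    if \<omega>: "\<omega> \<in> space M - B" and t: "0 \<le> t" for \<omega> t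
  proof -
    obtain i where i: "i \<le> m" "ostat m \<tau> i \<omega> \<le> ennreal t" "ennreal t < ostat m \<tau> (Suc i) \<omega>"
      and other: "\<And>i'. i' \<le> m \<Longrightarrow> i' \<noteq> i \<Longrightarrow> \<not> (ostat m \<tau> i' \<omega> \<le> ennreal t \<and> ennreal t < ostat m \<tau> (Suc i') \<omega>)"
      using ex1_ostat_interval[of m \<tau> \<omega> t] by blast
    have "(\<lambda>j\<in>{..<m}. nmid (\<tau> j \<omega>) (ostat m \<tau> i \<omega>)) = tv m t \<omega>"
      using ostat_between_seen[OF i] unfolding seen_def by (intro restrict_ext) auto
    then have "Y t \<omega> = (\<Sum>i'\<in>{i}. H (\<lambda>j\<in>{..<m}. nmid (\<tau> j \<omega>) (ostat m \<tau> i' \<omega>), t, \<omega>) *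
      (if ostat m \<tau> i' \<omega> \<le> ennreal t \<and> ennreal t < ostat m \<tau> (Suc i') \<omega> then 1 else 0))"
      using YH[OF \<omega> t] i by simp
    also have "\<dots> = (\<Sum>i'\<le>m. H (\<lambda>j\<in>{..<m}. nmid (\<tau> j \<omega>) (ostat m \<tau> i' \<omega>), t, \<omega>) *
      (if ostat m \<tau> i' \<omega> \<le> ennreal t \<and> ennreal t < ostat m \<tau> (Suc i') \<omega> then 1 else 0))"
      using i(1) other by (intro sum.mono_neutral_left) auto
    finally show ?thesis .
  qed
  have BN: "B \<in> Nk M F \<tau> m"
    unfolding Nk_def null_sa_def HH_def[symmetric]
    using B by (intro sigma_sets.Basic) (auto simp: measure_def)
  show "\<exists>Yi. (\<forall>i\<le>m. (\<lambda>(u, t, \<omega>). Yi i u t \<omega>) \<in> borel_measurable ?EO) \<and>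
      (\<exists>N\<in>Nk M F \<tau> m. (\<exists>B\<in>sets M. N \<subseteq> B \<and> prob B = 0) \<and>
        (\<forall>\<omega>\<in>space M - N. \<forall>t\<ge>0. Y t \<omega> =
          (\<Sum>i\<le>m. Yi i (\<lambda>j\<in>{..<m}. nmid (\<tau> j \<omega>) (ostat m \<tau> i \<omega>)) t \<omega> *
            (if ostat m \<tau> i \<omega> \<le> ennreal t \<and> ennreal t < ostat m \<tau> (Suc i) \<omega> then 1 else 0))))"
  proof (intro exI[of _ "\<lambda>i u t \<omega>. H (u, t, \<omega>)"] conjI allI impI bexI[of _ B] ballI BN tail)
    show "(\<lambda>(u, t, \<omega>). H (u, t, \<omega>)) \<in> borel_measurable ?EO" using H by simp
    show "prob B = 0" using B(4) by (simp add: measure_def)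
  qed (use B in auto)
qed

end

theorem mainTheorem16:
  fixes M :: "'w measure"
    and F :: "real \<Rightarrow> 'w set set"
    and \<tau> :: "nat \<Rightarrow> 'w \<Rightarrow> ennreal"
    and m :: nat
    and \<mu> :: "ennreal measure"
    and \<gamma> :: "(nat \<Rightarrow> ennreal) \<Rightarrow> 'w \<Rightarrow> ennreal"
  assumes "prob_space M"
    and "std_filtration M F"
    and "right_continuous_filtration F"
    and "null_sa M (Finf M F) \<subseteq> F 0"
    and "\<And>j. j < m \<Longrightarrow> \<tau> j \<in> borel_measurable M"
    and "prob_space \<mu>" and "sets \<mu> = sets borel"
    and "(\<lambda>(u, \<omega>). \<gamma> u \<omega>) \<in>
           borel_measurable (PiM {..<m} (\<lambda>_. \<mu>) \<Otimes>\<^sub>M sigma (space M) (Finf M F))"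
    and "\<And>A. A \<in> sets (PiM {..<m} (\<lambda>_. \<mu>)) \<Longrightarrow>
           AE \<omega> in M. nn_cond_exp M (sigma (space M) (Finf M F))
                         (\<lambda>\<omega>. indicator A (\<lambda>j\<in>{..<m}. \<tau> j \<omega>)) \<omega>
                     = (\<integral>\<^sup>+ u. \<gamma> u \<omega> * indicator A u \<partial>(PiM {..<m} (\<lambda>_. \<mu>)))"
  shows "optional_splitting M F \<tau> m"
proof -
  interpret random_times M F \<tau> m
    by (intro random_times.intro usual_filtration.intro usual_filtration_axioms.intro
        random_times_axioms.intro assms)
  show ?thesis
    using density_transfer[OF assms(6-9)] by (rule optional_splitting_of_transfer)
qed

end
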